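(* Let $H$ be a separable infinite-dimensional Hilbert space, let $(\mathcal{M},\tau)$ be a finite von Neumann algebra acting on $H$, let $V_0$ be a (possibly unbounded) self-adjoint operator on $H$ with $V_0\in L^0(\mathcal{M},\tau)$, let $\xi_0\in H$, and put $U^t=e^{-\frac{i}{\hbar}tV_0}$. Suppose that a vector $\xi\in H$ is reachable at some time $T>0$ for a parameter $N>0$. Then there exists an admissible control function with bound $N$ for which the system reaches $\xi$ in minimal time; that is, with $$T^*=\inf\{S : \text{there is } \xi_S\in\mathcal{R}^N(S)\text{ with }\xi=U^S\xi_0+\xi_S\},$$ there exists $V\in\mathcal{E}^N[0,T^*]$ such that $$\xi=U^{T^*}\xi_0+\int_0^{T^*}U^{T^*-s}V(s)U^s\xi_0\,ds .$$
   Context: A finite von Neumann algebra $(\mathcal{M},\tau)$ is a von Neumann algebra $\mathcal{M}\subseteq\mathcal{B}(H)$ (with unit $I_H$) together with a faithful normal tracial state $\tau$. A closed densely defined operator $a$ on $H$ is affiliated with $\mathcal{M}$ if $ua=au$ for every unitary $u$ in the commutant $\mathcal{M}'$; $L^0(\mathcal{M},\tau)$ is the set of all closed densely defined operators affiliated with $\mathcal{M}$. Here $\hbar>0$ is a fixed constant. A control function on $[0,S]$ is a family of self-adjoint operators $V(t)\in L^0(\mathcal{M},\tau)$, $t\in[0,S]$. It is admissible with bound $N$ if $V(t)\in\mathcal{M}$ for all $t\in[0,S]$ and the map $t\mapsto V(t)$ is (i) measurable, (ii) strongly continuous on $H$, and (iii) satisfies $\|V(t)\|\le N$ for all $t\in[0,S]$.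 The set of all such control functions is $\mathcal{E}^N[0,S]$. The reachable set at time $S$ for parameter $N$ is $$\mathcal{R}^N(S)=\Big\{\int_0^S U^{S-s}V(s)U^s\xi_0\,ds : V\in\mathcal{E}^N[0,S]\Big\}\subseteq H .$$ A vector $\xi\in H$ is reachable at time $S$ for parameter $N$ if there is $\xi_S\in\mathcal{R}^N(S)$ with $\xi=U^S\xi_0+\xi_S$. *)

theory Defs
  imports "HOL-Analysis.Analysis"
begin

section \<open>Complex Hilbert spaces\<close>

text \<open>
  A complex Hilbert space is a real Hilbert space of the library together with a complex
  scalar multiplication and a complex inner product (linear in the first argument) that
  extend the real ones. In particular the norm, the topology and the integral are those of
  the library classes.
\<close>

class complex_hilbert = real_inner + banach +
  fixes scaleC :: "complex \<Rightarrow> 'a \<Rightarrow> 'a"  (infixr \<open>*\<^sub>C\<close> 75)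
    and cinner :: "'a \<Rightarrow> 'a \<Rightarrow> complex"
  assumes scaleC_add_right: "c *\<^sub>C (x + y) = c *\<^sub>C x + c *\<^sub>C y"
    and scaleC_add_left: "(c + d) *\<^sub>C x = c *\<^sub>C x + d *\<^sub>C x"
    and scaleC_scaleC: "c *\<^sub>C (d *\<^sub>C x) = (c * d) *\<^sub>C x"
    and scaleC_of_real: "complex_of_real r *\<^sub>C x = r *\<^sub>R x"
    and cinner_commute: "cinner x y = cnj (cinner y x)"
    and cinner_add_left: "cinner (x + y) z = cinner x z + cinner y z"
    and cinner_scaleC_left: "cinner (c *\<^sub>C x) y = c * cinner x y"
    and Re_cinner: "Re (cinner x y) = inner x y"

interpretation complex_vector: vector_space "scaleC :: complex \<Rightarrow> 'h \<Rightarrow> 'h::complex_hilbert"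
proof
  fix x :: 'h
  show "1 *\<^sub>C x = x"
    using scaleC_of_real[of 1 x] by simp
qed (simp_all add: scaleC_add_right scaleC_add_left scaleC_scaleC)

definition separable_hilbert :: "'h::complex_hilbert itself \<Rightarrow> bool" where
  "separable_hilbert _ \<longleftrightarrow> (\<exists>B :: 'h set. countable B \<and> closure B = UNIV)"

definition infinite_dimensional :: "'h::complex_hilbert itself \<Rightarrow> bool" where
  "infinite_dimensional _ \<longleftrightarrow> \<not> (\<exists>B :: 'h set. finite B \<and> complex_vector.span B = UNIV)"


section \<open>Bounded operators and von Neumann algebras\<close>

definition bounded_clinear :: "('h::complex_hilbert \<Rightarrow> 'h) \<Rightarrow> bool" where
  "bounded_clinear T \<longleftrightarrow> bounded_linear T \<and> (\<forall>c x. T (c *\<^sub>C x) = c *\<^sub>C T x)"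

definition adj :: "('h::complex_hilbert \<Rightarrow> 'h) \<Rightarrow> ('h \<Rightarrow> 'h)" where
  "adj T = (THE S. \<forall>x y. cinner (T x) y = cinner x (S y))"

definition unitary_op :: "('h::complex_hilbert \<Rightarrow> 'h) \<Rightarrow> bool" where
  "unitary_op u \<longleftrightarrow> bounded_clinear u \<and> u \<circ> adj u = id \<and> adj u \<circ> u = id"

definition positive_op :: "('h::complex_hilbert \<Rightarrow> 'h) \<Rightarrow> bool" where
  "positive_op T \<longleftrightarrow> bounded_clinear T \<and> (\<forall>x. cinner (T x) x \<in> \<real>\<^sub>\<ge>\<^sub>0)"

definition op_le :: "('h::complex_hilbert \<Rightarrow> 'h) \<Rightarrow> ('h \<Rightarrow> 'h) \<Rightarrow> bool" where
  "op_le S T \<longleftrightarrow> positive_op (\<lambda>x. T x - S x)"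

definition commutant :: "('h::complex_hilbert \<Rightarrow> 'h) set \<Rightarrow> ('h \<Rightarrow> 'h) set" where
  "commutant M = {T. bounded_clinear T \<and> (\<forall>a\<in>M. T \<circ> a = a \<circ> T)}"

text \<open>
  Dixmier's definition: a self-adjoint set of bounded operators that equals its double
  commutant. Being a commutant, such a set is a subalgebra and contains the identity.
\<close>

definition von_neumann_algebra :: "('h::complex_hilbert \<Rightarrow> 'h) set \<Rightarrow> bool" where
  "von_neumann_algebra M \<longleftrightarrow>
     (\<forall>a\<in>M. bounded_clinear a) \<and> (\<forall>a\<in>M. adj a \<in> M) \<and> commutant (commutant M) = M"

definition state_on :: "('h::complex_hilbert \<Rightarrow> 'h) set \<Rightarrow> (('h \<Rightarrow> 'h) \<Rightarrow> complex) \<Rightarrow> bool" where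
  "state_on M \<tau> \<longleftrightarrow>
     (\<forall>a\<in>M. \<forall>b\<in>M. \<tau> (\<lambda>x. a x + b x) = \<tau> a + \<tau> b) \<and>
     (\<forall>c. \<forall>a\<in>M. \<tau> (\<lambda>x. c *\<^sub>C a x) = c * \<tau> a) \<and>
     (\<forall>a\<in>M. positive_op a \<longrightarrow> \<tau> a \<in> \<real>\<^sub>\<ge>\<^sub>0) \<and>
     \<tau> id = 1"

definition tracial_on :: "('h::complex_hilbert \<Rightarrow> 'h) set \<Rightarrow> (('h \<Rightarrow> 'h) \<Rightarrow> complex) \<Rightarrow> bool" where
  "tracial_on M \<tau> \<longleftrightarrow> (\<forall>a\<in>M. \<forall>b\<in>M. \<tau> (a \<circ> b) = \<tau> (b \<circ> a))"

definition faithful_on :: "('h::complex_hilbert \<Rightarrow> 'h) set \<Rightarrow> (('h \<Rightarrow> 'h) \<Rightarrow> complex) \<Rightarrow> bool" where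
  "faithful_on M \<tau> \<longleftrightarrow> (\<forall>a\<in>M. positive_op a \<and> \<tau> a = 0 \<longrightarrow> a = (\<lambda>x. 0))"

text \<open>
  Normality is preservation of suprema of increasing nets of positive elements; such a net
  is given by its range, an upward directed set \<open>D\<close>, and \<open>s\<close> is its least upper bound in \<open>M\<close>.
\<close>

definition normal_on :: "('h::complex_hilbert \<Rightarrow> 'h) set \<Rightarrow> (('h \<Rightarrow> 'h) \<Rightarrow> complex) \<Rightarrow> bool" where
  "normal_on M \<tau> \<longleftrightarrow>
     (\<forall>D s. D \<noteq> {} \<and> D \<subseteq> {a \<in> M. positive_op a} \<and>
        (\<forall>a\<in>D. \<forall>b\<in>D. \<exists>c\<in>D. op_le a c \<and> op_le b c) \<and>
        s \<in> M \<and> (\<forall>a\<in>D. op_le a s) \<and>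
        (\<forall>b\<in>M. (\<forall>a\<in>D. op_le a b) \<longrightarrow> op_le s b)
        \<longrightarrow> Re (\<tau> s) = (SUP a\<in>D. Re (\<tau> a)))"

definition finite_von_neumann_algebra ::
    "('h::complex_hilbert \<Rightarrow> 'h) set \<Rightarrow> (('h \<Rightarrow> 'h) \<Rightarrow> complex) \<Rightarrow> bool" where
  "finite_von_neumann_algebra M \<tau> \<longleftrightarrow>
     von_neumann_algebra M \<and> state_on M \<tau> \<and> tracial_on M \<tau> \<and> faithful_on M \<tau> \<and> normal_on M \<tau>"


section \<open>Unbounded operators\<close>

text \<open>
  A possibly unbounded operator is represented by its graph, so equality of operators
  includes equality of their domains, and the domain is the library's \<^const>\<open>Domain\<close>.
\<close>

type_synonym 'h unbounded_op = "('h \<times> 'h) set"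

definition graph_of :: "('h \<Rightarrow> 'h) \<Rightarrow> 'h unbounded_op" where
  "graph_of T = {(x, T x) | x. True}"

definition linear_op :: "'h::complex_hilbert unbounded_op \<Rightarrow> bool" where
  "linear_op A \<longleftrightarrow> single_valued A \<and> (0, 0) \<in> A \<and>
     (\<forall>x y x' y'. (x, y) \<in> A \<and> (x', y') \<in> A \<longrightarrow> (x + x', y + y') \<in> A) \<and>
     (\<forall>c x y. (x, y) \<in> A \<longrightarrow> (c *\<^sub>C x, c *\<^sub>C y) \<in> A)"

definition densely_defined :: "'h::complex_hilbert unbounded_op \<Rightarrow> bool" where
  "densely_defined A \<longleftrightarrow> closure (Domain A) = UNIV"

definition op_adjoint :: "'h::complex_hilbert unbounded_op \<Rightarrow> 'h unbounded_op" where
  "op_adjoint A = {(y, z). \<forall>(x, w)\<in>A. cinner w y = cinner x z}"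

definition self_adjoint_op :: "'h::complex_hilbert unbounded_op \<Rightarrow> bool" where
  "self_adjoint_op A \<longleftrightarrow> linear_op A \<and> densely_defined A \<and> op_adjoint A = A"

text \<open>
  In terms of graphs the product \<open>uA\<close> (first \<open>A\<close>, then \<open>u\<close>) is \<open>A O graph_of u\<close>.
\<close>

definition affiliated :: "'h::complex_hilbert unbounded_op \<Rightarrow> ('h \<Rightarrow> 'h) set \<Rightarrow> bool" where
  "affiliated A M \<longleftrightarrow>
     (\<forall>u\<in>commutant M. unitary_op u \<longrightarrow> A O graph_of u = graph_of u O A)"

definition L0 :: "('h::complex_hilbert \<Rightarrow> 'h) set \<Rightarrow> 'h unbounded_op set" where
  "L0 M = {A. linear_op A \<and> closed A \<and> densely_defined A \<and> affiliated A M}"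


section \<open>Functional calculus of self-adjoint operators\<close>

definition projection_valued_measure :: "(real set \<Rightarrow> 'h::complex_hilbert \<Rightarrow> 'h) \<Rightarrow> bool" where
  "projection_valued_measure E \<longleftrightarrow>
     (\<forall>B\<in>sets borel. bounded_clinear (E B) \<and> E B \<circ> E B = E B \<and> adj (E B) = E B) \<and>
     E UNIV = id \<and>
     (\<forall>B\<in>sets borel. \<forall>C\<in>sets borel. E (B \<inter> C) = E B \<circ> E C) \<and>
     (\<forall>B :: nat \<Rightarrow> real set. range B \<subseteq> sets borel \<and> disjoint_family B
        \<longrightarrow> (\<forall>x. (\<lambda>n. E (B n) x) sums E (\<Union>n. B n) x))"

text \<open>The finite Borel measure \<open>B \<mapsto> \<langle>E(B)x, x\<rangle>\<close>.\<close>

definition scalar_measure :: "(real set \<Rightarrow> 'h::complex_hilbert \<Rightarrow> 'h) \<Rightarrow> 'h \<Rightarrow> real measure" where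
  "scalar_measure E x = measure_of UNIV (sets borel) (\<lambda>B. ennreal (Re (cinner (E B x) x)))"

text \<open>
  The operator \<open>\<integral> f dE\<close> for bounded Borel \<open>f\<close>; over the complex numbers an operator is
  determined by its quadratic form.
\<close>

definition spectral_integral ::
    "(real set \<Rightarrow> 'h::complex_hilbert \<Rightarrow> 'h) \<Rightarrow> (real \<Rightarrow> complex) \<Rightarrow> 'h \<Rightarrow> 'h" where
  "spectral_integral E f =
     (THE T. bounded_clinear T \<and> (\<forall>x. cinner (T x) x = (\<integral>l. f l \<partial>scalar_measure E x)))"

text \<open>
  \<open>A = \<integral> \<lambda> dE(\<lambda>)\<close>, with domain the vectors \<open>x\<close> for which \<open>\<integral> \<lambda>\<^sup>2 d\<langle>E x, x\<rangle>\<close> is finite.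
\<close>

definition is_spectral_measure ::
    "'h::complex_hilbert unbounded_op \<Rightarrow> (real set \<Rightarrow> 'h \<Rightarrow> 'h) \<Rightarrow> bool" where
  "is_spectral_measure A E \<longleftrightarrow> projection_valued_measure E \<and>
     Domain A = {x. integrable (scalar_measure E x) (\<lambda>l. l\<^sup>2)} \<and>
     (\<forall>(x, y)\<in>A. cinner y x = complex_of_real (\<integral>l. l \<partial>scalar_measure E x))"

text \<open>
  By the spectral theorem a self-adjoint operator has a spectral measure, and it is unique
  on the Borel sets; the choice below is only about its values on other sets.
\<close>

definition spectral_measure :: "'h::complex_hilbert unbounded_op \<Rightarrow> real set \<Rightarrow> 'h \<Rightarrow> 'h" where
  "spectral_measure A = (SOME E. is_spectral_measure A E)"

definition fun_calc :: "'h::complex_hilbert unbounded_op \<Rightarrow> (real \<Rightarrow> complex) \<Rightarrow> 'h \<Rightarrow> 'h" where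
  "fun_calc A f = spectral_integral (spectral_measure A) f"

definition evolution :: "real \<Rightarrow> 'h::complex_hilbert unbounded_op \<Rightarrow> real \<Rightarrow> 'h \<Rightarrow> 'h" where
  "evolution hbar V0 t =
     fun_calc V0 (\<lambda>l. exp (- (\<i> / complex_of_real hbar) * complex_of_real t * complex_of_real l))"


section \<open>Control functions and reachability\<close>

definition control_function ::
    "('h::complex_hilbert \<Rightarrow> 'h) set \<Rightarrow> real \<Rightarrow> (real \<Rightarrow> 'h unbounded_op) \<Rightarrow> bool" where
  "control_function M S V \<longleftrightarrow> (\<forall>t\<in>{0..S}. self_adjoint_op (V t) \<and> V t \<in> L0 M)"

text \<open>
  Admissible controls take values in \<open>M\<close>, so they are given as families of everywhere
  defined operators; values outside \<open>[0, S]\<close> are irrelevant.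
\<close>

definition admissible_controls ::
    "('h::complex_hilbert \<Rightarrow> 'h) set \<Rightarrow> real \<Rightarrow> real \<Rightarrow> (real \<Rightarrow> 'h \<Rightarrow> 'h) set" where
  "admissible_controls M N S =
     {V. control_function M S (\<lambda>t. graph_of (V t)) \<and>
         (\<forall>t\<in>{0..S}. V t \<in> M) \<and>
         (\<forall>x. (\<lambda>t. V t x) \<in> borel_measurable (lebesgue_on {0..S})) \<and>
         (\<forall>x. continuous_on {0..S} (\<lambda>t. V t x)) \<and>
         (\<forall>t\<in>{0..S}. onorm (V t) \<le> N)}"

definition control_integral ::
    "real \<Rightarrow> 'h::complex_hilbert unbounded_op \<Rightarrow> 'h \<Rightarrow> real \<Rightarrow> (real \<Rightarrow> 'h \<Rightarrow> 'h) \<Rightarrow> 'h" where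
  "control_integral hbar V0 \<xi>0 S V =
     integral {0..S} (\<lambda>s. evolution hbar V0 (S - s) (V s (evolution hbar V0 s \<xi>0)))"

definition reachable_set ::
    "real \<Rightarrow> ('h::complex_hilbert \<Rightarrow> 'h) set \<Rightarrow> 'h unbounded_op \<Rightarrow> 'h \<Rightarrow> real \<Rightarrow> real \<Rightarrow> 'h set" where
  "reachable_set hbar M V0 \<xi>0 N S = control_integral hbar V0 \<xi>0 S ` admissible_controls M N S"

definition reachable ::
    "real \<Rightarrow> ('h::complex_hilbert \<Rightarrow> 'h) set \<Rightarrow> 'h unbounded_op \<Rightarrow> 'h \<Rightarrow> real \<Rightarrow> real \<Rightarrow> 'h \<Rightarrow> bool" where
  "reachable hbar M V0 \<xi>0 N S \<xi> \<longleftrightarrow>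
     (\<exists>\<xi>S\<in>reachable_set hbar M V0 \<xi>0 N S. \<xi> = evolution hbar V0 S \<xi>0 + \<xi>S)"

end

theory Submission
  imports Defs "HOL-Probability.Probability"
begin

text \<open>
  Write \<open>U\<^sup>t\<close> for the evolution group. Since \<open>V\<^sub>0\<close> is affiliated with \<open>M\<close>, every \<open>U\<^sup>t\<close> lies in \<open>M\<close>,
  so \<open>A = \<integral> U\<^sup>-\<^sup>s V(s) U\<^sup>s ds\<close> is a self-adjoint element of \<open>M\<close> with norm at most \<open>N S\<close>, and the control
  integral is \<open>U\<^sup>S A \<xi>\<^sub>0\<close>. Conversely each such \<open>A\<close> comes from the strongly continuous control
  \<open>V(s) = U\<^sup>s (A / S) U\<^sup>-\<^sup>s\<close>. Hence \<open>\<xi>\<close> is reachable at time \<open>S\<close> iff \<open>U\<^sup>-\<^sup>S \<xi> - \<xi>\<^sub>0 = A \<xi>\<^sub>0\<close> for some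
  self-adjoint \<open>A\<close> in \<open>M\<close> with \<open>\<parallel>A\<parallel> \<le> N S\<close>, and this condition passes to the limit along a minimizing
  sequence of times because balls of \<open>M\<close> are compact in the weak operator topology.

  The properties of \<open>U\<^sup>t\<close> require the spectral theorem. A unitary operator \<open>W\<close> gets its spectral measures
  as weak limits of discrete Fejer measures (Helly's selection theorem); the Cayley transform carries
  the result over to unbounded self-adjoint operators. Identities between operators are verified
  on powers of the Cayley transform and extended to all bounded Borel functions by the
  Stone-Weierstrass theorem and bounded pointwise limits.
\<close>

text \<open>The controls themselves lack compactness: a limit of strongly continuous controls need
  not be strongly continuous. The averaged operator \<open>A\<close> is all that the final state
  sees of a control, and the control built back from \<open>A\<close> is constant in the interaction
  picture, hence again continuous. This exchange works in both directions only if conjugation by the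
  evolution stays inside \<open>M\<close>, so affiliation must first be turned into membership in
  \<open>M\<close> of the bounded functions of \<open>V0\<close>.

  \<open>evolution\<close> rests on an unspecified choice of spectral measure, and
  \<open>is_spectral_measure\<close> fixes only a domain and a quadratic form. Existence therefore
  does not suffice: whichever measure is chosen must be shown to reproduce the Cayley transform of
  \<open>V0\<close>. Quadratic forms are the basic data throughout, and operators are recovered from
  them by polarization.

  The Fejer measures are discrete so that their moments are finite sums over roots of unity. The
  weak limit is taken along a filter because one choice of indices has to serve all pairs of vectors
  at once.\<close>

section \<open>Algebra and continuity of the complex inner product\<close>

lemma scaleC_one [simp]: "1 *\<^sub>C x = (x::'h::complex_hilbert)"
  using scaleC_of_real[of 1 x] by simp

lemma scaleC_minus_one [simp]: "(-1) *\<^sub>C x = - (x::'h::complex_hilbert)"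
  using scaleC_of_real[of "-1" x] by simp

lemma cinner_add_right: "cinner x (y + z) = cinner x y + cinner x (z::'h::complex_hilbert)"
  unfolding cinner_commute[of x "y + z"] cinner_commute[of x y] cinner_commute[of x z]
  by (simp add: cinner_add_left)

lemma cinner_scaleC_right: "cinner x (c *\<^sub>C y) = cnj c * cinner x (y::'h::complex_hilbert)"
  unfolding cinner_commute[of x "c *\<^sub>C y"] cinner_commute[of x y]
  by (simp add: cinner_scaleC_left)

lemma cinner_self: "cinner x x = complex_of_real ((norm (x::'h::complex_hilbert))\<^sup>2)"
proof (rule complex_eqI)
  show "Re (cinner x x) = Re (complex_of_real ((norm x)\<^sup>2))"
    by (simp add: Re_cinner power2_norm_eq_inner)
  have "Im (cinner x x) = Im (cnj (cinner x x))"
    by (rule arg_cong[OF cinner_commute])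
  then show "Im (cinner x x) = Im (complex_of_real ((norm x)\<^sup>2))" by simp
qed

lemma norm_scaleC: "norm (c *\<^sub>C x) = cmod c * norm (x::'h::complex_hilbert)"
proof -
  have "complex_of_real ((norm (c *\<^sub>C x))\<^sup>2) = c * cnj c * cinner x x"
    unfolding cinner_self[symmetric]
    by (simp add: cinner_scaleC_left cinner_scaleC_right)
  also have "\<dots> = complex_of_real ((cmod c * norm x)\<^sup>2)"
    by (simp add: cinner_self complex_norm_square[symmetric] power_mult_distrib)
  finally have "(norm (c *\<^sub>C x))\<^sup>2 = (cmod c * norm x)\<^sup>2"
    using of_real_eq_iff by blast
  then show ?thesis by (simp add: power2_eq_iff_nonneg)
qed

text \<open>The real Cauchy-Schwarz inequality controls only the real part. Multiplying
  \<open>x\<close> by the conjugate phase of \<open>cinner x y\<close> makes the product real and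
  does not increase the norm.\<close>

lemma cmod_cinner_le: "cmod (cinner x y) \<le> norm x * norm (y::'h::complex_hilbert)"
proof -
  define c where "c = cnj (sgn (cinner x y))"
  have "cmod c \<le> 1" by (simp add: c_def norm_sgn)
  have *: "c * cinner x y = complex_of_real (cmod (cinner x y))"
    by (cases "cinner x y = 0")
       (simp_all add: c_def sgn_eq complex_norm_square[symmetric] power2_eq_square
          mult.commute[of "cnj _"])
  have "cmod (cinner x y) = Re (cinner (c *\<^sub>C x) y)"
    by (simp only: cinner_scaleC_left * Re_complex_of_real)
  also have "\<dots> \<le> norm (c *\<^sub>C x) * norm y"
    by (simp add: Re_cinner norm_cauchy_schwarz)
  also have "\<dots> \<le> norm x * norm y"
    unfolding norm_scaleC using \<open>cmod c \<le> 1\<close>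
    by (intro mult_right_mono) (auto simp: mult_left_le_one_le)
  finally show ?thesis .
qed

lemma bounded_bilinear_cinner:
  "bounded_bilinear (cinner :: 'h::complex_hilbert \<Rightarrow> 'h \<Rightarrow> complex)"
proof
  fix x y z :: 'h and r :: real
  show "cinner (x + y) z = cinner x z + cinner y z" by (rule cinner_add_left)
  show "cinner x (y + z) = cinner x y + cinner x z" by (rule cinner_add_right)
  show "cinner (r *\<^sub>R x) y = r *\<^sub>R cinner x y"
    using cinner_scaleC_left[of "of_real r" x y] by (simp add: scaleC_of_real scaleR_conv_of_real)
  show "cinner x (r *\<^sub>R y) = r *\<^sub>R cinner x y"
    using cinner_scaleC_right[of x "of_real r" y] by (simp add: scaleC_of_real scaleR_conv_of_real)
  show "\<exists>K. \<forall>a b::'h. norm (cinner a b) \<le> norm a * norm b * K"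
    by (rule exI[of _ 1]) (simp add: cmod_cinner_le)
qed

lemma bounded_bilinear_scaleC:
  "bounded_bilinear (scaleC :: complex \<Rightarrow> 'h \<Rightarrow> 'h::complex_hilbert)"
proof
  fix c d :: complex and x y :: 'h and r :: real
  show "(c + d) *\<^sub>C x = c *\<^sub>C x + d *\<^sub>C x" by (rule scaleC_add_left)
  show "c *\<^sub>C (x + y) = c *\<^sub>C x + c *\<^sub>C y" by (rule scaleC_add_right)
  show "(r *\<^sub>R c) *\<^sub>C x = r *\<^sub>R (c *\<^sub>C x)"
    by (metis scaleC_of_real scaleC_scaleC scaleR_conv_of_real)
  show "c *\<^sub>C (r *\<^sub>R x) = r *\<^sub>R (c *\<^sub>C x)"
    by (metis mult.commute scaleC_of_real scaleC_scaleC)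
  show "\<exists>K. \<forall>a (b::'h). norm (a *\<^sub>C b) \<le> norm a * norm b * K"
    by (rule exI[of _ 1]) (simp add: norm_scaleC)
qed

interpretation cinner: bounded_bilinear "cinner :: 'h::complex_hilbert \<Rightarrow> 'h \<Rightarrow> complex"
  by (rule bounded_bilinear_cinner)

interpretation scaleC: bounded_bilinear "scaleC :: complex \<Rightarrow> 'h \<Rightarrow> 'h::complex_hilbert"
  by (rule bounded_bilinear_scaleC)

lemmas cinner_simps = cinner.add_left cinner.add_right cinner.diff_left cinner.diff_right
  cinner.minus_left cinner.minus_right cinner_scaleC_left cinner_scaleC_right

lemma cinner_eqI:
  assumes "\<And>y. cinner x y = cinner x' (y::'h::complex_hilbert)"
  shows "x = x'"
proof -
  have "cinner (x - x') (x - x') = 0"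
    using assms by (simp add: cinner.diff_left)
  then show ?thesis by (simp add: cinner_self)
qed

lemma cinner_eqI_right:
  assumes "\<And>y. cinner y x = cinner (y::'h::complex_hilbert) x'"
  shows "x = x'"
proof (rule cinner_eqI)
  show "cinner x y = cinner x' y" for y
    unfolding cinner_commute[of x y] cinner_commute[of x' y] assms by (rule refl)
qed

subsection \<open>Orthogonal projection and representation of bounded forms\<close>

lemma exists_nearest_point_subspace:
  fixes K :: "'a::{real_inner,banach} set"
  assumes K: "subspace K" "closed K"
  shows "\<exists>k\<in>K. \<forall>v\<in>K. inner (x - k) v = 0"
proof -
  define d where "d = Inf ((\<lambda>k. (norm (x - k))\<^sup>2) ` K)"
  have bdd: "bdd_below ((\<lambda>k. (norm (x - k))\<^sup>2) ` K)"
    by (rule bdd_belowI[of _ 0]) auto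
  have ne: "(\<lambda>k. (norm (x - k))\<^sup>2) ` K \<noteq> {}"
    using subspace_0[OF K(1)] by auto
  have d_le: "d \<le> (norm (x - k))\<^sup>2" if "k \<in> K" for k
    unfolding d_def using bdd that by (intro cInf_lower) auto
  have "\<exists>k\<in>K. (norm (x - k))\<^sup>2 < d + 1 / real (Suc n)" for n
  proof -
    have "d < d + 1 / real (Suc n)" by simp
    then show ?thesis
      unfolding d_def using cInf_lessD[OF ne] by (metis (no_types, lifting) imageE)
  qed
  then obtain k where k: "\<And>n. k n \<in> K" "\<And>n. (norm (x - k n))\<^sup>2 < d + 1 / real (Suc n)"
    by metis
  \<comment> \<open>Parallelogram law: the midpoint lies in \<open>K\<close>, so its squared
    distance to \<open>x\<close> is at least \<open>d\<close>.\<close>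
  have par: "(norm (k m - k n))\<^sup>2 \<le> 2 / real (Suc m) + 2 / real (Suc n)" for m n
  proof -
    have "(1/2) *\<^sub>R (k m + k n) \<in> K"
      using k(1) K(1) by (intro subspace_scale subspace_add) auto
    then have "d \<le> (norm (x - (1/2) *\<^sub>R (k m + k n)))\<^sup>2" by (rule d_le)
    moreover have "(norm (k m - k n))\<^sup>2 =
        2 * (norm (x - k m))\<^sup>2 + 2 * (norm (x - k n))\<^sup>2
        - 4 * (norm (x - (1/2) *\<^sub>R (k m + k n)))\<^sup>2"
      by (simp add: power2_norm_eq_inner inner_simps inner_commute algebra_simps)
    moreover have "2 / real (Suc j) = 2 * (1 / real (Suc j))" for j by simp
    ultimately show ?thesis using k(2)[of m] k(2)[of n] by linarith
  qed
  have "Cauchy k"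
  proof (rule metric_CauchyI)
    fix e :: real assume "e > 0"
    then have "0 < e\<^sup>2 / 4" by simp
    then obtain M where M: "1 / real (Suc M) < e\<^sup>2 / 4" using nat_approx_posE by blast
    have "dist (k m) (k n) < e" if "m \<ge> M" "n \<ge> M" for m n
    proof -
      have "1 / real (Suc m) \<le> 1 / real (Suc M)" "1 / real (Suc n) \<le> 1 / real (Suc M)"
        using that by (simp_all add: frac_le)
      moreover have "2 / real (Suc j) = 2 * (1 / real (Suc j))" for j by simp
      ultimately have "(norm (k m - k n))\<^sup>2 < e\<^sup>2"
        using par[of m n] M by linarith
      then show ?thesis
        using \<open>e > 0\<close> by (simp add: dist_norm power2_less_imp_less)
    qed
    then show "\<exists>M. \<forall>m\<ge>M. \<forall>n\<ge>M. dist (k m) (k n) < e" by blast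
  qed
  then obtain l where l: "k \<longlonglongrightarrow> l" by (auto simp: Cauchy_convergent_iff convergent_def)
  have lK: "l \<in> K" using K(2) l k(1) closed_sequentially by blast
  have "(norm (x - l))\<^sup>2 \<le> d"
  proof (rule LIMSEQ_le)
    show "(\<lambda>n. (norm (x - k n))\<^sup>2) \<longlonglongrightarrow> (norm (x - l))\<^sup>2" using l by (intro tendsto_intros)
    show "(\<lambda>n. d + 1 / real (Suc n)) \<longlonglongrightarrow> d"
      using tendsto_add[OF tendsto_const[of d] LIMSEQ_inverse_real_of_nat]
      by (simp add: inverse_eq_divide)
  qed (use k(2) less_imp_le in blast)
  then have min: "(norm (x - l))\<^sup>2 \<le> (norm (x - v))\<^sup>2" if "v \<in> K" for v
    using d_le[OF that] by linarith
  have "inner (x - l) v = 0" if v: "v \<in> K" for v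
  proof (cases "v = 0")
    case False
    define a where "a = inner (x - l) v"
    \<comment> \<open>This \<open>t\<close> minimizes the squared distance from \<open>x\<close>
      along the line through \<open>l\<close> in direction \<open>v\<close>; the gain would be
      \<open>a\<^sup>2 / (norm v)\<^sup>2\<close>.\<close>
    define t where "t = a / (norm v)\<^sup>2"
    have "l + t *\<^sub>R v \<in> K" using lK v K(1) by (intro subspace_add subspace_scale)
    from min[OF this] have "(norm (x - l))\<^sup>2 \<le> (norm (x - (l + t *\<^sub>R v)))\<^sup>2" .
    also have "\<dots> = (norm (x - l))\<^sup>2 + (t * t * (norm v)\<^sup>2 - 2 * t * a)"
      unfolding power2_norm_eq_inner a_def
      by (simp add: inner_simps inner_commute algebra_simps)
    finally have "0 \<le> t * t * (norm v)\<^sup>2 - 2 * t * a" by simp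
    also have "\<dots> = - (a\<^sup>2 / (norm v)\<^sup>2)"
      using False by (simp add: t_def power2_eq_square field_simps)
    finally have "a\<^sup>2 / (norm v)\<^sup>2 \<le> 0" by simp
    then have "a = 0" using False by (simp add: divide_le_0_iff)
    then show ?thesis by (simp add: a_def)
  qed simp
  with lK show ?thesis by blast
qed

text \<open>A vector orthogonal to the kernel spans its complement, since the kernel has codimension
  one.\<close>

lemma riesz_representation_real:
  fixes \<phi> :: "'a::{real_inner,banach} \<Rightarrow> real"
  assumes "bounded_linear \<phi>"
  shows "\<exists>z. \<forall>x. \<phi> x = inner x z"
proof (cases "\<forall>x. \<phi> x = 0")
  case True
  then show ?thesis by (intro exI[of _ 0]) simp
next
  case False
  interpret bounded_linear \<phi> by fact
  obtain x where x: "\<phi> x \<noteq> 0" using False by blast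
  have "closed {k. \<phi> k = 0}"
    by (intro closed_Collect_eq continuous_on continuous_intros tendsto) 
  moreover have "subspace {k. \<phi> k = 0}"
    by (auto simp: subspace_def zero add scaleR)
  ultimately obtain k where k: "\<phi> k = 0" "\<And>v. \<phi> v = 0 \<Longrightarrow> inner (x - k) v = 0"
    using exists_nearest_point_subspace[of "{k. \<phi> k = 0}" x] by auto
  define w where "w = x - k"
  have w: "\<phi> w = \<phi> x" using k by (simp add: w_def diff)
  then have "w \<noteq> 0" using x by (auto simp: zero)
  have "\<phi> y = inner y ((\<phi> w / inner w w) *\<^sub>R w)" for y
  proof -
    have "\<phi> (y - (\<phi> y / \<phi> w) *\<^sub>R w) = 0" using w x by (simp add: diff scaleR)
    then have "inner w (y - (\<phi> y / \<phi> w) *\<^sub>R w) = 0" using k(2) w_def by blast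
    then show ?thesis using \<open>w \<noteq> 0\<close> w x by (simp add: inner_simps inner_commute field_simps)
  qed
  then show ?thesis by blast
qed

text \<open>A complex-linear functional is determined by its real part, because
  \<open>Im (\<phi> x)\<close> is the real part of \<phi> at
  \<open>- \<i> *\<^sub>C x\<close>.\<close>

lemma riesz_representation:
  fixes \<phi> :: "'h::complex_hilbert \<Rightarrow> complex"
  assumes "bounded_linear \<phi>" "\<And>c x. \<phi> (c *\<^sub>C x) = c * \<phi> x"
  shows "\<exists>z. \<forall>x. \<phi> x = cinner x z"
proof -
  have "bounded_linear (\<lambda>x. Re (\<phi> x))"
    using assms(1) by (rule bounded_linear_compose[OF bounded_linear_Re])
  then obtain z where z: "\<And>x. Re (\<phi> x) = inner x z" using riesz_representation_real by blast
  have "\<phi> x = cinner x z" for x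
  proof (rule complex_eqI)
    show "Re (\<phi> x) = Re (cinner x z)" by (simp add: z Re_cinner)
    have "Re (\<phi> (- \<i> *\<^sub>C x)) = Re (cinner (- \<i> *\<^sub>C x) z)" by (simp only: z Re_cinner)
    then show "Im (\<phi> x) = Im (cinner x z)" 
      unfolding assms(2) cinner_scaleC_left by simp
  qed
  then show ?thesis by blast
qed

section \<open>Bounded operators, sesquilinear forms and adjoints\<close>

lemma bounded_clinearI:
  fixes T :: "'h::complex_hilbert \<Rightarrow> 'h"
  assumes "\<And>x y. T (x + y) = T x + T y" "\<And>c x. T (c *\<^sub>C x) = c *\<^sub>C T x"
    and "\<And>x. norm (T x) \<le> C * norm x"
  shows "bounded_clinear T"
  unfolding bounded_clinear_def
proof
  show "bounded_linear T"
    using assms(2)[of "of_real _"]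
    by (intro bounded_linear_intro[of _ C]) (simp_all add: assms mult.commute[of _ C] scaleC_of_real)
qed (simp add: assms)

lemma bounded_clinear_bounded_linear: "bounded_clinear T \<Longrightarrow> bounded_linear T"
  by (simp add: bounded_clinear_def)

lemma bounded_clinear_scaleC: "bounded_clinear T \<Longrightarrow> T (c *\<^sub>C x) = c *\<^sub>C T x"
  by (simp add: bounded_clinear_def)

lemma bounded_clinear_add: "bounded_clinear T \<Longrightarrow> T (x + y) = T x + T y"
  by (simp add: bounded_clinear_def linear_simps)

lemma bounded_clinear_diff: "bounded_clinear T \<Longrightarrow> T (x - y) = T x - T y"
  by (simp add: bounded_clinear_def linear_simps)

lemma bounded_clinear_zero: "bounded_clinear T \<Longrightarrow> T 0 = 0"
  by (simp add: bounded_clinear_def linear_simps)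

lemma bounded_clinear_id: "bounded_clinear id" "bounded_clinear (\<lambda>x. x)"
  by (simp_all add: bounded_clinear_def id_def)

lemma bounded_clinear_compose:
  "bounded_clinear S \<Longrightarrow> bounded_clinear T \<Longrightarrow> bounded_clinear (\<lambda>x. S (T x))"
  by (simp add: bounded_clinear_def bounded_linear_compose)

lemma bounded_clinear_funpow:
  "bounded_clinear T \<Longrightarrow> bounded_clinear (T ^^ n)"
  by (induction n) (auto simp: bounded_clinear_id bounded_clinear_compose comp_def)

text \<open>The source of every operator that is not given explicitly: adjoints, values of the
  functional calculus and weak limits. The norm bound keeps the constant \<open>C\<close> of the
  form, which the weak limits rely on.\<close>

lemma form_representation:
  fixes B :: "'h::complex_hilbert \<Rightarrow> 'h \<Rightarrow> complex"
  assumes add_left: "\<And>x y z. B (x + y) z = B x z + B y z"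
    and add_right: "\<And>x y z. B x (y + z) = B x y + B x z"
    and scale_left: "\<And>c x y. B (c *\<^sub>C x) y = c * B x y"
    and scale_right: "\<And>c x y. B x (c *\<^sub>C y) = cnj c * B x y"
    and bound: "\<And>x y. cmod (B x y) \<le> C * norm x * norm y"
  shows "\<exists>T. bounded_clinear T \<and> (\<forall>x y. cinner (T x) y = B x y) \<and> (\<forall>x. norm (T x) \<le> C * norm x)"
proof -
  have "\<exists>z. \<forall>y. cnj (B x y) = cinner y z" for x
  proof (rule riesz_representation)
    show "bounded_linear (\<lambda>y. cnj (B x y))"
    proof (rule bounded_linear_intro[of _ "C * norm x"])
      show "cnj (B x (r *\<^sub>R y)) = r *\<^sub>R cnj (B x y)" for r y
        using scale_right[of x "of_real r" y] by (simp add: scaleC_of_real scaleR_conv_of_real)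
      show "cmod (cnj (B x y)) \<le> norm y * (C * norm x)" for y
        using bound[of x y] by (simp add: mult_ac)
    qed (simp add: add_right)
  qed (simp add: scale_right)
  then obtain T where T: "\<And>x y. cnj (B x y) = cinner y (T x)" by metis
  have TB: "cinner (T x) y = B x y" for x y
    by (metis T cinner_commute complex_cnj_cnj)
  have nT: "norm (T x) \<le> C * norm x" for x
  proof (cases "T x = 0")
    case False
    have "(norm (T x))\<^sup>2 = cmod (B x (T x))"
      using TB[of x "T x"] by (metis cinner_self norm_of_real abs_power2 of_real_power real_norm_def)
    also have "\<dots> \<le> C * norm x * norm (T x)" by (rule bound)
    finally show ?thesis using False by (simp add: power2_eq_square)
  next
    case True
    show ?thesis
    proof (cases "x = 0")
      case False
      \<comment> \<open>No sign of \<open>C\<close> is assumed; the bound at \<open>(x, x)\<close>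
        forces it as soon as \<open>x\<close> is nonzero.\<close>
      have "0 \<le> C * norm x * norm x" using bound[of x x] norm_ge_zero order_trans by blast
      then show ?thesis using True False by (simp add: zero_le_mult_iff)
    qed (use True in simp)
  qed
  have "bounded_clinear T"
    by (rule bounded_clinearI[OF _ _ nT]; rule cinner_eqI)
       (simp_all add: TB add_left scale_left cinner_add_left cinner_scaleC_left)
  with TB nT show ?thesis by blast
qed

lemma adj_eqI:
  assumes "\<And>x y. cinner (T x) y = cinner x (S y)"
  shows "adj T = S"
  unfolding adj_def
proof (rule the_equality)
  show "\<forall>x y. cinner (T x) y = cinner x (S y)" by (intro allI assms)
  fix S' assume S': "\<forall>x y. cinner (T x) y = cinner x (S' y)"
  show "S' = S"
    by (rule ext, rule cinner_eqI_right) (rule trans[OF S'[rule_format, symmetric] assms])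
qed

text \<open>\<open>adj\<close> is a definite description, so a witness is needed first. It
  represents the form \<open>cinner x (T y)\<close>, and conjugation turns it into the
  adjoint.\<close>

lemma adj_cinner:
  assumes "bounded_clinear T"
  shows "cinner (T x) y = cinner x (adj T y)"
proof -
  obtain K where K: "\<And>x. norm (T x) \<le> norm x * K"
    using bounded_linear.bounded[OF bounded_clinear_bounded_linear[OF assms]] by blast
  have K': "cmod (cinner x (T y)) \<le> K * norm x * norm y" for x y
    using order_trans[OF cmod_cinner_le[of x "T y"] mult_left_mono[OF K[of y], of "norm x"]]
    by (simp add: mult_ac)
  obtain S where S: "\<And>x y. cinner (S x) y = cinner x (T y)"
    using form_representation[of "\<lambda>x y. cinner x (T y)" K] K' assms
    by (auto simp: cinner_simps bounded_clinear_add bounded_clinear_scaleC)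
  have S': "cinner (T x) y = cinner x (S y)" for x y
    unfolding cinner_commute[of "T x" y] cinner_commute[of x "S y"] S by (rule refl)
  show ?thesis
    unfolding adj_eqI[of T S, OF S'] by (rule S')
qed

lemma bounded_clinear_adj:
  assumes "bounded_clinear T"
  shows "bounded_clinear (adj T)"
proof -
  obtain K where K: "\<And>x. norm (T x) \<le> norm x * K" "K > 0"
    using bounded_linear.pos_bounded[OF bounded_clinear_bounded_linear[OF assms]] by blast
  show ?thesis
  proof (rule bounded_clinearI[of _ K])
    show "norm (adj T x) \<le> K * norm x" for x
    proof (cases "adj T x = 0")
      case False
      have "(norm (adj T x))\<^sup>2 = cmod (cinner (T (adj T x)) x)"
        by (simp add: adj_cinner[OF assms] cinner_self norm_power)
      also have "\<dots> \<le> norm (adj T x) * K * norm x"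
        by (rule order_trans[OF cmod_cinner_le mult_right_mono[OF K(1)]]) simp
      finally show ?thesis using False by (simp add: power2_eq_square)
    qed (use K in simp)
  qed (rule cinner_eqI_right; simp add: cinner_simps adj_cinner[OF assms, symmetric])+
qed

lemma cinner_polarization:
  fixes T :: "'h::complex_hilbert \<Rightarrow> 'h"
  assumes "\<And>x y. T (x + y) = T x + T y" "\<And>c x. T (c *\<^sub>C x) = c *\<^sub>C T x"
  shows "4 * cinner (T x) y = cinner (T (x + y)) (x + y) - cinner (T (x - y)) (x - y)
     + \<i> * cinner (T (x + \<i> *\<^sub>C y)) (x + \<i> *\<^sub>C y) - \<i> * cinner (T (x - \<i> *\<^sub>C y)) (x - \<i> *\<^sub>C y)"
proof -
  have d: "T (u - v) = T u - T v" for u v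
    using assms(1)[of u "- v"] assms(2)[of "-1" v] by simp
  show ?thesis by (simp add: assms d cinner_simps algebra_simps)
qed

text \<open>This is how the definite description in \<open>spectral_integral\<close> is resolved and
  how adjoints in a calculus are identified.\<close>

lemma quadratic_form_determines:
  assumes "bounded_clinear S" "bounded_clinear T" "\<And>x. cinner (S x) x = cinner (T x) x"
  shows "S = T"
proof (rule ext, rule cinner_eqI)
  fix x y
  have "4 * cinner (S x) y = 4 * cinner (T x) y"
    unfolding cinner_polarization[OF bounded_clinear_add[OF assms(1)] bounded_clinear_scaleC[OF assms(1)]]
      cinner_polarization[OF bounded_clinear_add[OF assms(2)] bounded_clinear_scaleC[OF assms(2)]]
      assms(3) by (rule refl)
  then show "cinner (S x) y = cinner (T x) y" by simp
qed

subsection \<open>Functionals on bounded Borel functions\<close>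

definition bdd_borel :: "('a::topological_space \<Rightarrow> complex) set" where
  "bdd_borel = {f \<in> borel_measurable borel. \<exists>C. \<forall>t. cmod (f t) \<le> C}"

text \<open>Linear functionals that are continuous under bounded pointwise convergence.\<close>

definition bp_functional :: "(('a::topological_space \<Rightarrow> complex) \<Rightarrow> complex) \<Rightarrow> bool" where
  "bp_functional L \<longleftrightarrow>
     (\<forall>f\<in>bdd_borel. \<forall>g\<in>bdd_borel. L (\<lambda>t. f t + g t) = L f + L g) \<and>
     (\<forall>c. \<forall>f\<in>bdd_borel. L (\<lambda>t. c * f t) = c * L f) \<and>
     (\<forall>F f C. (\<forall>n. F n \<in> borel_measurable borel) \<and> (\<forall>n t. cmod (F n t) \<le> C) \<and>
        (\<forall>t. (\<lambda>n. F n t) \<longlonglongrightarrow> f t) \<longrightarrow> (\<lambda>n. L (F n)) \<longlonglongrightarrow> L f)"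

lemma bdd_borelI:
  "f \<in> borel_measurable borel \<Longrightarrow> (\<And>t. cmod (f t) \<le> C) \<Longrightarrow> f \<in> bdd_borel"
  unfolding bdd_borel_def by blast

lemma bdd_borelE:
  assumes "f \<in> bdd_borel"
  obtains C where "f \<in> borel_measurable borel" "\<And>t. cmod (f t) \<le> C" "C \<ge> 0"
proof -
  obtain C where C: "f \<in> borel_measurable borel" "\<And>t. cmod (f t) \<le> C"
    using assms unfolding bdd_borel_def by blast
  then have "C \<ge> 0" using norm_ge_zero order_trans by blast
  with C that show ?thesis by blast
qed

lemma bdd_borel_measurable: "f \<in> bdd_borel \<Longrightarrow> f \<in> borel_measurable borel"
  unfolding bdd_borel_def by blast

lemma bdd_borel_const [simp]: "(\<lambda>_. c) \<in> bdd_borel"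
  by (rule bdd_borelI[of _ "cmod c"]) auto

lemma bdd_borel_add:
  assumes "f \<in> bdd_borel" "g \<in> bdd_borel"
  shows "(\<lambda>t. f t + g t) \<in> bdd_borel"
proof -
  obtain C where C: "f \<in> borel_measurable borel" "\<And>t. cmod (f t) \<le> C" "C \<ge> 0"
    using bdd_borelE[OF assms(1)] by blast
  obtain D where D: "g \<in> borel_measurable borel" "\<And>t. cmod (g t) \<le> D" "D \<ge> 0"
    using bdd_borelE[OF assms(2)] by blast
  have "cmod (f t + g t) \<le> C + D" for t
    by (rule order_trans[OF norm_triangle_ineq add_mono[OF C(2) D(2)]])
  then show ?thesis using C D by (intro bdd_borelI) auto
qed

lemma bdd_borel_mult:
  assumes "f \<in> bdd_borel" "g \<in> bdd_borel"
  shows "(\<lambda>t. f t * g t) \<in> bdd_borel"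
proof -
  obtain C where C: "f \<in> borel_measurable borel" "\<And>t. cmod (f t) \<le> C" "C \<ge> 0"
    using bdd_borelE[OF assms(1)] by blast
  obtain D where D: "g \<in> borel_measurable borel" "\<And>t. cmod (g t) \<le> D" "D \<ge> 0"
    using bdd_borelE[OF assms(2)] by blast
  have "cmod (f t * g t) \<le> C * D" for t
    unfolding norm_mult by (rule mult_mono) (use C D in auto)
  then show ?thesis using C D by (intro bdd_borelI) auto
qed

lemma bdd_borel_diff:
  assumes "f \<in> bdd_borel" "g \<in> bdd_borel"
  shows "(\<lambda>t. f t - g t) \<in> bdd_borel"
  using bdd_borel_add[OF assms(1) bdd_borel_mult[OF bdd_borel_const[of "-1"] assms(2)]]
  by simp

lemma bdd_borel_cnj:
  assumes "f \<in> bdd_borel"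
  shows "(\<lambda>t. cnj (f t)) \<in> bdd_borel"
proof -
  obtain C where C: "f \<in> borel_measurable borel" "\<And>t. cmod (f t) \<le> C" "C \<ge> 0"
    using bdd_borelE[OF assms(1)] by blast
  have "(\<lambda>t. cnj (f t)) \<in> borel_measurable borel"
    by (rule borel_measurable_continuous_on[OF _ C(1)]) (intro continuous_intros)
  then show ?thesis using C by (intro bdd_borelI[of _ C]) auto
qed

lemma bdd_borel_indicator [simp]:
  "B \<in> sets borel \<Longrightarrow> (\<lambda>t. indicator B t) \<in> bdd_borel"
  by (rule bdd_borelI[of _ 1]) (auto simp: indicator_def)

lemma bdd_borel_compose:
  assumes "f \<in> bdd_borel" "\<phi> \<in> borel_measurable borel"
  shows "(\<lambda>t. f (\<phi> t)) \<in> bdd_borel"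
  using assms unfolding bdd_borel_def by auto

lemma bdd_borel_compose_continuous:
  assumes "continuous_on UNIV \<phi>" "\<And>t. cmod (\<phi> t) \<le> C"
  shows "\<phi> \<in> bdd_borel"
  by (rule bdd_borelI[of _ C]) (auto intro: assms borel_measurable_continuous_onI)

lemma bp_functionalI:
  assumes "\<And>f g. f \<in> bdd_borel \<Longrightarrow> g \<in> bdd_borel \<Longrightarrow> L (\<lambda>t. f t + g t) = L f + L g"
    and "\<And>c f. f \<in> bdd_borel \<Longrightarrow> L (\<lambda>t. c * f t) = c * L f"
    and "\<And>F f C. (\<And>n. F n \<in> borel_measurable borel) \<Longrightarrow> (\<And>n t. cmod (F n t) \<le> C) \<Longrightarrow>
      (\<And>t. (\<lambda>n. F n t) \<longlonglongrightarrow> f t) \<Longrightarrow> (\<lambda>n. L (F n)) \<longlonglongrightarrow> L f"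
  shows "bp_functional L"
  unfolding bp_functional_def using assms by blast

lemma bp_functional_add_arg:
  "bp_functional L \<Longrightarrow> f \<in> bdd_borel \<Longrightarrow> g \<in> bdd_borel \<Longrightarrow> L (\<lambda>t. f t + g t) = L f + L g"
  unfolding bp_functional_def by blast

lemma bp_functional_mult_arg:
  "bp_functional L \<Longrightarrow> f \<in> bdd_borel \<Longrightarrow> L (\<lambda>t. c * f t) = c * L f"
  unfolding bp_functional_def by blast

lemma bp_functional_limit:
  assumes "bp_functional L" "\<And>n. F n \<in> borel_measurable borel" "\<And>n t. cmod (F n t) \<le> C"
    "\<And>t. (\<lambda>n. F n t) \<longlonglongrightarrow> f t"
  shows "(\<lambda>n. L (F n)) \<longlonglongrightarrow> L f"
  using assms unfolding bp_functional_def by blast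

lemma bp_functional_zero_arg: "bp_functional L \<Longrightarrow> L (\<lambda>_. 0) = 0"
  using bp_functional_mult_arg[of L "\<lambda>_. 0" 0] by simp

lemma bp_functional_diff_arg:
  assumes "bp_functional L" "f \<in> bdd_borel" "g \<in> bdd_borel"
  shows "L (\<lambda>t. f t - g t) = L f - L g"
  using bp_functional_add_arg[OF assms(1,2) bdd_borel_mult[OF bdd_borel_const[of "-1"] assms(3)]]
    bp_functional_mult_arg[OF assms(1,3), of "-1"] by simp

lemma bdd_borel_sum:
  "finite I \<Longrightarrow> (\<And>i. i \<in> I \<Longrightarrow> f i \<in> bdd_borel) \<Longrightarrow> (\<lambda>t. \<Sum>i\<in>I. f i t) \<in> bdd_borel"
  by (induction I rule: finite_induct) (auto intro: bdd_borel_add)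

lemma bp_functional_sum_arg:
  assumes "bp_functional L"
  shows "finite I \<Longrightarrow> (\<And>i. i \<in> I \<Longrightarrow> f i \<in> bdd_borel) \<Longrightarrow> L (\<lambda>t. \<Sum>i\<in>I. f i t) = (\<Sum>i\<in>I. L (f i))"
  by (induction I rule: finite_induct)
     (auto simp: bp_functional_zero_arg[OF assms] bp_functional_add_arg[OF assms] bdd_borel_sum)

lemma bp_functional_limit_zero:
  assumes "bp_functional L" "\<And>n. F n \<in> borel_measurable borel" "\<And>n t. cmod (F n t) \<le> C"
    "\<And>t. (\<lambda>n. F n t) \<longlonglongrightarrow> f t" "\<And>n. L (F n) = 0"
  shows "L f = 0"
  using LIMSEQ_unique[OF bp_functional_limit[OF assms(1-4)]] assms(5) by simp

lemma bp_functional_add: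
  assumes "bp_functional L" "bp_functional L'"
  shows "bp_functional (\<lambda>f. L f + L' f)"
  by (rule bp_functionalI)
     (auto simp: bp_functional_add_arg[OF assms(1)] bp_functional_add_arg[OF assms(2)]
       bp_functional_mult_arg[OF assms(1)] bp_functional_mult_arg[OF assms(2)] algebra_simps
       intro!: tendsto_intros bp_functional_limit[OF assms(1)] bp_functional_limit[OF assms(2)])

lemma bp_functional_mult:
  assumes "bp_functional L"
  shows "bp_functional (\<lambda>f. c * L f)"
  by (rule bp_functionalI)
     (auto simp: bp_functional_add_arg[OF assms(1)] bp_functional_mult_arg[OF assms(1)] algebra_simps
       intro!: tendsto_intros bp_functional_limit[OF assms(1)])

lemma bp_functional_diff:
  assumes "bp_functional L" "bp_functional L'"
  shows "bp_functional (\<lambda>f. L f - L' f)"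
  using bp_functional_add[OF assms(1) bp_functional_mult[OF assms(2), of "-1"]] by simp

text \<open>The push-forward of a functional; it moves functionals between the angle, the unit
  circle and the real line.\<close>

lemma bp_functional_compose:
  assumes L: "bp_functional L" and \<phi>: "\<phi> \<in> borel_measurable borel"
  shows "bp_functional (\<lambda>f. L (\<lambda>t. f (\<phi> t)))"
proof (rule bp_functionalI)
  fix F :: "nat \<Rightarrow> 'b \<Rightarrow> complex" and f C
  assume F: "\<And>n. F n \<in> borel_measurable borel" "\<And>n t. cmod (F n t) \<le> C"
    "\<And>t. (\<lambda>n. F n t) \<longlonglongrightarrow> f t"
  show "(\<lambda>n. L (\<lambda>t. F n (\<phi> t))) \<longlonglongrightarrow> L (\<lambda>t. f (\<phi> t))"
    using F \<phi> by (intro bp_functional_limit[OF L, of _ C]) auto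
qed (auto simp: bp_functional_add_arg[OF L] bp_functional_mult_arg[OF L] bdd_borel_compose[OF _ \<phi>])

lemma bp_functional_times:
  assumes L: "bp_functional L" and g: "g \<in> bdd_borel"
  shows "bp_functional (\<lambda>f. L (\<lambda>t. f t * g t))"
proof (rule bp_functionalI)
  fix F :: "nat \<Rightarrow> 'a \<Rightarrow> complex" and f C
  assume F: "\<And>n. F n \<in> borel_measurable borel" "\<And>n t. cmod (F n t) \<le> C"
    "\<And>t. (\<lambda>n. F n t) \<longlonglongrightarrow> f t"
  obtain D where D: "g \<in> borel_measurable borel" "\<And>t. cmod (g t) \<le> D" "D \<ge> 0"
    using bdd_borelE[OF g] by blast
  have C: "C \<ge> 0" using F(2)[of 0 undefined] norm_ge_zero order_trans by blast
  have "cmod (F n t * g t) \<le> C * D" for n t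
    unfolding norm_mult by (rule mult_mono) (use C F D in auto)
  then show "(\<lambda>n. L (\<lambda>t. F n t * g t)) \<longlonglongrightarrow> L (\<lambda>t. f t * g t)"
    using F D by (intro bp_functional_limit[OF L, of _ "C * D"] tendsto_intros) auto
next
  fix f f' :: "'a \<Rightarrow> complex" assume "f \<in> bdd_borel" "f' \<in> bdd_borel"
  then show "L (\<lambda>t. (f t + f' t) * g t) = L (\<lambda>t. f t * g t) + L (\<lambda>t. f' t * g t)"
    by (simp add: distrib_right bp_functional_add_arg[OF L] bdd_borel_mult g)
next
  fix f :: "'a \<Rightarrow> complex" and c assume "f \<in> bdd_borel"
  then show "L (\<lambda>t. c * f t * g t) = c * L (\<lambda>t. f t * g t)"
    by (simp add: mult.assoc bp_functional_mult_arg[OF L] bdd_borel_mult g)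
qed

lemma integrable_bdd_borel:
  assumes "finite_measure \<mu>" "sets \<mu> = sets borel" "f \<in> bdd_borel"
  shows "integrable \<mu> f"
proof -
  obtain C where C: "f \<in> borel_measurable borel" "\<And>t. cmod (f t) \<le> C"
    using bdd_borelE[OF assms(3)] by blast
  then show ?thesis
    using assms by (intro finite_measure.integrable_const_bound[of _ _ C]) (auto cong: measurable_cong_sets)
qed

lemma bp_functional_integral:
  assumes "finite_measure \<mu>" "sets \<mu> = sets borel"
  shows "bp_functional (\<lambda>f. \<integral>t. f t \<partial>\<mu>)"
proof (rule bp_functionalI)
  fix F :: "nat \<Rightarrow> 'a \<Rightarrow> complex" and f C
  assume F: "\<And>n. F n \<in> borel_measurable borel" "\<And>n t. cmod (F n t) \<le> C"
    "\<And>t. (\<lambda>n. F n t) \<longlonglongrightarrow> f t"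
  have *: "borel_measurable \<mu> = (borel_measurable borel :: ('a \<Rightarrow> complex) set)"
    using assms(2) by (rule measurable_cong_sets) simp
  have f: "f \<in> borel_measurable borel"
    by (rule borel_measurable_LIMSEQ_metric[OF F(1) F(3)])
  show "(\<lambda>n. \<integral>t. F n t \<partial>\<mu>) \<longlonglongrightarrow> (\<integral>t. f t \<partial>\<mu>)"
  proof (rule integral_dominated_convergence[where w="\<lambda>_. C"])
    show "integrable \<mu> (\<lambda>_. C)" using assms(1) by (rule finite_measure.integrable_const)
  qed (use F f * in auto)
qed (auto simp: integrable_bdd_borel[OF assms])

section \<open>Classes of functions that determine a functional\<close>

text \<open>Nonnegative Borel functions arise from indicators by sums, multiples and increasing
  limits. A general \<open>f\<close> is split into the positive and negative parts of its real and
  imaginary parts.\<close>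

lemma bp_functional_zero_of_indicator:
  assumes L: "bp_functional L" and ind: "\<And>B. B \<in> sets borel \<Longrightarrow> L (\<lambda>t. indicator B t) = 0"
    and f: "f \<in> bdd_borel"
  shows "L f = 0"
proof -
  have pos: "L (\<lambda>t. complex_of_real (u t)) = 0"
    if u: "u \<in> borel_measurable borel" "\<And>t. 0 \<le> u t" "\<And>t. u t \<le> C" for u C
  proof -
    \<comment> \<open>The bound is quantified inside the induction: the functional is controlled
      only on bounded functions, and summands and approximants inherit a bound from the function
      they build up.\<close>
    have "\<forall>C. (\<forall>t. u t \<le> C) \<longrightarrow> L (\<lambda>t. complex_of_real (u t)) = 0"
      using u(1,2)
    proof (induction u rule: borel_measurable_induct_real)
      case (set A)
      then show ?case using ind[of A]
        by (simp add: of_real_indicator)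
    next
      case (mult u c)
      show ?case
      proof (intro allI impI)
        fix C assume C: "\<forall>t. c * u t \<le> C"
        show "L (\<lambda>t. complex_of_real (c * u t)) = 0"
        proof (cases "c = 0")
          case True then show ?thesis using bp_functional_zero_arg[OF L] by simp
        next
          case False
          then have C': "\<forall>t. u t \<le> C / c" using C mult.hyps(1)
            by (simp add: pos_le_divide_eq mult.commute)
          then have "L (\<lambda>t. complex_of_real (u t)) = 0" using mult.IH by blast
          moreover have "(\<lambda>t. complex_of_real (u t)) \<in> bdd_borel"
            using C' mult.hyps by (intro bdd_borelI[of _ "C / c"]) auto
          ultimately show ?thesis
            using bp_functional_mult_arg[OF L, of _ "complex_of_real c"] by simp
        qed
      qed
    next
      case (add u v)
      show ?case
      proof (intro allI impI)
        fix C assume C: "\<forall>t. v t + u t \<le> C"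
        have C': "u t \<le> C" "v t \<le> C" for t
          using C[rule_format, of t] add.hyps(2)[of t] add.hyps(4)[of t] by auto
        have "(\<lambda>t. complex_of_real (u t)) \<in> bdd_borel" "(\<lambda>t. complex_of_real (v t)) \<in> bdd_borel"
          using C' add.hyps by (auto intro!: bdd_borelI[of _ "C"])
        moreover have "L (\<lambda>t. complex_of_real (u t)) = 0" "L (\<lambda>t. complex_of_real (v t)) = 0"
          using C' add.IH by blast+
        ultimately show "L (\<lambda>t. complex_of_real (v t + u t)) = 0"
          by (simp add: bp_functional_add_arg[OF L])
      qed
    next
      case (seq U)
      show ?case
      proof (intro allI impI)
        fix C assume C: "\<forall>t. u t \<le> C"
        have UC: "U i t \<le> C" for i t
        proof -
          have "incseq (\<lambda>i. U i t)" using \<open>incseq U\<close> by (simp add: incseq_def le_fun_def)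
          then have "U i t \<le> u t" by (rule incseq_le) (simp add: seq.hyps)
          then show ?thesis using C order_trans by blast
        qed
        show "L (\<lambda>t. complex_of_real (u t)) = 0"
        proof (rule bp_functional_limit_zero[OF L, of "\<lambda>i t. complex_of_real (U i t)" C])
          show "L (\<lambda>t. complex_of_real (U i t)) = 0" for i
            using seq.IH UC by blast
        qed (use UC seq.hyps in \<open>auto intro!: tendsto_intros\<close>)
      qed
    qed
    then show ?thesis using u(3) by blast
  qed
  obtain C where C: "f \<in> borel_measurable borel" "\<And>t. cmod (f t) \<le> C" "C \<ge> 0"
    using bdd_borelE[OF f] by blast
  have rel: "\<bar>Re (f t)\<bar> \<le> C" "\<bar>Im (f t)\<bar> \<le> C" for t
    using C(2)[of t] abs_Re_le_cmod[of "f t"] abs_Im_le_cmod[of "f t"] by linarith+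
  have re: "L (\<lambda>t. complex_of_real (u t)) = 0"
    if u: "u \<in> borel_measurable borel" "\<And>t. \<bar>u t\<bar> \<le> C" for u
  proof -
    have bb: "(\<lambda>t. complex_of_real (max 0 (u t))) \<in> bdd_borel" 
      "(\<lambda>t. complex_of_real (max 0 (- u t))) \<in> bdd_borel"
      using u C(3) by (auto intro!: bdd_borelI[of _ C] simp: abs_le_iff)
    have e: "(\<lambda>t. complex_of_real (u t)) = (\<lambda>t. complex_of_real (max 0 (u t)) - complex_of_real (max 0 (- u t)))"
      by (auto simp: max_def)
    show ?thesis
      unfolding e bp_functional_diff_arg[OF L bb]
      using u C(3) by (subst (1 2) pos[of _ C]) (auto simp: abs_le_iff)
  qed
  have bb: "(\<lambda>t. complex_of_real (Re (f t))) \<in> bdd_borel" "(\<lambda>t. complex_of_real (Im (f t))) \<in> bdd_borel"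
    using rel C(1) by (auto intro!: bdd_borelI[of _ C])
  have "L f = L (\<lambda>t. complex_of_real (Re (f t)) + \<i> * complex_of_real (Im (f t)))"
    by (subst complex_eq[symmetric]) (rule refl)
  also have "\<dots> = L (\<lambda>t. complex_of_real (Re (f t))) + \<i> * L (\<lambda>t. complex_of_real (Im (f t)))"
    using bb bdd_borel_mult[OF bdd_borel_const bb(2)]
    by (simp add: bp_functional_add_arg[OF L] bp_functional_mult_arg[OF L])
  also have "\<dots> = 0"
    using rel C(1) by (simp add: re)
  finally show ?thesis .
qed

text \<open>Closed sets form an intersection-stable generator of the Borel sets, and the sets whose
  indicator is annihilated are stable under complements and countable disjoint unions.\<close>

lemma bp_functional_zero_of_closed:
  assumes L: "bp_functional L" and cl: "\<And>B. closed B \<Longrightarrow> L (\<lambda>t. indicator B t) = 0"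
    and f: "f \<in> bdd_borel"
  shows "L f = 0"
proof (rule bp_functional_zero_of_indicator[OF L _ f])
  fix B :: "'a set" assume "B \<in> sets borel"
  then have B: "B \<in> sigma_sets UNIV (Collect closed)" by (simp add: borel_eq_closed)
  have bor: "A \<in> sets borel" if "A \<in> sigma_sets UNIV (Collect closed)" for A :: "'a set"
    using that by (simp add: borel_eq_closed)
  have "Int_stable (Collect closed :: 'a set set)" by (auto simp: Int_stable_def)
  moreover have "Collect closed \<subseteq> Pow (UNIV :: 'a set)" by simp
  ultimately show "L (\<lambda>t. indicator B t) = 0" using B
  proof (induction rule: sigma_sets_induct_disjoint)
    case (basic A) then show ?case by (simp add: cl)
  next
    case empty then show ?case by (simp add: bp_functional_zero_arg[OF L])
  next
    case (compl A)
    have "L (\<lambda>t. indicator (UNIV - A) t) = L (\<lambda>t. indicator UNIV t - indicator A t)"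
      by (rule arg_cong[of _ _ L]) (auto simp: indicator_def)
    also have "\<dots> = 0"
      using compl cl[of UNIV] bor[OF compl.hyps] bdd_borel_indicator[of UNIV]
      by (subst bp_functional_diff_arg[OF L]) auto
    finally show ?case .
  next
    case (union A)
    have A: "A i \<in> sets borel" for i using union.hyps(2) by (intro bor) auto
    show ?case
    proof (rule bp_functional_limit_zero[OF L, of "\<lambda>n t. indicator (\<Union>i<n. A i) t" 1])
      show "(\<lambda>n. indicator (\<Union>i<n. A i) t :: complex) \<longlonglongrightarrow> indicator (\<Union>i. A i) t" for t
        by (rule LIMSEQ_indicator_UN)
      fix n
      have "disjoint_family_on A {..<n}" 
        using union.hyps(1) by (auto simp: disjoint_family_on_def)
      then have "L (\<lambda>t. indicator (\<Union>i<n. A i) t) = L (\<lambda>t. \<Sum>i<n. indicator (A i) t)"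
        by (simp add: indicator_UN_disjoint)
      also have "\<dots> = 0" using A by (simp add: bp_functional_sum_arg[OF L] union.IH)
      finally show "L (\<lambda>t. indicator (\<Union>i<n. A i) t) = 0" .
    qed (use A in \<open>auto simp: indicator_def\<close>)
  qed
qed

text \<open>The indicator of a closed set is a bounded pointwise limit of the continuous tents
  \<open>max 0 (1 - real n * infdist t B)\<close>.\<close>

lemma bp_functional_zero_of_continuous:
  fixes L :: "('a::metric_space \<Rightarrow> complex) \<Rightarrow> complex"
  assumes L: "bp_functional L"
    and cont: "\<And>f::'a \<Rightarrow> real. continuous_on UNIV f \<Longrightarrow> (\<And>t. \<bar>f t\<bar> \<le> 1) \<Longrightarrow> L (\<lambda>t. of_real (f t)) = 0"
    and f: "f \<in> bdd_borel"
  shows "L f = 0"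
proof (rule bp_functional_zero_of_closed[OF L _ f])
  fix B :: "'a set" assume B: "closed B"
  show "L (\<lambda>t. indicator B t) = 0"
  \<comment> \<open>\<open>infdist t {}\<close> is 0 by convention, so for the empty set the tents
    would be constantly 1.\<close>
  proof (cases "B = {}")
    case True then show ?thesis by (simp add: bp_functional_zero_arg[OF L])
  next
    case False
    define g where "g n t = max 0 (1 - real n * infdist t B)" for n :: nat and t
    have gc: "continuous_on UNIV (g n)" for n
      unfolding g_def by (intro continuous_intros)
    have g1: "\<bar>g n t\<bar> \<le> 1" for n t
      by (auto simp: g_def infdist_nonneg)
    show ?thesis
    proof (rule bp_functional_limit_zero[OF L, of "\<lambda>n t. of_real (g n t)" 1])
      show "(\<lambda>t. complex_of_real (g n t)) \<in> borel_measurable borel" for n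
        by (intro borel_measurable_continuous_onI continuous_intros gc)
      show "cmod (complex_of_real (g n t)) \<le> 1" for n t using g1[of n t] by simp
      show "L (\<lambda>t. complex_of_real (g n t)) = 0" for n by (rule cont[OF gc g1])
      fix t
      show "(\<lambda>n. complex_of_real (g n t)) \<longlonglongrightarrow> indicator B t"
      proof (cases "t \<in> B")
        case True then show ?thesis by (simp add: g_def)
      next
        case t: False
        then have d: "infdist t B > 0"
          using B False infdist_pos_not_in_closed by blast
        obtain N where N: "real N * infdist t B > 1" using reals_Archimedean3[OF d] by blast
        have "complex_of_real (g n t) = indicator B t" if "n \<ge> N" for n
        proof -
          have "real N * infdist t B \<le> real n * infdist t B"
            using that d by (intro mult_right_mono) auto
          then show ?thesis using N t by (simp add: g_def)
        qed
        then show ?thesis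
          by (intro tendsto_eventually) (auto simp: eventually_sequentially)
      qed
    qed
  qed
qed

section \<open>Trigonometric polynomials and functions on the circle\<close>

inductive trig_poly :: "(real \<Rightarrow> complex) \<Rightarrow> bool" where
  base: "trig_poly (\<lambda>t. c * cis (of_int k * t))"
| add: "trig_poly f \<Longrightarrow> trig_poly g \<Longrightarrow> trig_poly (\<lambda>t. f t + g t)"

lemma trig_poly_mult:
  assumes "trig_poly f" "trig_poly g"
  shows "trig_poly (\<lambda>t. f t * g t)"
  using assms(1)
proof (induction f)
  case (base c k)
  show ?case using assms(2)
  proof (induction g)
    case (base d j)
    have "(\<lambda>t. c * cis (of_int k * t) * (d * cis (of_int j * t))) = (\<lambda>t. (c * d) * cis (of_int (k + j) * t))"
      by (auto simp: cis_mult[symmetric] distrib_right)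
    then show ?case by (simp only: trig_poly.base)
  next
    case (add f g)
    then show ?case by (simp add: distrib_left trig_poly.add)
  qed
next
  case (add f g)
  then show ?case by (simp add: distrib_right trig_poly.add)
qed

lemma trig_poly_real_polynomial:
  fixes p :: "complex \<Rightarrow> real"
  assumes "real_polynomial_function p"
  shows "trig_poly (\<lambda>t. of_real (p (cis t)))"
  using assms
proof (induction p)
  case (linear p)
  interpret bounded_linear p by fact
  have "p (cis t) = cos t * p 1 + sin t * p \<i>" for t
  proof -
    have "cis t = cos t *\<^sub>R 1 + sin t *\<^sub>R \<i>" by (auto simp: complex_eq_iff)
    then show ?thesis by (simp only: add scaleR real_scaleR_def)
  qed
  \<comment> \<open>Cosine and sine are written through \<open>cis t\<close> and
    \<open>cis (- t)\<close>; the two coefficients are complex conjugates because \<open>p\<close>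
    is real.\<close>
  then have "(\<lambda>t. complex_of_real (p (cis t))) =
      (\<lambda>t. (Complex (p 1) (- p \<i>) / 2) * cis (of_int 1 * t) + (Complex (p 1) (p \<i>) / 2) * cis (of_int (-1) * t))"
    by (auto simp: complex_eq_iff field_simps)
  then show ?case by (simp only: trig_poly.intros)
next
  case (const c)
  then show ?case using trig_poly.base[of "of_real c" 0] by simp
next
  case (add f g)
  then show ?case using trig_poly.add by simp
next
  case (mult f g)
  then show ?case using trig_poly_mult by simp
qed

lemma bdd_borel_cis [simp]: "(\<lambda>t. cis (a * t)) \<in> bdd_borel"
  by (rule bdd_borel_compose_continuous[of _ 1]) (auto intro!: continuous_intros)

lemma trig_poly_bdd_borel: "trig_poly f \<Longrightarrow> f \<in> bdd_borel"
  by (induction rule: trig_poly.induct) (auto intro!: bdd_borel_add bdd_borel_mult)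

text \<open>\<open>Arg\<close> is continuous off the nonpositive real axis, and on that axis it is
  constantly pi except for the value 0 at the origin.\<close>

lemma borel_measurable_Arg: "Arg \<in> borel_measurable borel"
proof -
  have "(\<lambda>z. if z \<in> - \<real>\<^sub>\<le>\<^sub>0 then Arg z else pi) \<in> borel_measurable borel"
    by (intro borel_measurable_continuous_on_if borel_open)
       (auto intro!: continuous_at_imp_continuous_on continuous_at_Arg open_Compl closed_nonpos_Reals_complex)
  then have *: "(\<lambda>z. if z = 0 then 0 else if z \<in> - \<real>\<^sub>\<le>\<^sub>0 then Arg z else pi) \<in> borel_measurable borel"
    by (rule measurable_If[rotated]) auto
  have "Arg z = (if z = 0 then 0 else if z \<in> - \<real>\<^sub>\<le>\<^sub>0 then Arg z else pi)" for z
  proof (cases "z \<in> \<real>\<^sub>\<le>\<^sub>0")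
    case True
    then obtain r where "z = of_real r" "r \<le> 0" by (auto elim: nonpos_Reals_cases)
    then show ?thesis by (auto simp: Arg_zero simp del: Arg_eq_pi)
  qed (auto simp: Arg_zero)
  then show ?thesis using * by presburger
qed

text \<open>Stone-Weierstrass passes from characters to continuous functions on the circle, and
  \<open>bp_functional_zero_of_continuous\<close> on to all Borel functions of \<open>cis t\<close>.
  Such functions cannot separate points that differ by a multiple of 2 pi, hence the support
  condition \<open>supp\<close>.\<close>

lemma bp_functional_zero_of_cis:
  assumes L: "bp_functional L"
    and supp: "\<And>f. f \<in> bdd_borel \<Longrightarrow> (\<And>t. t \<in> {-pi<..pi} \<Longrightarrow> f t = 0) \<Longrightarrow> L f = 0"
    and cis0: "\<And>k::int. L (\<lambda>t. cis (of_int k * t)) = 0"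
    and f: "f \<in> bdd_borel"
  shows "L f = 0"
proof -
  have cm: "cis \<in> borel_measurable borel"
    by (intro borel_measurable_continuous_onI continuous_intros)
  have trig: "L g = 0" if "trig_poly g" for g
    using that by (induction rule: trig_poly.induct)
      (simp_all add: bp_functional_mult_arg[OF L] bp_functional_add_arg[OF L] cis0 trig_poly_bdd_borel)
  have all: "L (\<lambda>t. F (cis t)) = 0" if F: "F \<in> bdd_borel" for F
  proof (rule bp_functional_zero_of_continuous[OF bp_functional_compose[OF L cm] _ F])
    fix g :: "complex \<Rightarrow> real" assume g: "continuous_on UNIV g" "\<And>t. \<bar>g t\<bar> \<le> 1"
    have "\<exists>p. real_polynomial_function p \<and> (\<forall>z\<in>sphere 0 1. \<bar>g z - p z\<bar> < 1 / real (Suc n))" for n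
      by (rule Stone_Weierstrass_real_polynomial_function[of "sphere 0 1" g "1 / real (Suc n)"])
         (blast intro: continuous_on_subset[OF g(1)] compact_sphere of_nat_0_less_iff | simp)+
    then obtain p where p: "\<And>n. real_polynomial_function (p n)"
      "\<And>n z. z \<in> sphere 0 1 \<Longrightarrow> \<bar>g z - p n z\<bar> < 1 / real (Suc n)" by metis
    have p': "\<bar>g (cis t) - p n (cis t)\<bar> < 1 / real (Suc n)" for n t using p(2) by simp
    show "L (\<lambda>t. complex_of_real (g (cis t))) = 0"
    proof (rule bp_functional_limit_zero[OF L, of "\<lambda>n t. of_real (p n (cis t))" 2])
      have tp: "trig_poly (\<lambda>t. complex_of_real (p n (cis t)))" for n
        by (rule trig_poly_real_polynomial[OF p(1)])
      show "(\<lambda>t. complex_of_real (p n (cis t))) \<in> borel_measurable borel" for n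
        by (intro bdd_borel_measurable trig_poly_bdd_borel tp)
      show "L (\<lambda>t. complex_of_real (p n (cis t))) = 0" for n by (rule trig[OF tp])
      \<comment> \<open>The bound is 1 for \<open>g\<close> plus an approximation error of at most
        1.\<close>
      show "cmod (complex_of_real (p n (cis t))) \<le> 2" for n t
      proof -
        have "1 / real (Suc n) \<le> 1" by simp
        then show ?thesis using p'[of t n] g(2)[of "cis t"] unfolding norm_of_real by linarith
      qed
      show "(\<lambda>n. complex_of_real (p n (cis t))) \<longlonglongrightarrow> complex_of_real (g (cis t))" for t
      proof (intro tendsto_intros)
        have "(\<lambda>n. p n (cis t) - g (cis t)) \<longlonglongrightarrow> 0"
        proof (rule Lim_null_comparison[of _ "\<lambda>n. 1 / real (Suc n)"])
          show "\<forall>\<^sub>F n in sequentially. norm (p n (cis t) - g (cis t)) \<le> 1 / real (Suc n)"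
            using p'[of t] by (intro always_eventually allI) (simp add: abs_minus_commute less_imp_le)
          show "(\<lambda>n. 1 / real (Suc n)) \<longlonglongrightarrow> 0"
            using LIMSEQ_inverse_real_of_nat by (simp add: inverse_eq_divide)
        qed
        then show "(\<lambda>n. p n (cis t)) \<longlonglongrightarrow> g (cis t)" by (rule LIM_zero_cancel)
      qed
    qed
  qed
  have bb: "(\<lambda>t. f (Arg (cis t))) \<in> bdd_borel"
    by (intro bdd_borel_compose[OF f] measurable_compose[OF cm borel_measurable_Arg])
  \<comment> \<open>On (-pi, pi] the angle \<open>Arg (cis t)\<close> is \<open>t\<close>, so the
    difference vanishes there and falls under \<open>supp\<close>.\<close>
  have "L f = L (\<lambda>t. f (Arg (cis t))) + L (\<lambda>t. f t - f (Arg (cis t)))"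
    using bp_functional_diff_arg[OF L f bb] by simp
  also have "L (\<lambda>t. f t - f (Arg (cis t))) = 0"
    by (rule supp) (auto simp: Arg_cis bdd_borel_diff f bb)
  also have "L (\<lambda>t. f (Arg (cis t))) = 0"
    by (rule all[OF bdd_borel_compose[OF f borel_measurable_Arg]])
  finally show ?thesis by simp
qed

section \<open>The Cayley transform of the real line\<close>

definition cayley :: "real \<Rightarrow> complex" where
  "cayley l = (of_real l - \<i>) / (of_real l + \<i>)"

text \<open>On the unit circle without 1 the quotient is already real; \<open>Re\<close> merely
  fixes the type and makes the function total. At \<open>z = 1\<close> division by zero yields
  0.\<close>

definition inv_cayley :: "complex \<Rightarrow> real" where
  "inv_cayley z = Re (\<i> * (1 + z) / (1 - z))"

lemma of_real_plus_i_nonzero [simp]: "complex_of_real l + \<i> \<noteq> 0"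
  by (simp add: complex_eq_iff)

lemma i_plus_of_real_nonzero [simp]: "\<i> + complex_of_real l \<noteq> 0"
  by (simp add: complex_eq_iff)

lemma of_real_minus_i_nonzero [simp]: "complex_of_real l - \<i> \<noteq> 0"
  by (simp add: complex_eq_iff)

lemma cmod_cayley [simp]: "cmod (cayley l) = 1"
proof -
  have "cmod (complex_of_real l - \<i>) = cmod (complex_of_real l + \<i>)"
    by (simp add: cmod_def)
  then show ?thesis by (simp add: cayley_def norm_divide)
qed

lemma inv_cayley_cayley [simp]: "inv_cayley (cayley l) = l"
proof -
  have "1 - cayley l = 2 * \<i> / (of_real l + \<i>)" "1 + cayley l = 2 * of_real l / (of_real l + \<i>)"
    by (simp_all add: cayley_def field_simps)
  then have "\<i> * (1 + cayley l) / (1 - cayley l) = of_real l" by simp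
  then show ?thesis by (simp add: inv_cayley_def)
qed

lemma cayley_inv_cayley:
  assumes "cmod z = 1" "z \<noteq> 1"
  shows "cayley (inv_cayley z) = z"
proof -
  have z: "z * cnj z = 1" using assms(1) by (simp add: complex_norm_square[symmetric])
  have nz: "1 - z \<noteq> 0" "1 - cnj z \<noteq> 0" using assms(2)
    by (auto simp: complex_eq_iff)
  define w where "w = \<i> * (1 + z) / (1 - z)"
  have "cnj w = - \<i> * (1 + cnj z) / (1 - cnj z)" by (simp add: w_def)
  also have "\<dots> = w" using nz z by (simp add: w_def field_simps) 
  finally have "w \<in> \<real>" by (simp add: Reals_cnj_iff)
  then have w: "complex_of_real (inv_cayley z) = w" by (simp add: inv_cayley_def w_def)
  have wi: "w + \<i> = 2 * \<i> / (1 - z)" "w - \<i> = 2 * \<i> * z / (1 - z)"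
    using nz by (simp_all add: w_def field_simps)
  show ?thesis unfolding cayley_def w wi using nz by simp
qed

lemma continuous_on_cayley: "continuous_on S cayley"
  unfolding cayley_def by (intro continuous_intros) auto

lemma borel_measurable_cayley: "cayley \<in> borel_measurable borel"
  by (intro borel_measurable_continuous_onI continuous_on_cayley)

lemma borel_measurable_inv_cayley: "inv_cayley \<in> borel_measurable borel"
  unfolding inv_cayley_def by measurable

text \<open>\<open>Arg (cayley t)\<close> is an angle in (-pi, pi], so the push-forward along it
  satisfies the support condition, and \<open>inv_cayley\<close> recovers \<open>t\<close> from the
  angle.\<close>

lemma bp_functional_zero_of_cayley:
  assumes L: "bp_functional L"
    and c0: "\<And>k::int. L (\<lambda>t. cayley t powi k) = 0"
    and f: "f \<in> bdd_borel"
  shows "L f = 0"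
proof -
  have m: "(\<lambda>t. Arg (cayley t)) \<in> borel_measurable borel"
    using borel_measurable_Arg borel_measurable_cayley by auto
  have ca: "cis (Arg (cayley t)) = cayley t" for t
  proof -
    have "cayley t \<noteq> 0" using cmod_cayley[of t] by force
    then show ?thesis by (simp add: cis_Arg sgn_eq)
  qed
  have "L (\<lambda>t. f (inv_cayley (cis (Arg (cayley t))))) = 0"
  proof (rule bp_functional_zero_of_cis[OF bp_functional_compose[OF L m]])
    show "L (\<lambda>t. f (Arg (cayley t))) = 0"
      if "f \<in> bdd_borel" "\<And>t. t \<in> {- pi<..pi} \<Longrightarrow> f t = 0" for f
      using that(2) mpi_less_Arg Arg_le_pi by (simp add: bp_functional_zero_arg[OF L])
    show "L (\<lambda>t. cis (of_int k * Arg (cayley t))) = 0" for k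
      unfolding cis_power_int[symmetric] ca by (rule c0)
    have "cis \<in> borel_measurable borel"
      by (intro borel_measurable_continuous_onI continuous_intros)
    then show "(\<lambda>t. f (inv_cayley (cis t))) \<in> bdd_borel"
      using borel_measurable_inv_cayley by (intro bdd_borel_compose[OF f]) auto
  qed
  then show ?thesis by (simp add: ca)
qed

subsection \<open>Bounded Borel functional calculi\<close>

text \<open>A spectral measure seen as a *-homomorphism on bounded Borel functions; countable
  additivity becomes the clause on \<open>bp_functional\<close>.\<close>

definition borel_calculus :: "((real \<Rightarrow> complex) \<Rightarrow> 'h::complex_hilbert \<Rightarrow> 'h) \<Rightarrow> bool" where
  "borel_calculus \<Phi> \<longleftrightarrow>
     (\<forall>f\<in>bdd_borel. bounded_clinear (\<Phi> f)) \<and>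
     (\<forall>x y. bp_functional (\<lambda>f. cinner (\<Phi> f x) y)) \<and>
     \<Phi> (\<lambda>_. 1) = id \<and>
     (\<forall>f\<in>bdd_borel. \<forall>g\<in>bdd_borel. \<forall>x. \<Phi> (\<lambda>t. f t * g t) x = \<Phi> f (\<Phi> g x)) \<and>
     (\<forall>f\<in>bdd_borel. \<forall>x y. cinner (\<Phi> f x) y = cinner x (\<Phi> (\<lambda>t. cnj (f t)) y))"

text \<open>Agreement on \<open>bdd_borel\<close> is enough because a bounded pointwise limit of
  Borel functions is again in \<open>bdd_borel\<close>.\<close>

lemma bp_functional_cong:
  assumes "bp_functional L" "\<And>f. f \<in> bdd_borel \<Longrightarrow> L' f = L f"
  shows "bp_functional L'"
proof (rule bp_functionalI)
  fix F :: "nat \<Rightarrow> 'a \<Rightarrow> complex" and f C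
  assume F: "\<And>n. F n \<in> borel_measurable borel" "\<And>n t. cmod (F n t) \<le> C"
    "\<And>t. (\<lambda>n. F n t) \<longlonglongrightarrow> f t"
  have "f \<in> borel_measurable borel"
    by (rule borel_measurable_LIMSEQ_metric[OF F(1) F(3)])
  moreover have "cmod (f t) \<le> C" for t
    by (rule LIMSEQ_le_const2[OF tendsto_norm[OF F(3)]]) (use F(2) in blast)
  ultimately have f: "f \<in> bdd_borel" by (rule bdd_borelI)
  have "F n \<in> bdd_borel" for n by (rule bdd_borelI[OF F(1,2)])
  then show "(\<lambda>n. L' (F n)) \<longlonglongrightarrow> L' f"
    using bp_functional_limit[OF assms(1) F] assms(2) f by simp
qed (simp_all add: assms(2) bdd_borel_add bdd_borel_mult bp_functional_add_arg[OF assms(1)]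
       bp_functional_mult_arg[OF assms(1)])

text \<open>The candidate expectations \<open>q f x\<close> are available for every
  \<open>f\<close>, but operators only for the generators \<open>g i\<close>. By \<open>det\<close>,
  functionals that ignore values outside \<open>X\<close> are determined on generators, so every
  algebraic law has to be checked only there. It is applied to indicators for a projection-valued
  measure and to characters for a unitary operator.\<close>

lemma borel_calculus_exists:
  fixes q :: "(real \<Rightarrow> complex) \<Rightarrow> 'h::complex_hilbert \<Rightarrow> complex"
    and X :: "real set" and I :: "'i set" and g :: "'i \<Rightarrow> real \<Rightarrow> complex" and T :: "'i \<Rightarrow> 'h \<Rightarrow> 'h"
  assumes q_bp: "\<And>x. bp_functional (\<lambda>f. q f x)"
    and q_bound: "\<And>f C x. f \<in> bdd_borel \<Longrightarrow> (\<And>t. cmod (f t) \<le> C) \<Longrightarrow> cmod (q f x) \<le> C * (norm x)\<^sup>2"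
    and q_cnj: "\<And>f x. f \<in> bdd_borel \<Longrightarrow> q (\<lambda>t. cnj (f t)) x = cnj (q f x)"
    and q_null: "\<And>f x. f \<in> bdd_borel \<Longrightarrow> (\<And>t. t \<in> X \<Longrightarrow> f t = 0) \<Longrightarrow> q f x = 0"
    and det: "\<And>L f. bp_functional L \<Longrightarrow>
        (\<And>f. f \<in> bdd_borel \<Longrightarrow> (\<And>t. t \<in> X \<Longrightarrow> f t = 0) \<Longrightarrow> L f = 0) \<Longrightarrow>
        (\<And>i. i \<in> I \<Longrightarrow> L (g i) = 0) \<Longrightarrow> f \<in> bdd_borel \<Longrightarrow> L f = 0"
    and G: "\<And>i. i \<in> I \<Longrightarrow> g i \<in> bdd_borel"
    and T: "\<And>i. i \<in> I \<Longrightarrow> bounded_clinear (T i)" "\<And>i x. i \<in> I \<Longrightarrow> q (g i) x = cinner (T i x) x"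
    and one: "\<exists>i\<in>I. g i = (\<lambda>_. 1) \<and> T i = id"
    and mult: "\<And>i j. i \<in> I \<Longrightarrow> j \<in> I \<Longrightarrow>
        \<exists>k\<in>I. g k = (\<lambda>t. g i t * g j t) \<and> (\<forall>x. T k x = T i (T j x))"
  shows "\<exists>\<Phi>. borel_calculus \<Phi> \<and> (\<forall>f\<in>bdd_borel. \<forall>x. cinner (\<Phi> f x) x = q f x) \<and>
      (\<forall>i\<in>I. \<Phi> (g i) = T i) \<and>
      (\<forall>f\<in>bdd_borel. (\<forall>t\<in>X. f t = 0) \<longrightarrow> (\<forall>x. \<Phi> f x = 0))"
proof -
  \<comment> \<open>The polarization formula is only a candidate at this point, since
    \<open>q f\<close> is not yet known to be a quadratic form. Sesquilinearity is inherited from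
    the operators \<open>T i\<close> through \<open>eq\<close>.\<close>
  define B where "B f x y = (1/4) * (q f (x + y) - q f (x - y)
      + \<i> * q f (x + \<i> *\<^sub>C y) - \<i> * q f (x - \<i> *\<^sub>C y))" for f x y
  have B_bp: "bp_functional (\<lambda>f. B f x y)" for x y
    unfolding B_def by (intro bp_functional_mult bp_functional_add bp_functional_diff q_bp)
  have B_null: "B f x y = 0" if "f \<in> bdd_borel" "\<And>t. t \<in> X \<Longrightarrow> f t = 0" for f x y
    unfolding B_def using q_null[OF that] by simp
  have B_G: "B (g i) x y = cinner (T i x) y" if "i \<in> I" for i x y
    unfolding B_def T(2)[OF that]
      cinner_polarization[OF bounded_clinear_add[OF T(1)[OF that]] bounded_clinear_scaleC[OF T(1)[OF that]],
        of x y, symmetric] by simp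
  have eq: "L f = L' f" if "bp_functional L" "bp_functional L'"
      "\<And>f. f \<in> bdd_borel \<Longrightarrow> (\<And>t. t \<in> X \<Longrightarrow> f t = 0) \<Longrightarrow> L f = 0"
      "\<And>f. f \<in> bdd_borel \<Longrightarrow> (\<And>t. t \<in> X \<Longrightarrow> f t = 0) \<Longrightarrow> L' f = 0"
      "\<And>i. i \<in> I \<Longrightarrow> L (g i) = L' (g i)" "f \<in> bdd_borel" for L L' f
  proof -
    have "L f - L' f = 0"
    proof (rule det[OF bp_functional_diff[OF that(1,2)] _ _ that(6)])
      show "L g - L' g = 0" if "g \<in> bdd_borel" "\<And>t. t \<in> X \<Longrightarrow> g t = 0" for g
        using \<open>\<And>f. f \<in> bdd_borel \<Longrightarrow> (\<And>t. t \<in> X \<Longrightarrow> f t = 0) \<Longrightarrow> L f = 0\<close>[OF that]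
          \<open>\<And>f. f \<in> bdd_borel \<Longrightarrow> (\<And>t. t \<in> X \<Longrightarrow> f t = 0) \<Longrightarrow> L' f = 0\<close>[OF that] by simp
    qed (simp add: that(5))
    then show ?thesis by simp
  qed
  have B_diag: "B f x x = q f x" if "f \<in> bdd_borel" for f x
    by (rule eq[OF B_bp q_bp B_null q_null _ that]) (auto simp: B_G T(2))
  have B_add_left: "B f (x + y) z = B f x z + B f y z" if "f \<in> bdd_borel" for f x y z
    by (rule eq[OF B_bp bp_functional_add[OF B_bp B_bp] B_null _ _ that])
       (auto simp: B_G B_null cinner_add_left bounded_clinear_add[OF T(1)])
  have B_add_right: "B f x (y + z) = B f x y + B f x z" if "f \<in> bdd_borel" for f x y z
    by (rule eq[OF B_bp bp_functional_add[OF B_bp B_bp] B_null _ _ that])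
       (auto simp: B_G B_null cinner_add_right)
  have B_scale_left: "B f (c *\<^sub>C x) y = c * B f x y" if "f \<in> bdd_borel" for f x y c
    by (rule eq[OF B_bp bp_functional_mult[OF B_bp] B_null _ _ that])
       (auto simp: B_G B_null cinner_scaleC_left bounded_clinear_scaleC[OF T(1)])
  have B_scale_right: "B f x (c *\<^sub>C y) = cnj c * B f x y" if "f \<in> bdd_borel" for f x y c
    by (rule eq[OF B_bp bp_functional_mult[OF B_bp] B_null _ _ that])
       (auto simp: B_G B_null cinner_scaleC_right)
  have B_bound: "cmod (B f x y) \<le> 2 * C * norm x * norm y"
    if f: "f \<in> bdd_borel" "\<And>t. cmod (f t) \<le> C" for f C x y
  proof -
    \<comment> \<open>By the parallelogram law the four squared norms add up to 8 for unit vectors,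
      and a quarter of \<open>8 * C\<close> is \<open>2 * C\<close>. The general case follows by
      scaling.\<close>
    have unit: "cmod (B f u v) \<le> 2 * C" if "norm u = 1" "norm v = 1" for u v
    proof -
      have par: "(norm (u + w))\<^sup>2 + (norm (u - w))\<^sup>2 = 2 * (norm u)\<^sup>2 + 2 * (norm w)\<^sup>2" for w
        by (simp add: power2_norm_eq_inner inner_simps inner_commute)
      have "cmod (B f u v) \<le> (1/4) * (cmod (q f (u + v)) + cmod (q f (u - v))
          + cmod (q f (u + \<i> *\<^sub>C v)) + cmod (q f (u - \<i> *\<^sub>C v)))"
        unfolding B_def norm_mult
        using norm_triangle_ineq4[of "q f (u + v)" "q f (u - v)"]
          norm_triangle_ineq[of "q f (u + v) - q f (u - v)" "\<i> * q f (u + \<i> *\<^sub>C v)"]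
          norm_triangle_ineq4[of "q f (u + v) - q f (u - v) + \<i> * q f (u + \<i> *\<^sub>C v)" "\<i> * q f (u - \<i> *\<^sub>C v)"]
        by (simp add: norm_mult)
      also have "\<dots> \<le> (1/4) * (C * (norm (u + v))\<^sup>2 + C * (norm (u - v))\<^sup>2
          + C * (norm (u + \<i> *\<^sub>C v))\<^sup>2 + C * (norm (u - \<i> *\<^sub>C v))\<^sup>2)"
        by (intro mult_left_mono add_mono q_bound f) auto
      also have "\<dots> = (1/4) * (C * ((norm (u + v))\<^sup>2 + (norm (u - v))\<^sup>2)
          + C * ((norm (u + \<i> *\<^sub>C v))\<^sup>2 + (norm (u - \<i> *\<^sub>C v))\<^sup>2))"
        by (simp add: algebra_simps)
      also have "\<dots> = 2 * C" unfolding par using that by (simp add: norm_scaleC)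
      finally show ?thesis .
    qed
    show ?thesis
    proof (cases "x = 0 \<or> y = 0")
      case True
      then show ?thesis
        using B_scale_left[OF f(1), of 0 x y] B_scale_right[OF f(1), of x 0 y] by auto
    next
      case False
      define u where "u = complex_of_real (1 / norm x) *\<^sub>C x"
      define v where "v = complex_of_real (1 / norm y) *\<^sub>C y"
      have "cmod (B f u v) \<le> 2 * C"
        by (rule unit) (use False in \<open>simp_all add: u_def v_def norm_scaleC norm_divide\<close>)
      moreover have "B f u v = complex_of_real (1 / norm y) * (complex_of_real (1 / norm x) * B f x y)"
        by (simp only: u_def v_def B_scale_left[OF f(1)] B_scale_right[OF f(1)] complex_cnj_complex_of_real)
      then have "cmod (B f u v) = cmod (B f x y) / (norm x * norm y)"
        by (simp add: norm_mult norm_divide)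
      ultimately show ?thesis using False by (simp add: divide_simps mult.assoc)
    qed
  qed
  have "\<exists>S. bounded_clinear S \<and> (\<forall>x y. cinner (S x) y = B f x y)" if f: "f \<in> bdd_borel" for f
  proof -
    obtain C where "\<And>t. cmod (f t) \<le> C" using bdd_borelE[OF f] by blast
    then show ?thesis
      using form_representation[OF B_add_left[OF f] B_add_right[OF f] B_scale_left[OF f]
          B_scale_right[OF f] B_bound[OF f]] by blast
  qed
  then obtain \<Phi> where \<Phi>: "\<And>f. f \<in> bdd_borel \<Longrightarrow> bounded_clinear (\<Phi> f)"
    "\<And>f x y. f \<in> bdd_borel \<Longrightarrow> cinner (\<Phi> f x) y = B f x y" by metis
  have \<Phi>_bp: "bp_functional (\<lambda>f. cinner (\<Phi> f x) y)" for x y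
    by (rule bp_functional_cong[OF B_bp \<Phi>(2)])
  have \<Phi>_null: "cinner (\<Phi> f x) y = 0" if "f \<in> bdd_borel" "\<And>t. t \<in> X \<Longrightarrow> f t = 0" for f x y
    using \<Phi>(2)[OF that(1)] B_null[OF that] by simp
  have \<Phi>_G: "\<Phi> (g i) = T i" if "i \<in> I" for i
    by (rule ext, rule cinner_eqI) (use that G \<Phi>(2) B_G in auto)
  \<comment> \<open>Multiplicativity comes in two rounds: here the second factor is a generator and
    the first is arbitrary; afterwards the second factor is extended as well.\<close>
  have mult1: "B (\<lambda>t. f t * g i t) x y = B f (T i x) y" if f: "f \<in> bdd_borel" and i: "i \<in> I" for f i x y
  proof (rule eq[OF bp_functional_times[OF B_bp G[OF i]] B_bp _ _ _ f])
    show "B (\<lambda>t. f t * g i t) x y = 0" if "f \<in> bdd_borel" "\<And>t. t \<in> X \<Longrightarrow> f t = 0" for f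
      by (rule B_null) (use that i G in \<open>auto intro: bdd_borel_mult\<close>)
    show "B f (T i x) y = 0" if "f \<in> bdd_borel" "\<And>t. t \<in> X \<Longrightarrow> f t = 0" for f
      by (rule B_null[OF that])
    fix j assume j: "j \<in> I"
    obtain k where "k \<in> I" "g k = (\<lambda>t. g j t * g i t)" "\<And>x. T k x = T j (T i x)"
      using mult[OF j i] by blast
    then show "B (\<lambda>t. g j t * g i t) x y = B (g j) (T i x) y"
      using B_G[of k x y] B_G[OF j] by simp
  qed
  have \<Phi>_mult: "\<Phi> (\<lambda>t. f t * e t) x = \<Phi> f (\<Phi> e x)" if f: "f \<in> bdd_borel" and e: "e \<in> bdd_borel" for f e x
  proof (rule cinner_eqI)
    fix y
    have "bp_functional (\<lambda>e. B (\<lambda>t. e t * f t) x y)" by (rule bp_functional_times[OF B_bp f])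
    then have 1: "bp_functional (\<lambda>e. B (\<lambda>t. f t * e t) x y)" by (simp add: mult.commute)
    \<comment> \<open>Moving \<open>\<Phi> f\<close> to the other side by its adjoint leaves a
      matrix coefficient of \<open>\<Phi> e\<close>, which is a functional in
      \<open>e\<close>.\<close>
    have 2: "bp_functional (\<lambda>e. cinner (\<Phi> f (\<Phi> e x)) y)"
      unfolding adj_cinner[OF \<Phi>(1)[OF f]] by (rule \<Phi>_bp)
    have "B (\<lambda>t. f t * e t) x y = cinner (\<Phi> f (\<Phi> e x)) y"
    proof (rule eq[OF 1 2 _ _ _ e])
      show "B (\<lambda>t. f t * h t) x y = 0" if "h \<in> bdd_borel" "\<And>t. t \<in> X \<Longrightarrow> h t = 0" for h
        by (rule B_null) (use that f in \<open>auto intro: bdd_borel_mult\<close>)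
      show "cinner (\<Phi> f (\<Phi> h x)) y = 0" if "h \<in> bdd_borel" "\<And>t. t \<in> X \<Longrightarrow> h t = 0" for h
        unfolding adj_cinner[OF \<Phi>(1)[OF f]] by (rule \<Phi>_null[OF that])
      show "B (\<lambda>t. f t * g i t) x y = cinner (\<Phi> f (\<Phi> (g i) x)) y" if "i \<in> I" for i
        using mult1[OF f that] \<Phi>(2)[OF f] \<Phi>_G[OF that] by simp
    qed
    then show "cinner (\<Phi> (\<lambda>t. f t * e t) x) y = cinner (\<Phi> f (\<Phi> e x)) y"
      using \<Phi>(2) bdd_borel_mult[OF f e] by simp
  qed
  have \<Phi>_q: "cinner (\<Phi> f x) x = q f x" if "f \<in> bdd_borel" for f x
    using that by (simp add: \<Phi>(2) B_diag)
  have adj: "adj (\<Phi> f) = \<Phi> (\<lambda>t. cnj (f t))" if f: "f \<in> bdd_borel" for f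
  proof (rule quadratic_form_determines[OF bounded_clinear_adj[OF \<Phi>(1)[OF f]] \<Phi>(1)[OF bdd_borel_cnj[OF f]]])
    fix x
    have "cinner (adj (\<Phi> f) x) x = cnj (cinner (\<Phi> f x) x)"
      unfolding adj_cinner[OF \<Phi>(1)[OF f]] by (rule cinner_commute)
    also have "\<dots> = cinner (\<Phi> (\<lambda>t. cnj (f t)) x) x"
      using f by (simp add: \<Phi>_q q_cnj bdd_borel_cnj)
    finally show "cinner (adj (\<Phi> f) x) x = cinner (\<Phi> (\<lambda>t. cnj (f t)) x) x" .
  qed
  have "cinner (\<Phi> f x) y = cinner x (\<Phi> (\<lambda>t. cnj (f t)) y)" if "f \<in> bdd_borel" for f x y
    unfolding adj_cinner[OF \<Phi>(1)[OF that]] adj[OF that] by (rule refl)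
  moreover have "\<Phi> (\<lambda>_. 1) = id" using one \<Phi>_G by metis
  ultimately have "borel_calculus \<Phi>"
    unfolding borel_calculus_def using \<Phi>(1) \<Phi>_bp \<Phi>_mult by simp
  moreover have "\<Phi> f x = 0" if "f \<in> bdd_borel" "\<forall>t\<in>X. f t = 0" for f x
    by (rule cinner_eqI) (use \<Phi>_null[OF that(1)] that(2) in \<open>auto simp: cinner.zero_left\<close>)
  ultimately show ?thesis using \<Phi>_q \<Phi>_G by blast
qed

section \<open>Rules of computation in a Borel calculus\<close>

context
  fixes \<Phi> :: "(real \<Rightarrow> complex) \<Rightarrow> 'h::complex_hilbert \<Rightarrow> 'h"
  assumes \<Phi>: "borel_calculus \<Phi>"
begin

lemma calculus_clinear: "f \<in> bdd_borel \<Longrightarrow> bounded_clinear (\<Phi> f)"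
  using \<Phi> unfolding borel_calculus_def by blast

lemma calculus_bp: "bp_functional (\<lambda>f. cinner (\<Phi> f x) y)"
  using \<Phi> unfolding borel_calculus_def by blast

lemma calculus_one: "\<Phi> (\<lambda>_. 1) = id"
  using \<Phi> unfolding borel_calculus_def by blast

lemma calculus_mult:
  "f \<in> bdd_borel \<Longrightarrow> g \<in> bdd_borel \<Longrightarrow> \<Phi> (\<lambda>t. f t * g t) x = \<Phi> f (\<Phi> g x)"
  using \<Phi> unfolding borel_calculus_def by blast

lemma calculus_cinner:
  "f \<in> bdd_borel \<Longrightarrow> cinner (\<Phi> f x) y = cinner x (\<Phi> (\<lambda>t. cnj (f t)) y)"
  using \<Phi> unfolding borel_calculus_def by blast

lemma calculus_add:
  "f \<in> bdd_borel \<Longrightarrow> g \<in> bdd_borel \<Longrightarrow> \<Phi> (\<lambda>t. f t + g t) x = \<Phi> f x + \<Phi> g x"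
  by (rule cinner_eqI) (simp add: cinner_add_left bp_functional_add_arg[OF calculus_bp])

lemma calculus_diff:
  "f \<in> bdd_borel \<Longrightarrow> g \<in> bdd_borel \<Longrightarrow> \<Phi> (\<lambda>t. f t - g t) x = \<Phi> f x - \<Phi> g x"
  by (rule cinner_eqI) (simp add: cinner.diff_left bp_functional_diff_arg[OF calculus_bp])

lemma calculus_scale:
  "f \<in> bdd_borel \<Longrightarrow> \<Phi> (\<lambda>t. c * f t) x = c *\<^sub>C \<Phi> f x"
  by (rule cinner_eqI) (simp add: cinner_scaleC_left bp_functional_mult_arg[OF calculus_bp])

lemma calculus_cinner_cinner:
  assumes "f \<in> bdd_borel" "g \<in> bdd_borel"
  shows "cinner (\<Phi> f x) (\<Phi> g x) = cinner (\<Phi> (\<lambda>t. f t * cnj (g t)) x) x"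
proof -
  have "cinner (\<Phi> (\<lambda>t. f t * cnj (g t)) x) x = cinner (\<Phi> (\<lambda>t. cnj (g t) * f t) x) x"
    by (simp add: mult.commute)
  also have "\<dots> = cinner (\<Phi> (\<lambda>t. cnj (g t)) (\<Phi> f x)) x"
    using assms by (simp add: calculus_mult bdd_borel_cnj)
  also have "\<dots> = cinner (\<Phi> f x) (\<Phi> g x)"
    using calculus_cinner[OF bdd_borel_cnj[OF assms(2)]] by simp
  finally show ?thesis by simp
qed

lemma calculus_norm:
  assumes "f \<in> bdd_borel"
  shows "complex_of_real ((norm (\<Phi> f x))\<^sup>2) = cinner (\<Phi> (\<lambda>t. complex_of_real ((cmod (f t))\<^sup>2)) x) x"
  using calculus_cinner_cinner[OF assms assms, of x]
  unfolding cinner_self complex_norm_square[symmetric] by simp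

text \<open>Weak continuity upgrades to strong continuity, because the squared norm of
  \<open>\<Phi> (F n) x - \<Phi> f x\<close> is itself the expectation of
  \<open>(cmod (F n t - f t))\<^sup>2\<close>.\<close>

lemma calculus_limit:
  assumes F: "\<And>n. F n \<in> borel_measurable borel" "\<And>n t. cmod (F n t) \<le> C"
    "\<And>t. (\<lambda>n. F n t) \<longlonglongrightarrow> f t"
  shows "(\<lambda>n. \<Phi> (F n) x) \<longlonglongrightarrow> \<Phi> f x"
proof -
  have fm: "f \<in> borel_measurable borel"
    by (rule borel_measurable_LIMSEQ_metric[OF F(1) F(3)])
  have fC: "cmod (f t) \<le> C" for t
    by (rule LIMSEQ_le_const2[OF tendsto_norm[OF F(3)]]) (use F(2) in blast)
  have f: "f \<in> bdd_borel" by (rule bdd_borelI[OF fm fC])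
  have Fn: "F n \<in> bdd_borel" for n by (rule bdd_borelI[OF F(1,2)])
  have "(\<lambda>n. cinner (\<Phi> (\<lambda>t. complex_of_real ((cmod (F n t - f t))\<^sup>2)) x) x)
      \<longlonglongrightarrow> cinner (\<Phi> (\<lambda>t. 0) x) x"
  proof (rule bp_functional_limit[OF calculus_bp])
    show "cmod (complex_of_real ((cmod (F n t - f t))\<^sup>2)) \<le> (2 * C)\<^sup>2" for n t
    proof -
      have "cmod (F n t - f t) \<le> 2 * C"
        using norm_triangle_ineq4[of "F n t" "f t"] F(2)[of n t] fC[of t] by linarith
      from power_mono[OF this, of 2] show ?thesis by (simp add: norm_power)
    qed
    show "(\<lambda>n. complex_of_real ((cmod (F n t - f t))\<^sup>2)) \<longlonglongrightarrow> 0" for t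
      using F(3)[of t] by (auto intro!: tendsto_eq_intros)
  qed (use F(1) fm in measurable)
  also have "cinner (\<Phi> (\<lambda>t. 0) x) x = 0"
    using bp_functional_zero_arg[OF calculus_bp] .
  also have "(\<lambda>n. cinner (\<Phi> (\<lambda>t. complex_of_real ((cmod (F n t - f t))\<^sup>2)) x) x) =
      (\<lambda>n. complex_of_real ((norm (\<Phi> (F n) x - \<Phi> f x))\<^sup>2))"
    using calculus_norm[OF bdd_borel_diff[OF Fn f]] by (simp add: calculus_diff Fn f)
  finally have "(\<lambda>n. (norm (\<Phi> (F n) x - \<Phi> f x))\<^sup>2) \<longlonglongrightarrow> 0"
    by (drule_tac tendsto_Re) simp
  then have "(\<lambda>n. norm (\<Phi> (F n) x - \<Phi> f x)) \<longlonglongrightarrow> 0"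
    using tendsto_real_sqrt by fastforce
  then show ?thesis using LIM_zero_cancel tendsto_norm_zero_iff by blast
qed

lemma calculus_unitary:
  assumes "f \<in> bdd_borel" "\<And>t. cmod (f t) = 1"
  shows "\<Phi> f (\<Phi> (\<lambda>t. cnj (f t)) x) = x" "\<Phi> (\<lambda>t. cnj (f t)) (\<Phi> f x) = x"
proof -
  have "f t * cnj (f t) = 1" for t
    using assms(2) by (simp add: complex_norm_square[symmetric])
  then show "\<Phi> f (\<Phi> (\<lambda>t. cnj (f t)) x) = x" "\<Phi> (\<lambda>t. cnj (f t)) (\<Phi> f x) = x"
    using calculus_mult[OF assms(1) bdd_borel_cnj[OF assms(1)], of x]
      calculus_mult[OF bdd_borel_cnj[OF assms(1)] assms(1), of x]
    by (simp_all add: calculus_one mult.commute)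
qed

end

subsection \<open>Projection-valued measures\<close>

context
  fixes E :: "real set \<Rightarrow> 'h::complex_hilbert \<Rightarrow> 'h"
  assumes E: "projection_valued_measure E"
begin

lemma pvm_clinear: "B \<in> sets borel \<Longrightarrow> bounded_clinear (E B)"
  using E unfolding projection_valued_measure_def by blast

lemma pvm_UNIV: "E UNIV = id"
  using E unfolding projection_valued_measure_def by blast

lemma pvm_Int: "B \<in> sets borel \<Longrightarrow> C \<in> sets borel \<Longrightarrow> E (B \<inter> C) x = E B (E C x)"
  using E unfolding projection_valued_measure_def by (metis comp_apply)

lemma pvm_cinner:
  assumes B: "B \<in> sets borel"
  shows "cinner (E B x) x = complex_of_real ((norm (E B x))\<^sup>2)"
proof -
  have a: "adj (E B) = E B" "E B (E B x) = E B x"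
    using E B unfolding projection_valued_measure_def by (blast, metis comp_apply)
  have "cinner (E B x) x = cinner (E B (E B x)) x" by (simp add: a)
  also have "\<dots> = cinner (E B x) (E B x)" by (simp add: adj_cinner[OF pvm_clinear[OF B]] a)
  finally show ?thesis by (simp add: cinner_self)
qed

lemma pvm_sums:
  assumes "range B \<subseteq> sets borel" "disjoint_family (B :: nat \<Rightarrow> real set)"
  shows "(\<lambda>n. (norm (E (B n) x))\<^sup>2) sums (norm (E (\<Union>n. B n) x))\<^sup>2"
proof -
  have "(\<lambda>n. E (B n) x) sums E (\<Union>n. B n) x"
    using E assms unfolding projection_valued_measure_def by blast
  then have "(\<lambda>n. cinner (E (B n) x) x) sums cinner (E (\<Union>n. B n) x) x"
    by (rule bounded_linear.sums[OF cinner.bounded_linear_left])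
  moreover have "B n \<in> sets borel" "(\<Union>n. B n) \<in> sets borel" for n using assms(1) by auto
  ultimately have "(\<lambda>n. complex_of_real ((norm (E (B n) x))\<^sup>2)) sums complex_of_real ((norm (E (\<Union>n. B n) x))\<^sup>2)"
    by (simp only: pvm_cinner)
  then show ?thesis by (rule sums_of_real_iff[THEN iffD1])
qed

lemma sets_scalar_measure: "sets (scalar_measure E x) = sets borel"
  unfolding scalar_measure_def using sets.sigma_sets_eq[of borel] by simp

lemma space_scalar_measure: "space (scalar_measure E x) = UNIV"
  unfolding scalar_measure_def by (simp add: space_measure_of_conv)

lemma emeasure_scalar_measure:
  assumes B: "B \<in> sets borel"
  shows "emeasure (scalar_measure E x) B = ennreal ((norm (E B x))\<^sup>2)"
proof -
  have ca: "countably_additive (sets borel) (\<lambda>B. ennreal (Re (cinner (E B x) x)))"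
  proof (rule countably_additiveI)
    fix A :: "nat \<Rightarrow> real set"
    assume A: "range A \<subseteq> sets borel" "disjoint_family A" "(\<Union>i. A i) \<in> sets borel"
    have A': "A i \<in> sets borel" for i using A(1) by auto
    show "(\<Sum>i. ennreal (Re (cinner (E (A i) x) x))) = ennreal (Re (cinner (E (\<Union>i. A i) x) x))"
      using pvm_sums[OF A(1,2), of x] A' A(3) by (simp add: pvm_cinner suminf_ennreal_eq sums_iff)
  qed
  have pos: "positive (sets borel) (\<lambda>B. ennreal (Re (cinner (E B x) x)))"
  proof -
    \<comment> \<open>The empty set is a disjoint union of copies of itself, and a summable constant
      series has terms 0.\<close>
    have "(\<lambda>n. (norm (E {} x))\<^sup>2) sums (norm (E {} x))\<^sup>2"
      using pvm_sums[of "\<lambda>_. {}" x] by (simp add: disjoint_family_on_def)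
    then have "(norm (E {} x))\<^sup>2 = 0"
      using summable_LIMSEQ_zero[OF sums_summable] LIMSEQ_unique tendsto_const by blast
    then show ?thesis by (simp add: positive_def cinner.zero_left)
  qed
  have "emeasure (scalar_measure E x) B = ennreal (Re (cinner (E B x) x))"
    by (rule emeasure_measure_of[OF scalar_measure_def])
       (use B pos ca sets_scalar_measure in auto)
  then show ?thesis using B by (simp add: pvm_cinner)
qed

lemma finite_scalar_measure: "finite_measure (scalar_measure E x)"
  by (rule finite_measureI) (simp add: space_scalar_measure emeasure_scalar_measure)

lemma integral_indicator_scalar_measure:
  assumes B: "B \<in> sets borel"
  shows "(\<integral>t. indicator B t \<partial>scalar_measure E x) = cinner (E B x) x"
proof -
  have "(\<integral>t. indicator B t \<partial>scalar_measure E x) =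
      (\<integral>t. complex_of_real (indicator B t) \<partial>scalar_measure E x)"
    by (simp only: of_real_indicator)
  also have "\<dots> = complex_of_real (measure (scalar_measure E x) B)"
    unfolding integral_complex_of_real by (simp add: space_scalar_measure)
  finally show ?thesis using B by (simp add: measure_def emeasure_scalar_measure pvm_cinner)
qed

text \<open>Indicators serve as generators: the product of two is the indicator of the intersection,
  matching the product of the projections. With \<open>X = UNIV\<close> there is no support
  restriction.\<close>

lemma pvm_calculus:
  "\<exists>\<Phi>. borel_calculus \<Phi> \<and> (\<forall>f\<in>bdd_borel. \<forall>x. cinner (\<Phi> f x) x = (\<integral>t. f t \<partial>scalar_measure E x))"
proof -
  have mult: "(\<lambda>t. indicator B t * indicator C t :: complex) = (\<lambda>t. indicator (B \<inter> C) t)" for B C :: "real set"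
    by (auto simp: indicator_def)
  have "\<exists>\<Phi>. borel_calculus \<Phi> \<and> (\<forall>f\<in>bdd_borel. \<forall>x. cinner (\<Phi> f x) x = (\<integral>t. f t \<partial>scalar_measure E x))
      \<and> (\<forall>B\<in>sets borel. \<Phi> (\<lambda>t. indicator B t) = E B)
      \<and> (\<forall>f\<in>bdd_borel. (\<forall>t\<in>UNIV. f t = 0) \<longrightarrow> (\<forall>x. \<Phi> f x = 0))"
  proof (rule borel_calculus_exists[where X = UNIV])
    show "bp_functional (\<lambda>f. \<integral>t. f t \<partial>scalar_measure E x)" for x
      by (rule bp_functional_integral[OF finite_scalar_measure sets_scalar_measure])
    show "cmod (\<integral>t. f t \<partial>scalar_measure E x) \<le> C * (norm x)\<^sup>2"
      if f: "f \<in> bdd_borel" "\<And>t. cmod (f t) \<le> C" for f C x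
    proof -
      interpret finite_measure "scalar_measure E x" by (rule finite_scalar_measure)
      have "cmod (\<integral>t. f t \<partial>scalar_measure E x) \<le> (\<integral>t. C \<partial>scalar_measure E x)"
        using integrable_bdd_borel[OF finite_scalar_measure sets_scalar_measure f(1)]
        by (intro Bochner_Integration.integral_norm_bound_integral f) auto
      also have "\<dots> = C * (norm x)\<^sup>2"
        by (simp add: measure_def space_scalar_measure emeasure_scalar_measure pvm_UNIV)
      finally show ?thesis .
    qed
    show "(\<integral>t. cnj (f t) \<partial>scalar_measure E x) = cnj (\<integral>t. f t \<partial>scalar_measure E x)"
      if "f \<in> bdd_borel" for f x by simp
    show "L f = 0" if "bp_functional L" "\<And>B. B \<in> sets borel \<Longrightarrow> L (\<lambda>t. indicator B t) = 0"
      "f \<in> bdd_borel" for L f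
      by (rule bp_functional_zero_of_indicator[OF that])
    show "\<exists>k\<in>sets borel. (\<lambda>t. indicator k t :: complex) = (\<lambda>t. indicator B t * indicator C t) \<and>
        (\<forall>x. E k x = E B (E C x))" if "B \<in> sets borel" "C \<in> sets borel" for B C
      using that by (intro bexI[of _ "B \<inter> C"]) (auto simp: mult pvm_Int)
    show "\<exists>B\<in>sets borel. (\<lambda>t. indicator B t :: complex) = (\<lambda>_. 1) \<and> E B = id"
      by (rule bexI[of _ UNIV]) (auto simp: pvm_UNIV)
  qed (auto simp: pvm_clinear integral_indicator_scalar_measure)
  then show ?thesis by blast
qed

end

text \<open>Strong countable additivity is \<open>calculus_limit\<close> for the indicators of
  partial unions. The integral formula holds because both sides are functionals in \<open>f\<close>
  that agree on indicators.\<close>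

lemma calculus_pvm:
  assumes \<Phi>: "borel_calculus \<Phi>"
  shows "projection_valued_measure (\<lambda>B. \<Phi> (\<lambda>t. indicator B t))"
    and "f \<in> bdd_borel \<Longrightarrow>
      (\<integral>t. f t \<partial>scalar_measure (\<lambda>B. \<Phi> (\<lambda>t. indicator B t)) x) = cinner (\<Phi> f x) x"
proof -
  let ?E = "\<lambda>B. \<Phi> (\<lambda>t. indicator B t)"
  have mult: "(\<lambda>t. indicator B t * indicator C t :: complex) = (\<lambda>t. indicator (B \<inter> C) t)" for B C :: "real set"
    by (auto simp: indicator_def)
  have Int: "?E (B \<inter> C) = ?E B \<circ> ?E C" if "B \<in> sets borel" "C \<in> sets borel" for B C
    using calculus_mult[OF \<Phi>, of "\<lambda>t. indicator B t" "\<lambda>t. indicator C t"] that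
    by (auto simp: mult)
  show pvm: "projection_valued_measure ?E"
    unfolding projection_valued_measure_def
  proof (intro conjI ballI allI impI)
    fix B :: "real set" assume B: "B \<in> sets borel"
    show "bounded_clinear (?E B)" using B by (simp add: calculus_clinear[OF \<Phi>])
    show "?E B \<circ> ?E B = ?E B" using Int[OF B B] by simp
    show "adj (?E B) = ?E B"
    proof (rule adj_eqI)
      have "(\<lambda>t. cnj (indicator B t)) = (\<lambda>t. indicator B t)" by (auto simp: indicator_def)
      then show "cinner (?E B x) y = cinner x (?E B y)" for x y
        using calculus_cinner[OF \<Phi>, of "\<lambda>t. indicator B t" x y] B by simp
    qed
  next
    show "?E UNIV = id" using calculus_one[OF \<Phi>] by simp
  next
    fix B :: "nat \<Rightarrow> real set" and x
    assume B: "range B \<subseteq> sets borel \<and> disjoint_family B"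
    have B': "B n \<in> sets borel" for n using B by auto
    have "(\<lambda>n. ?E (\<Union>i<n. B i) x) \<longlonglongrightarrow> ?E (\<Union>n. B n) x"
    proof (rule calculus_limit[OF \<Phi>])
      show "(\<lambda>n. indicator (\<Union>i<n. B i) t :: complex) \<longlonglongrightarrow> indicator (\<Union>n. B n) t" for t
        by (rule LIMSEQ_indicator_UN)
    qed (use B' in \<open>auto simp: indicator_def\<close>)
    moreover have "?E (\<Union>i<n. B i) x = (\<Sum>i<n. ?E (B i) x)" for n
    proof (induction n)
      case 0
      have "\<Phi> (\<lambda>t. 0) x = 0"
        by (rule cinner_eqI) (simp add: bp_functional_zero_arg[OF calculus_bp[OF \<Phi>]] cinner.zero_left)
      then show ?case by simp
    next
      case (Suc n)
      have "B i \<inter> B n = {}" if "i < n" for i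
        using disjoint_family_onD[of B UNIV i n] B that by auto
      then have "(\<Union>i<n. B i) \<inter> B n = {}" by blast
      then have "(\<lambda>t. indicator (\<Union>i<Suc n. B i) t :: complex) = (\<lambda>t. indicator (\<Union>i<n. B i) t + indicator (B n) t)"
        by (intro ext) (auto simp: lessThan_Suc split: split_indicator)
      then show ?case
        using Suc B' by (simp add: calculus_add[OF \<Phi>])
    qed
    ultimately show "(\<lambda>n. ?E (B n) x) sums ?E (\<Union>n. B n) x"
      unfolding sums_def by simp
  qed (rule Int)
  assume f: "f \<in> bdd_borel"
  have "(\<lambda>f. (\<integral>t. f t \<partial>scalar_measure ?E x) - cinner (\<Phi> f x) x) f = 0"
    by (rule bp_functional_zero_of_indicator[OF bp_functional_diff[OF bp_functional_integral[OF
          finite_scalar_measure[OF pvm] sets_scalar_measure[OF pvm]] calculus_bp[OF \<Phi>]] _ f])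
       (simp add: integral_indicator_scalar_measure[OF pvm])
  then show "(\<integral>t. f t \<partial>scalar_measure ?E x) = cinner (\<Phi> f x) x" by simp
qed

subsection \<open>The spectral calculus of a unitary operator\<close>

text \<open>Orthogonality of the characters of the cyclic group of order \<open>P\<close>: for
  \<open>m\<close> nonzero the sum is geometric with ratio a \<open>P\<close>-th root of unity,
  which differs from 1 because \<open>P\<close> does not divide \<open>m\<close>.\<close>

lemma sum_cis_equidistant:
  fixes m :: int
  assumes "\<bar>m\<bar> < int P"
  shows "(\<Sum>a<P. cis (of_int m * (2 * pi * real a / real P))) = (if m = 0 then of_nat P else 0)"
proof (cases "m = 0")
  case False
  have P: "P > 0" using assms by (cases P) auto
  define z where "z = cis (2 * pi * of_int m / real P)"
  have za: "cis (of_int m * (2 * pi * real a / real P)) = z ^ a" for a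
    by (simp add: z_def Complex.DeMoivre mult_ac)
  have "z ^ P = cis (2 * pi * of_int m)"
    unfolding z_def Complex.DeMoivre using P by simp
  then have zP: "z ^ P = 1" by (simp add: cis_multiple_2pi)
  have "z \<noteq> 1"
  proof
    assume "z = 1"
    then have "cos (2 * pi * of_int m / real P) = 1" by (simp add: z_def complex_eq_iff)
    then obtain n :: int where "2 * pi * of_int m / real P = of_int n * 2 * pi"
      using cos_one_2pi_int by blast
    then have "real_of_int m = of_int n * real P" using P by (simp add: field_simps)
    then have "m = n * int P" by (metis of_int_eq_iff of_int_mult of_int_of_nat_eq)
    moreover have "1 \<le> \<bar>n\<bar>" using calculation False by (cases "n = 0") auto
    ultimately have "\<bar>m\<bar> \<ge> int P" by (simp add: abs_mult mult_le_cancel_right1)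
    then show False using assms by simp
  qed
  then have "(\<Sum>a<P. z ^ a) = 0" using zP by (simp add: geometric_sum)
  then show ?thesis using False unfolding za by simp
qed simp

lemma cinner_funpow:
  fixes W :: "'h::complex_hilbert \<Rightarrow> 'h"
  assumes "\<And>u v. cinner (W u) (W v) = cinner u v"
  shows "cinner ((W ^^ n) u) ((W ^^ n) v) = cinner u v"
  by (induction n) (simp_all add: assms)

context
  fixes W :: "'h::complex_hilbert \<Rightarrow> 'h" and x :: 'h
  assumes W: "bounded_clinear W" "\<And>u v. cinner (W u) (W v) = cinner u v" and x: "norm x = 1"
begin

text \<open>Its squared norm is \<open>N\<close> times the \<open>N\<close>-th Fejer mean of the
  formal Fourier series with coefficients \<open>cinner ((W ^^ k) x) x\<close>. Written this way the
  mean is visibly nonnegative.\<close>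

definition fejer_vector :: "nat \<Rightarrow> real \<Rightarrow> 'h" where
  "fejer_vector N \<theta> = (\<Sum>j<N. cis (- real j * \<theta>) *\<^sub>C (W ^^ j) x)"

text \<open>In the divisor, one factor \<open>N\<close> normalizes the Fejer mean and
  \<open>2 * N\<close> is the number of nodes, so the weights have total mass 1 for a unit
  vector.\<close>

definition fejer_weight :: "nat \<Rightarrow> nat \<Rightarrow> real" where
  "fejer_weight N a = (norm (fejer_vector N (2 * pi * real a / real (2 * N))))\<^sup>2 / real (2 * N * N)"

text \<open>
  With \<open>2N\<close> equidistant nodes no frequency \<open>k - j + l\<close> (\<open>j, l < N\<close>, \<open>k \<le> N\<close>) is aliased to \<open>0\<close>.
\<close>

lemma sum_fejer_weight:
  assumes "k \<le> N" "N > 0"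
  shows "(\<Sum>a<2*N. of_real (fejer_weight N a) * cis (real k * (2 * pi * real a / real (2 * N)))) =
    of_nat (N - k) / of_nat N * cinner ((W ^^ k) x) x"
proof -
  define \<theta> where "\<theta> a = 2 * pi * real a / real (2 * N)" for a
  define c where "c j l = cinner ((W ^^ j) x) ((W ^^ l) x)" for j l
  have fv: "cinner (fejer_vector N t) (fejer_vector N t) =
      (\<Sum>j<N. \<Sum>l<N. cis (- real j * t) * cis (real l * t) * c j l)" for t
    unfolding fejer_vector_def cinner.sum_left cinner.sum_right cinner_scaleC_left cinner_scaleC_right c_def cis_cnj
    by (subst sum.swap) (simp add: sum_distrib_left mult_ac)
  have w: "of_real (fejer_weight N a) = 
      (\<Sum>j<N. \<Sum>l<N. cis (- real j * \<theta> a) * cis (real l * \<theta> a) * c j l) / of_nat (2 * N * N)" for a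
    unfolding fejer_weight_def \<theta>_def[symmetric] fv[symmetric] cinner_self by simp
  have "(\<Sum>a<2*N. of_real (fejer_weight N a) * cis (real k * \<theta> a)) =
      (\<Sum>a<2*N. \<Sum>j<N. \<Sum>l<N. (c j l / of_nat (2 * N * N)) * cis (of_int (int k - int j + int l) * \<theta> a))"
  proof (rule sum.cong[OF refl])
    fix a
    have "cis (- real j * \<theta> a) * cis (real l * \<theta> a) * cis (real k * \<theta> a) =
        cis (of_int (int k - int j + int l) * \<theta> a)" for j l
      unfolding cis_mult by (rule arg_cong[of _ _ cis]) (simp add: algebra_simps)
    then show "of_real (fejer_weight N a) * cis (real k * \<theta> a) =
        (\<Sum>j<N. \<Sum>l<N. (c j l / of_nat (2 * N * N)) * cis (of_int (int k - int j + int l) * \<theta> a))"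
      unfolding w sum_divide_distrib sum_distrib_right
      by (intro sum.cong refl) (simp add: field_simps)
  qed
  also have "\<dots> = (\<Sum>j<N. \<Sum>l<N. \<Sum>a<2*N. (c j l / of_nat (2 * N * N)) * cis (of_int (int k - int j + int l) * \<theta> a))"
    by (subst sum.swap, rule sum.cong[OF refl], subst sum.swap) (rule refl)
  \<comment> \<open>Summing over the nodes first kills every frequency except 0.\<close>
  also have "\<dots> = (\<Sum>j<N. \<Sum>l<N. if j = k + l then c j l / of_nat N else 0)"
  proof (intro sum.cong refl)
    fix j l assume jl: "j \<in> {..<N}" "l \<in> {..<N}"
    have "\<bar>int k - int j + int l\<bar> < int (2 * N)" using jl assms by auto
    note sum_cis_equidistant[OF this]
    then have "(\<Sum>a<2*N. cis (of_int (int k - int j + int l) * \<theta> a)) = (if j = k + l then of_nat (2 * N) else 0)"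
      unfolding \<theta>_def by (auto split: if_splits)
    then show "(\<Sum>a<2*N. (c j l / of_nat (2 * N * N)) * cis (of_int (int k - int j + int l) * \<theta> a)) =
        (if j = k + l then c j l / of_nat N else 0)"
      unfolding sum_distrib_left[symmetric] using assms by simp
  qed
  also have "\<dots> = (\<Sum>l<N. \<Sum>j<N. if j = k + l then c j l / of_nat N else 0)"
    by (rule sum.swap)
  also have "\<dots> = (\<Sum>l<N. if k + l < N then c (k + l) l / of_nat N else 0)"
    by (intro sum.cong refl) (simp add: sum.delta')
  \<comment> \<open>Since \<open>W\<close> preserves \<open>cinner\<close>, the surviving terms do
    not depend on \<open>l\<close>, and there are \<open>N - k\<close> of them.\<close>
  also have "\<dots> = (\<Sum>l<N. if l < N - k then cinner ((W ^^ k) x) x / of_nat N else 0)"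
  proof (intro sum.cong refl)
    fix l
    have "c (k + l) l = cinner ((W ^^ l) ((W ^^ k) x)) ((W ^^ l) x)"
      unfolding c_def by (simp add: funpow_add add.commute[of k])
    then show "(if k + l < N then c (k + l) l / of_nat N else 0) =
        (if l < N - k then cinner ((W ^^ k) x) x / of_nat N else 0)"
      using assms by (auto simp: cinner_funpow[OF W(2)])
  qed
  also have "\<dots> = of_nat (N - k) * (cinner ((W ^^ k) x) x / of_nat N)"
  proof -
    have "{l. l < N \<and> l < N - k} = {..<N - k}" by auto
    then show ?thesis by (simp add: sum.If_cases Int_def)
  qed
  finally show ?thesis by (simp add: \<theta>_def)
qed

definition fejer_measure :: "nat \<Rightarrow> real measure" where
  "fejer_measure N = distr (point_measure {..<2*N} (\<lambda>a. ennreal (fejer_weight N a))) borel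
     (\<lambda>a. 2 * pi * real a / real (2 * N))"

lemma fejer_weight_nonneg: "fejer_weight N a \<ge> 0"
  by (simp add: fejer_weight_def)

lemma sum_fejer_weight_one: "N > 0 \<Longrightarrow> (\<Sum>a<2*N. fejer_weight N a) = 1"
proof -
  assume "N > 0"
  then have "complex_of_real (\<Sum>a<2*N. fejer_weight N a) = 1"
    using sum_fejer_weight[of 0 N] x by (simp add: cinner_self)
  then show ?thesis using of_real_eq_1_iff by blast
qed

lemma fejer_measure:
  assumes "N > 0"
  shows "real_distribution (fejer_measure N)" and "measure (fejer_measure N) {-1<..7} = 1"
    and "k \<le> N \<Longrightarrow> char (fejer_measure N) (real k) = of_nat (N - k) / of_nat N * cinner ((W ^^ k) x) x"
proof -
  let ?M = "point_measure {..<2*N} (\<lambda>a. ennreal (fejer_weight N a))"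
  have emeasure: "emeasure ?M {..<2*N} = 1"
    using sum_fejer_weight_one[OF assms] fejer_weight_nonneg
    by (simp add: emeasure_point_measure_finite sum_ennreal)
  interpret prob_space ?M
    by (rule prob_spaceI) (simp add: space_point_measure emeasure)
  show "real_distribution (fejer_measure N)"
    unfolding fejer_measure_def by (rule real_distribution_distr) simp
  \<comment> \<open>All nodes lie in [0, 2 pi); the interval from -1 to 7 is a half-open one with
    convenient endpoints, independent of \<open>N\<close>, as tightness requires.\<close>
  have "2 * pi * real a / real (2 * N) \<in> {-1<..7}" if "a < 2 * N" for a
  proof -
    have "- 1 < 2 * pi * real a / real (2 * N)"
      by (rule less_le_trans[of _ 0]) simp_all
    moreover have "2 * pi * real a / real (2 * N) = 2 * pi * (real a / real (2 * N))" by simp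
    moreover have "2 * pi * (real a / real (2 * N)) \<le> 2 * pi * 1"
      using that by (intro mult_left_mono) auto
    moreover have "2 * pi \<le> 7" using pi_less_4 pi_approx by simp
    ultimately show ?thesis unfolding greaterThanAtMost_iff by linarith
  qed
  then have "(\<lambda>a. 2 * pi * real a / real (2 * N)) -` {-1<..7} \<inter> space ?M = {..<2*N}"
    by (auto simp: space_point_measure)
  then have "emeasure (fejer_measure N) {-1<..7} = 1"
    unfolding fejer_measure_def by (subst emeasure_distr) (simp_all add: emeasure)
  then show "measure (fejer_measure N) {-1<..7} = 1" by (simp add: measure_def)
  assume "k \<le> N"
  have "char (fejer_measure N) (real k) =
      (\<integral>a. iexp (real k * (2 * pi * real a / real (2 * N))) \<partial>?M)"
    unfolding char_def fejer_measure_def by (subst integral_distr) simp_all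
  also have "\<dots> = (\<Sum>a<2*N. fejer_weight N a *\<^sub>R cis (real k * (2 * pi * real a / real (2 * N))))"
    using fejer_weight_nonneg unfolding cis_conv_exp
    by (subst lebesgue_integral_point_measure_finite) auto
  also have "\<dots> = of_nat (N - k) / of_nat N * cinner ((W ^^ k) x) x"
    using sum_fejer_weight[OF \<open>k \<le> N\<close> assms] by (simp add: scaleR_conv_of_real)
  finally show "char (fejer_measure N) (real k) = of_nat (N - k) / of_nat N * cinner ((W ^^ k) x) x" .
qed

text \<open>The trigonometric moment problem for \<open>cinner ((W ^^ k) x) x\<close>. The Fejer
  measures share one bounded interval, hence are tight; along a convergent subsequence their
  \<open>k\<close>-th moments carry the factor \<open>1 - k / N\<close>, which tends to 1. Negative
  frequencies follow later by conjugation.\<close>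

lemma herglotz_measure:
  "\<exists>\<mu>. real_distribution \<mu> \<and> (\<forall>k. char \<mu> (real k) = cinner ((W ^^ k) x) x)"
proof -
  have "tight (\<lambda>n. fejer_measure (Suc n))"
    unfolding tight_def
  proof (intro conjI allI impI)
    show "real_distribution (fejer_measure (Suc n))" for n by (rule fejer_measure) simp
    fix e :: real assume "e > 0"
    then show "\<exists>a b. a < b \<and> (\<forall>n. 1 - e < measure (fejer_measure (Suc n)) {a<..b})"
      by (intro exI[of _ "-1"] exI[of _ 7]) (simp add: fejer_measure(2))
  qed
  from tight_imp_convergent_subsubsequence[OF this strict_mono_id]
  obtain r \<mu> where r: "strict_mono (r :: nat \<Rightarrow> nat)" and \<mu>: "real_distribution \<mu>"
    "weak_conv_m (\<lambda>n. fejer_measure (Suc (r n))) \<mu>" by (auto simp: comp_def)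
  have "char \<mu> (real k) = cinner ((W ^^ k) x) x" for k
  proof -
    have lim1: "(\<lambda>n. char (fejer_measure (Suc (r n))) (real k)) \<longlonglongrightarrow> char \<mu> (real k)"
      by (rule levy_continuity1[OF _ \<mu>]) (simp add: fejer_measure)
    have "(\<lambda>N. of_real (1 - real k / real (Suc N)) * cinner ((W ^^ k) x) x) \<longlonglongrightarrow>
        of_real (1 - 0) * cinner ((W ^^ k) x) x"
      by (intro tendsto_intros LIMSEQ_Suc lim_const_over_n)
    then have lim2: "(\<lambda>n. of_real (1 - real k / real (Suc (r n))) * cinner ((W ^^ k) x) x) \<longlonglongrightarrow>
        cinner ((W ^^ k) x) x"
      using LIMSEQ_subseq_LIMSEQ[OF _ r] by (fastforce simp: comp_def)
    \<comment> \<open>The moment formula requires \<open>k \<le> Suc (r n)\<close>, which holds from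
      \<open>n = k\<close> on since a strictly increasing \<open>r\<close> satisfies
      \<open>n \<le> r n\<close>.\<close>
    have "char (fejer_measure (Suc (r n))) (real k) =
        of_real (1 - real k / real (Suc (r n))) * cinner ((W ^^ k) x) x" if "n \<ge> k" for n
    proof -
      have "k \<le> Suc (r n)" using seq_suble[OF r, of n] that by linarith
      then show ?thesis
        by (simp add: fejer_measure(3) of_nat_diff field_simps)
    qed
    then have "(\<lambda>n. char (fejer_measure (Suc (r n))) (real k)) \<longlonglongrightarrow> cinner ((W ^^ k) x) x"
      by (intro Lim_transform_eventually[OF lim2] eventually_sequentiallyI[of k]) (rule sym)
    with lim1 show ?thesis using LIMSEQ_unique by blast
  qed
  with \<mu>(1) show ?thesis by blast
qed

end

section \<open>From moment measures to the calculus of a unitary operator\<close>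

lemma funpow_inverse:
  fixes W V :: "'a \<Rightarrow> 'a"
  assumes "\<And>x. W (V x) = x"
  shows "(W ^^ n) ((V ^^ n) x) = x"
proof (induction n arbitrary: x)
  case (Suc n)
  have "(W ^^ Suc n) ((V ^^ Suc n) x) = W ((W ^^ n) ((V ^^ n) (V x)))"
    by (simp add: funpow_swap1)
  then show ?case by (simp add: Suc assms)
qed simp

lemma funpow_commute:
  fixes W V :: "'a \<Rightarrow> 'a"
  assumes "\<And>x. W (V x) = V (W x)"
  shows "(W ^^ a) ((V ^^ b) x) = (V ^^ b) ((W ^^ a) x)"
proof -
  have 1: "W ((V ^^ b) x) = (V ^^ b) (W x)" for x by (induction b) (simp_all add: assms)
  show ?thesis by (induction a) (simp_all add: 1)
qed

text \<open>For each vector a separate moment measure is chosen, with no relation between different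
  vectors. That they fit together to operators is supplied by \<open>borel_calculus_exists\<close>,
  as the characters determine everything.\<close>

lemma unitary_circle_calculus:
  fixes W V :: "'h::complex_hilbert \<Rightarrow> 'h"
  assumes W: "bounded_clinear W" "bounded_clinear V"
    and inv: "\<And>x. W (V x) = x" "\<And>x. V (W x) = x"
    and adj: "\<And>x y. cinner (W x) y = cinner x (V y)"
  shows "\<exists>\<Phi>. borel_calculus \<Phi> \<and> \<Phi> cis = W \<and>
    (\<forall>f\<in>bdd_borel. (\<forall>t\<in>{-pi<..pi}. f t = 0) \<longrightarrow> (\<forall>x. \<Phi> f x = 0))"
proof -
  have iso: "cinner (W u) (W v) = cinner u v" for u v by (simp add: adj inv)
  have "\<exists>\<mu>. real_distribution \<mu> \<and>
      (\<forall>k. complex_of_real ((norm x)\<^sup>2) * char \<mu> (real k) = cinner ((W ^^ k) x) x)" for x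
  proof (cases "x = 0")
    case True
    \<comment> \<open>For the zero vector the factor \<open>(norm x)\<^sup>2\<close> vanishes, so
      any distribution will do.\<close>
    have "real_distribution (std_normal_distribution)" by (rule real_dist_normal_dist)
    moreover have "(W ^^ k) 0 = 0" for k by (rule bounded_clinear_zero[OF bounded_clinear_funpow[OF W(1)]])
    ultimately show ?thesis using True by (auto simp: cinner.zero_left)
  next
    case False
    define u where "u = complex_of_real (1 / norm x) *\<^sub>C x"
    have u: "norm u = 1" using False by (simp add: u_def norm_scaleC norm_divide)
    have xu: "x = complex_of_real (norm x) *\<^sub>C u" using False by (simp add: u_def scaleC_scaleC)
    obtain \<mu> where \<mu>: "real_distribution \<mu>" "\<And>k. char \<mu> (real k) = cinner ((W ^^ k) u) u"
      using herglotz_measure[OF W(1) iso u] by blast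
    have "cinner ((W ^^ k) x) x = complex_of_real ((norm x)\<^sup>2) * cinner ((W ^^ k) u) u" for k
      by (subst (1 2) xu) (simp add: bounded_clinear_scaleC[OF bounded_clinear_funpow[OF W(1)]]
        cinner_scaleC_left cinner_scaleC_right power2_eq_square)
    then show ?thesis using \<mu> by auto
  qed
  then obtain \<mu> where \<mu>: "\<And>x. real_distribution (\<mu> x)"
    "\<And>x k. complex_of_real ((norm x)\<^sup>2) * char (\<mu> x) (real k) = cinner ((W ^^ k) x) x" by metis
  have fin: "finite_measure (\<mu> x)" "sets (\<mu> x) = sets borel" for x
  proof -
    interpret real_distribution "\<mu> x" by (rule \<mu>)
    show "finite_measure (\<mu> x)" "sets (\<mu> x) = sets borel" by (rule finite_measure_axioms) simp
  qed
  have m: "(\<lambda>t. Arg (cis t)) \<in> borel_measurable borel"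
    by (rule measurable_compose[OF _ borel_measurable_Arg])
       (intro borel_measurable_continuous_onI continuous_intros)
  \<comment> \<open>Nothing is recorded about the support of \<open>\<mu> x\<close>. Composition
    with \<open>Arg (cis t)\<close> folds the line onto (-pi, pi] and leaves integer frequencies
    unchanged.\<close>
  define q where "q f x = complex_of_real ((norm x)\<^sup>2) * (\<integral>t. f (Arg (cis t)) \<partial>\<mu> x)" for f x
  have char_neg: "char (\<mu> x) (- t) = cnj (char (\<mu> x) t)" for x t
    unfolding char_def Bochner_Integration.integral_cnj[symmetric]
    by (rule Bochner_Integration.integral_cong) (simp_all add: exp_cnj)
  have "cis (of_int k * Arg (cis t)) = iexp (of_int k * t)" for k t
  proof -
    have "cis (Arg (cis t)) = cis t" by (simp add: cis_Arg sgn_eq)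
    then have "cis (of_int k * Arg (cis t)) = cis (of_int k * t)"
      unfolding cis_power_int[symmetric] by (rule arg_cong)
    then show ?thesis by (simp add: cis_conv_exp)
  qed
  then have q_cis: "q (\<lambda>t. cis (of_int k * t)) x = complex_of_real ((norm x)\<^sup>2) * char (\<mu> x) (of_int k)" for k x
    unfolding q_def char_def by simp
  have VW: "cinner ((V ^^ k) x) x = cnj (cinner ((W ^^ k) x) x)" for k x
  proof -
    have "cinner ((W ^^ k) x) x = cinner ((W ^^ k) x) ((W ^^ k) ((V ^^ k) x))"
      by (simp add: funpow_inverse inv)
    also have "\<dots> = cinner x ((V ^^ k) x)" by (rule cinner_funpow[OF iso])
    finally show ?thesis by (simp add: cinner_commute[of "(V ^^ k) x" x])
  qed
  \<comment> \<open>A pair \<open>(a, b)\<close> stands for the integer power \<open>a - b\<close>,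
    realized as \<open>a\<close> factors \<open>W\<close> and \<open>b\<close> factors of its
    inverse \<open>V\<close>. The redundancy makes products a plain addition of pairs.\<close>
  define g :: "nat \<times> nat \<Rightarrow> real \<Rightarrow> complex" where "g = (\<lambda>(a, b) t. cis (of_int (int a - int b) * t))"
  define T where "T = (\<lambda>(a, b) x. (W ^^ a) ((V ^^ b) x))"
  have comm: "(W ^^ a) ((V ^^ b) x) = (V ^^ b) ((W ^^ a) x)" for a b x
    by (rule funpow_commute) (simp add: inv)
  have "\<exists>\<Phi>. borel_calculus \<Phi> \<and> (\<forall>f\<in>bdd_borel. \<forall>x. cinner (\<Phi> f x) x = q f x) \<and>
      (\<forall>i\<in>UNIV. \<Phi> (g i) = T i) \<and>
      (\<forall>f\<in>bdd_borel. (\<forall>t\<in>{-pi<..pi}. f t = 0) \<longrightarrow> (\<forall>x. \<Phi> f x = 0))"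
  proof (rule borel_calculus_exists)
    show "bp_functional (\<lambda>f. q f x)" for x
      unfolding q_def
      by (intro bp_functional_mult bp_functional_compose[OF bp_functional_integral m] fin)
    show "cmod (q f x) \<le> C * (norm x)\<^sup>2" if f: "f \<in> bdd_borel" "\<And>t. cmod (f t) \<le> C" for f C x
    proof -
      interpret real_distribution "\<mu> x" by (rule \<mu>)
      have "cmod (\<integral>t. f (Arg (cis t)) \<partial>\<mu> x) \<le> (\<integral>t. C \<partial>\<mu> x)"
        using integrable_bdd_borel[OF fin bdd_borel_compose[OF f(1) m]]
        by (intro Bochner_Integration.integral_norm_bound_integral f) auto
      also have "\<dots> = C" using prob_space by simp
      finally have "cmod (q f x) \<le> (norm x)\<^sup>2 * C"
        unfolding q_def norm_mult norm_of_real by (intro mult_mono) auto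
      then show ?thesis by (simp add: mult.commute)
    qed
    show "q (\<lambda>t. cnj (f t)) x = cnj (q f x)" if "f \<in> bdd_borel" for f x
      unfolding q_def by simp
    show "q f x = 0" if "f \<in> bdd_borel" "\<And>t. t \<in> {-pi<..pi} \<Longrightarrow> f t = 0" for f x
    proof -
      have "f (Arg (cis t)) = 0" for t using that(2) mpi_less_Arg Arg_le_pi by simp
      then show ?thesis by (simp add: q_def)
    qed
    show "L f = 0" if L: "bp_functional L"
      "\<And>f. f \<in> bdd_borel \<Longrightarrow> (\<And>t. t \<in> {-pi<..pi} \<Longrightarrow> f t = 0) \<Longrightarrow> L f = 0"
      "\<And>i. i \<in> UNIV \<Longrightarrow> L (g i) = 0" "f \<in> bdd_borel" for L f
    proof (rule bp_functional_zero_of_cis[OF L(1,2) _ L(4)])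
      fix k :: int
      have "int (nat k) - int (nat (- k)) = k" by simp
      then have "g (nat k, nat (- k)) = (\<lambda>t. cis (of_int k * t))"
        by (simp only: g_def prod.case)
      then show "L (\<lambda>t. cis (of_int k * t)) = 0" using L(3)[of "(nat k, nat (- k))"] by simp
    qed
    show "g i \<in> bdd_borel" for i by (cases i) (simp add: g_def)
    show "bounded_clinear (T i)" for i
      by (cases i) (simp add: T_def bounded_clinear_compose bounded_clinear_funpow W)
    show "q (g i) x = cinner (T i x) x" for i x
    proof -
      obtain a b where i: "i = (a, b)" by (cases i)
      have q: "q (g i) x = complex_of_real ((norm x)\<^sup>2) * char (\<mu> x) (of_int (int a - int b))"
        unfolding i g_def prod.case q_cis by (rule refl)
      show ?thesis
      proof (cases "b \<le> a")
        case True
        then have "(W ^^ a) ((V ^^ b) x) = (W ^^ (a - b)) ((W ^^ b) ((V ^^ b) x))"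
          by (metis comp_apply funpow_add le_add_diff_inverse2)
        then have Ti: "T i x = (W ^^ (a - b)) x" by (simp add: i T_def funpow_inverse inv)
        have r: "real_of_int (int a - int b) = real (a - b)" using True by simp
        show ?thesis unfolding q Ti r by (rule \<mu>(2))
      next
        case False
        then have "(V ^^ b) ((W ^^ a) x) = (V ^^ (b - a)) ((V ^^ a) ((W ^^ a) x))"
          by (metis comp_apply funpow_add le_add_diff_inverse2 nat_le_linear)
        then have Ti: "T i x = (V ^^ (b - a)) x"
          unfolding i T_def prod.case comm by (simp add: funpow_inverse inv)
        have r: "real_of_int (int a - int b) = - real (b - a)" using False by simp
        show ?thesis unfolding q Ti r VW \<mu>(2)[symmetric] char_neg by simp
      qed
    qed
    show "\<exists>i\<in>UNIV. g i = (\<lambda>_. 1) \<and> T i = id"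
      by (rule bexI[of _ "(0, 0)"]) (auto simp: g_def T_def)
    show "\<exists>k\<in>UNIV. g k = (\<lambda>t. g i t * g j t) \<and> (\<forall>x. T k x = T i (T j x))" for i j
    proof -
      obtain a b c d where ij: "i = (a, b)" "j = (c, d)" by (cases i, cases j)
      show ?thesis
      proof (intro bexI[of _ "(a + c, b + d)"] conjI allI)
        show "g (a + c, b + d) = (\<lambda>t. g i t * g j t)"
          by (auto simp: ij g_def cis_mult algebra_simps)
        show "T (a + c, b + d) x = T i (T j x)" for x
          unfolding ij T_def prod.case funpow_add comp_def comm[of c] comm[of a] by (simp only: comm)
      qed simp
    qed
  qed
  then obtain \<Phi> where \<Phi>: "borel_calculus \<Phi>" "\<Phi> (g (1, 0)) = T (1, 0)"
    "\<forall>f\<in>bdd_borel. (\<forall>t\<in>{-pi<..pi}. f t = 0) \<longrightarrow> (\<forall>x. \<Phi> f x = 0)" by blast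
  have "g (1, 0) = cis" "T (1, 0) = W" by (auto simp: g_def T_def)
  with \<Phi> show ?thesis by auto
qed

text \<open>A change of variable from the angle to the real line. The only angle in (-pi, pi] that
  \<open>inv_cayley\<close> treats wrongly is 0, and its spectral projection vanishes because
  \<open>W\<close> has no nonzero fixed vector.\<close>

lemma unitary_calculus:
  fixes W V :: "'h::complex_hilbert \<Rightarrow> 'h"
  assumes W: "bounded_clinear W" "bounded_clinear V"
    and inv: "\<And>x. W (V x) = x" "\<And>x. V (W x) = x"
    and adj: "\<And>x y. cinner (W x) y = cinner x (V y)"
    and inj: "\<And>x. W x = x \<Longrightarrow> x = 0"
  shows "\<exists>\<Psi>. borel_calculus \<Psi> \<and> \<Psi> cayley = W"
proof -
  obtain \<Phi> where \<Phi>: "borel_calculus \<Phi>" "\<Phi> cis = W"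
    and null: "\<And>f x. f \<in> bdd_borel \<Longrightarrow> (\<And>t. t \<in> {-pi<..pi} \<Longrightarrow> f t = 0) \<Longrightarrow> \<Phi> f x = 0"
    using unitary_circle_calculus[OF W inv adj] by blast
  have cb: "cis \<in> bdd_borel" using bdd_borel_cis[of 1] by simp
  define \<rho> where "\<rho> t = inv_cayley (cis t)" for t
  have \<rho>: "\<rho> \<in> borel_measurable borel"
    unfolding \<rho>_def by (rule measurable_compose[OF bdd_borel_measurable[OF cb] borel_measurable_inv_cayley])
  define \<Psi> where "\<Psi> f = \<Phi> (\<lambda>t. f (\<rho> t))" for f
  have bc: "(\<lambda>t. f (\<rho> t)) \<in> bdd_borel" if "f \<in> bdd_borel" for f
    by (rule bdd_borel_compose[OF that \<rho>])
  have "borel_calculus \<Psi>"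
    unfolding borel_calculus_def \<Psi>_def
    using calculus_clinear[OF \<Phi>(1) bc] bp_functional_compose[OF calculus_bp[OF \<Phi>(1)] \<rho>]
      calculus_one[OF \<Phi>(1)] calculus_mult[OF \<Phi>(1) bc bc] calculus_cinner[OF \<Phi>(1) bc]
    by simp
  moreover have "\<Psi> cayley = W"
  proof -
    have cay: "cayley \<in> bdd_borel" by (rule bdd_borelI[of _ 1]) (auto simp: borel_measurable_cayley)
    define d where "d t = cayley (\<rho> t) - cis t" for t
    have d: "d \<in> bdd_borel" unfolding d_def by (intro bdd_borel_diff bc cay cb)
    let ?i = "\<lambda>t::real. indicator {0} t :: complex"
    have i: "?i \<in> bdd_borel" by simp
    \<comment> \<open>Since \<open>cis 0 = 1\<close>, the range of the projection at angle 0
      consists of fixed vectors of \<open>W\<close>.\<close>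
    have P0: "\<Phi> ?i x = 0" for x
    proof (rule inj)
      have "W (\<Phi> ?i x) = \<Phi> (\<lambda>t. cis t * ?i t) x" by (simp add: calculus_mult[OF \<Phi>(1) cb i] \<Phi>(2))
      also have "(\<lambda>t. cis t * ?i t) = ?i" by (auto simp: indicator_def)
      finally show "W (\<Phi> ?i x) = \<Phi> ?i x" .
    qed
    have "\<Phi> d x = 0" for x
    proof -
      \<comment> \<open>The error \<open>d\<close> can be nonzero within (-pi, pi] only at 0, so
        removing its value there makes \<open>null\<close> applicable.\<close>
      have "\<Phi> (\<lambda>t. d t - d t * ?i t) x = 0"
      proof (rule null)
        fix t assume t: "t \<in> {-pi<..pi}"
        show "d t - d t * ?i t = 0"
        proof (cases "t = 0")
          case False
          have "cis t \<noteq> 1"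
            using Arg_cis[OF t] False by (metis Arg_cis[of 0] cis_zero greaterThanAtMost_iff less_le_not_le neg_less_0_iff_less pi_ge_zero pi_gt_zero)
          then show ?thesis using False by (simp add: d_def \<rho>_def cayley_inv_cayley)
        qed simp
      qed (intro bdd_borel_diff bdd_borel_mult d i)
      also have "\<Phi> (\<lambda>t. d t - d t * ?i t) x = \<Phi> d x - \<Phi> d (\<Phi> ?i x)"
        by (simp add: calculus_diff[OF \<Phi>(1) d bdd_borel_mult[OF d i]] calculus_mult[OF \<Phi>(1) d i])
      also have "\<Phi> d (\<Phi> ?i x) = 0"
        unfolding P0 by (rule bounded_clinear_zero[OF calculus_clinear[OF \<Phi>(1) d]])
      finally show ?thesis by simp
    qed
    then have "\<Phi> (\<lambda>t. cayley (\<rho> t)) x = \<Phi> cis x" for x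
      unfolding d_def calculus_diff[OF \<Phi>(1) bc[OF cay] cb] by simp
    then show ?thesis unfolding \<Psi>_def \<Phi>(2)[symmetric] by (rule ext)
  qed
  ultimately show ?thesis by blast
qed

subsection \<open>The Cayley transform of a self-adjoint operator\<close>

context
  fixes A :: "'h::complex_hilbert unbounded_op"
  assumes A: "self_adjoint_op A"
begin

lemma sa_linear_op: "linear_op A"
  using A unfolding self_adjoint_op_def by blast

lemma sa_add: "(x, y) \<in> A \<Longrightarrow> (x', y') \<in> A \<Longrightarrow> (x + x', y + y') \<in> A"
  using sa_linear_op unfolding linear_op_def by blast

lemma sa_scale: "(x, y) \<in> A \<Longrightarrow> (c *\<^sub>C x, c *\<^sub>C y) \<in> A"
  using sa_linear_op unfolding linear_op_def by blast

lemma sa_diff: "(x, y) \<in> A \<Longrightarrow> (x', y') \<in> A \<Longrightarrow> (x - x', y - y') \<in> A"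
  using sa_add[of x y "(-1) *\<^sub>C x'" "(-1) *\<^sub>C y'"] sa_scale[of x' y' "-1"] by simp

lemma sa_unique: "(x, y) \<in> A \<Longrightarrow> (x, y') \<in> A \<Longrightarrow> y = y'"
  using sa_linear_op unfolding linear_op_def single_valued_def by blast

lemma sa_symmetric: "(x, y) \<in> A \<Longrightarrow> (x', y') \<in> A \<Longrightarrow> cinner y x' = cinner x y'"
  using A unfolding self_adjoint_op_def op_adjoint_def by blast

lemma sa_memI:
  assumes "\<And>x y. (x, y) \<in> A \<Longrightarrow> cinner y z = cinner x w"
  shows "(z, w) \<in> A"
proof -
  have "(z, w) \<in> op_adjoint A" using assms unfolding op_adjoint_def by auto
  then show ?thesis using A unfolding self_adjoint_op_def by simp
qed

text \<open>The mixed terms cancel because \<open>cinner y x = cinner x y\<close> by symmetry while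
  \<open>c\<close> is imaginary. This makes \<open>A + c\<close> injective with closed range and the
  Cayley transform isometric.\<close>

lemma sa_norm:
  assumes xy: "(x, y) \<in> A" and c: "c = \<i> \<or> c = - \<i>"
  shows "(norm (y + c *\<^sub>C x))\<^sup>2 = (norm y)\<^sup>2 + (norm x)\<^sup>2"
proof -
  have "cinner (y + c *\<^sub>C x) (y + c *\<^sub>C x) = cinner y y + cinner x x"
    using c sa_symmetric[OF xy xy] by (auto simp: cinner_simps algebra_simps)
  then have "complex_of_real ((norm (y + c *\<^sub>C x))\<^sup>2) = complex_of_real ((norm y)\<^sup>2 + (norm x)\<^sup>2)"
    unfolding cinner_self by simp
  then show ?thesis using of_real_eq_iff by blast
qed

text \<open>The range \<open>K\<close> is a closed subspace by \<open>sa_norm\<close> and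
  completeness. A vector orthogonal to it would be an eigenvector of \<open>A\<close> with the
  nonreal eigenvalue \<open>- cnj c\<close>, contradicting symmetry unless it is 0.\<close>

lemma sa_surj:
  assumes c: "c = \<i> \<or> c = - \<i>"
  shows "\<exists>x y. (x, y) \<in> A \<and> h = y + c *\<^sub>C x"
proof -
  define K where "K = {y + c *\<^sub>C x | x y. (x, y) \<in> A}"
  have K_scale: "d *\<^sub>C v \<in> K" if v: "v \<in> K" for d v
  proof -
    obtain x y where "(x, y) \<in> A" "v = y + c *\<^sub>C x" using v unfolding K_def by blast
    moreover from this have "d *\<^sub>C v = d *\<^sub>C y + c *\<^sub>C (d *\<^sub>C x)"
      by (simp add: scaleC_add_right scaleC_scaleC mult.commute)
    ultimately show ?thesis using sa_scale unfolding K_def by blast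
  qed
  have K_add: "v + v' \<in> K" if vK: "v \<in> K" "v' \<in> K" for v v'
  proof -
    obtain x y where v: "(x, y) \<in> A" "v = y + c *\<^sub>C x" using vK unfolding K_def by blast
    obtain x' y' where v': "(x', y') \<in> A" "v' = y' + c *\<^sub>C x'" using vK unfolding K_def by blast
    have "v + v' = (y + y') + c *\<^sub>C (x + x')" by (simp add: v v' scaleC_add_right)
    then show ?thesis using sa_add[OF v(1) v'(1)] unfolding K_def by blast
  qed
  have K0: "0 \<in> K"
    using sa_linear_op unfolding K_def linear_op_def by (auto intro!: exI[of _ 0])
  have "subspace K"
    unfolding subspace_def using K0 K_add K_scale[of _ "of_real _"] by (auto simp: scaleC_of_real)
  moreover have "closed K"
    unfolding closed_sequential_limits
  proof (intro allI impI, elim conjE)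
    fix v l assume v: "\<forall>n. v n \<in> K" and l: "v \<longlonglongrightarrow> l"
    obtain x y where xy: "\<And>n. (x n, y n) \<in> A" "\<And>n. v n = y n + c *\<^sub>C x n"
      using v unfolding K_def by (auto simp: choice_iff)
    have d: "v m - v n = (y m - y n) + c *\<^sub>C (x m - x n)" for m n
      by (simp add: xy scaleC.diff_right)
    have le: "norm (x m - x n) \<le> norm (v m - v n)" "norm (y m - y n) \<le> norm (v m - v n)" for m n
    proof -
      have "(norm (v m - v n))\<^sup>2 = (norm (y m - y n))\<^sup>2 + (norm (x m - x n))\<^sup>2"
        unfolding d by (rule sa_norm[OF sa_diff[OF xy(1) xy(1)] c])
      then show "norm (x m - x n) \<le> norm (v m - v n)" "norm (y m - y n) \<le> norm (v m - v n)"
        by (auto intro: power2_le_imp_le)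
    qed
    have "Cauchy v" using l by (rule LIMSEQ_imp_Cauchy)
    then have "Cauchy x" "Cauchy y"
      unfolding Cauchy_def dist_norm using le by (meson order_le_less_trans)+
    then obtain a b where ab: "x \<longlonglongrightarrow> a" "y \<longlonglongrightarrow> b"
      by (auto simp: Cauchy_convergent_iff convergent_def)
    \<comment> \<open>\<open>A\<close> is closed because it equals its adjoint, and the defining
      relation of the adjoint passes to limits.\<close>
    have "(a, b) \<in> A"
    proof (rule sa_memI)
      fix x' y' assume "(x', y') \<in> A"
      then have "cinner y' (x n) = cinner x' (y n)" for n by (rule sa_symmetric[OF _ xy(1)])
      moreover have "(\<lambda>n. cinner y' (x n)) \<longlonglongrightarrow> cinner y' a" "(\<lambda>n. cinner x' (y n)) \<longlonglongrightarrow> cinner x' b"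
        using ab by (auto intro: cinner.tendsto)
      ultimately show "cinner y' a = cinner x' b" using LIMSEQ_unique by simp
    qed
    moreover have "v \<longlonglongrightarrow> b + c *\<^sub>C a"
      using tendsto_add[OF ab(2) scaleC.tendsto[OF tendsto_const[of c] ab(1)]] by (simp add: xy(2)[symmetric])
    ultimately show "l \<in> K" using l LIMSEQ_unique unfolding K_def by blast
  qed
  ultimately obtain k where k: "k \<in> K" "\<And>v. v \<in> K \<Longrightarrow> inner (h - k) v = 0"
    using exists_nearest_point_subspace[of K h] by blast
  define z where "z = h - k"
  have orth: "cinner v z = 0" if "v \<in> K" for v
  proof (rule complex_eqI)
    show "Re (cinner v z) = Re 0" using k(2)[OF that] by (simp add: Re_cinner z_def inner_commute)
    have "Re (cinner (- \<i> *\<^sub>C v) z) = 0"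
      using k(2)[OF K_scale[OF that, of "- \<i>"]] by (simp only: Re_cinner z_def inner_commute)
    then show "Im (cinner v z) = Im 0" unfolding cinner_scaleC_left by simp
  qed
  have "(z, - cnj c *\<^sub>C z) \<in> A"
  proof (rule sa_memI)
    fix x y assume "(x, y) \<in> A"
    then have "cinner (y + c *\<^sub>C x) z = 0" by (intro orth) (auto simp: K_def)
    then show "cinner y z = cinner x (- cnj c *\<^sub>C z)"
      by (simp add: cinner_simps add_eq_0_iff2)
  qed
  from sa_symmetric[OF this this] have "cinner z z = 0"
    using c by (auto simp: cinner_simps)
  then have "h = k" by (simp add: cinner_self z_def)
  then show ?thesis using k(1) unfolding K_def by blast
qed

lemma sa_resolvent_unique:
  assumes "(x, y) \<in> A" "(x', y') \<in> A" "y + c *\<^sub>C x = y' + c *\<^sub>C x'" and c: "c = \<i> \<or> c = - \<i>"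
  shows "x = x'" "y = y'"
proof -
  have "(y - y') + c *\<^sub>C (x - x') = 0" using assms(3) by (simp add: scaleC.diff_right algebra_simps)
  then have "(norm (y - y'))\<^sup>2 + (norm (x - x'))\<^sup>2 = 0"
    using sa_norm[OF sa_diff[OF assms(1,2)] c] by simp
  then show "x = x'" "y = y'" by (simp_all add: sum_power2_eq_zero_iff)
qed

end

text \<open>\<open>V\<close> is both inverse and adjoint of \<open>W\<close>. The last clause,
  surjectivity of \<open>A + \<i>\<close>, allows every vector to be written through the graph of
  \<open>A\<close> and makes \<open>W\<close> unique.\<close>

definition cayley_pair ::
    "'h::complex_hilbert unbounded_op \<Rightarrow> ('h \<Rightarrow> 'h) \<Rightarrow> ('h \<Rightarrow> 'h) \<Rightarrow> bool" where
  "cayley_pair A W V \<longleftrightarrow> bounded_clinear W \<and> bounded_clinear V \<and>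
     (\<forall>x. W (V x) = x) \<and> (\<forall>x. V (W x) = x) \<and> (\<forall>x y. cinner (W x) y = cinner x (V y)) \<and>
     (\<forall>x y. (x, y) \<in> A \<longrightarrow> W (y + \<i> *\<^sub>C x) = y - \<i> *\<^sub>C x) \<and>
     (\<forall>h. \<exists>x y. (x, y) \<in> A \<and> h = y + \<i> *\<^sub>C x)"

lemma cayley_pair_exists:
  assumes A: "self_adjoint_op A"
  shows "\<exists>W V. cayley_pair A W V"
proof -
  \<comment> \<open>One construction for both signs: \<open>c = \<i>\<close> yields
    \<open>W\<close>, and \<open>c = - \<i>\<close> yields its inverse \<open>V\<close>.\<close>
  have ex: "\<exists>S. bounded_clinear S \<and> (\<forall>x y. (x, y) \<in> A \<longrightarrow> S (y + c *\<^sub>C x) = y - c *\<^sub>C x)"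
    if c: "c = \<i> \<or> c = - \<i>" for c
  proof -
    obtain X Y where XY: "\<And>h. (X h, Y h) \<in> A" "\<And>h. h = Y h + c *\<^sub>C X h"
      using sa_surj[OF A c] by metis
    define S where "S h = Y h - c *\<^sub>C X h" for h
    have S: "S (y + c *\<^sub>C x) = y - c *\<^sub>C x" if "(x, y) \<in> A" for x y
      using sa_resolvent_unique[OF A that XY(1) XY(2) c] by (simp add: S_def)
    have c': "- c = \<i> \<or> - c = - \<i>" using c by auto
    have "bounded_clinear S"
    proof (rule bounded_clinearI[of _ 1])
      fix h k
      have "S (h + k) = S ((Y h + Y k) + c *\<^sub>C (X h + X k))"
        by (subst XY(2)[of h], subst XY(2)[of k]) (simp add: scaleC_add_right algebra_simps)
      also have "\<dots> = S h + S k"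
        unfolding S[OF sa_add[OF A XY(1) XY(1)]] by (simp add: S_def scaleC_add_right)
      finally show "S (h + k) = S h + S k" .
    next
      fix d h
      have "S (d *\<^sub>C h) = S (d *\<^sub>C Y h + c *\<^sub>C (d *\<^sub>C X h))"
        by (subst XY(2)[of h]) (simp add: scaleC_add_right scaleC_scaleC mult.commute)
      also have "\<dots> = d *\<^sub>C S h"
        unfolding S[OF sa_scale[OF A XY(1)]]
        by (simp add: S_def scaleC.diff_right scaleC_scaleC mult.commute)
      finally show "S (d *\<^sub>C h) = d *\<^sub>C S h" .
    next
      fix h
      have "(norm (S h))\<^sup>2 = (norm h)\<^sup>2"
        using sa_norm[OF A XY(1) c, of h] sa_norm[OF A XY(1) c', of h] XY(2)[of h]
        by (simp add: S_def scaleC.minus_left)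
      then show "norm (S h) \<le> 1 * norm h" by (simp add: power2_eq_iff_nonneg)
    qed
    with S show ?thesis by blast
  qed
  obtain W where W: "bounded_clinear W" "\<And>x y. (x, y) \<in> A \<Longrightarrow> W (y + \<i> *\<^sub>C x) = y - \<i> *\<^sub>C x"
    using ex[of \<i>] by blast
  obtain V where V: "bounded_clinear V" "\<And>x y. (x, y) \<in> A \<Longrightarrow> V (y - \<i> *\<^sub>C x) = y + \<i> *\<^sub>C x"
    using ex[of "- \<i>"] by (auto simp: scaleC.minus_left)
  have sp: "\<exists>x y. (x, y) \<in> A \<and> h = y + \<i> *\<^sub>C x" for h using sa_surj[OF A, of \<i> h] by simp
  have sm: "\<exists>x y. (x, y) \<in> A \<and> h = y - \<i> *\<^sub>C x" for h
    using sa_surj[OF A, of "- \<i>" h] by (simp add: scaleC.minus_left)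
  have "V (W h) = h" for h
  proof -
    obtain x y where "(x, y) \<in> A" "h = y + \<i> *\<^sub>C x" using sp by blast
    then show ?thesis by (simp add: W V)
  qed
  moreover have "W (V h) = h" for h
  proof -
    obtain x y where "(x, y) \<in> A" "h = y - \<i> *\<^sub>C x" using sm by blast
    then show ?thesis by (simp add: W V)
  qed
  \<comment> \<open>With \<open>h\<close> written in the range of \<open>A + \<i>\<close> and
    \<open>k\<close> in the range of \<open>A - \<i>\<close>, the claim reduces to the symmetry of
    \<open>A\<close>.\<close>
  moreover have "cinner (W h) k = cinner h (V k)" for h k
  proof -
    obtain x y where h: "(x, y) \<in> A" "h = y + \<i> *\<^sub>C x" using sp by blast
    obtain x' y' where k: "(x', y') \<in> A" "k = y' - \<i> *\<^sub>C x'" using sm by blast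
    show ?thesis
      using sa_symmetric[OF A h(1) k(1)] by (simp add: h(2) k(2) W(2)[OF h(1)] V(2)[OF k(1)] cinner_simps algebra_simps)
  qed
  ultimately have "cayley_pair A W V"
    unfolding cayley_pair_def using W V sp by blast
  then show ?thesis by blast
qed

text \<open>For \<open>h = y + \<i> *\<^sub>C x\<close> the difference \<open>h - W h\<close> is
  \<open>(2 * \<i>) *\<^sub>C x\<close>. This supplies the hypothesis \<open>inj\<close> of
  \<open>unitary_calculus\<close>.\<close>

lemma cayley_pair_injective:
  assumes A: "self_adjoint_op A" and WV: "cayley_pair A W V" and "W h = h"
  shows "h = 0"
proof -
  obtain x y where h: "(x, y) \<in> A" "h = y + \<i> *\<^sub>C x" using WV unfolding cayley_pair_def by blast
  then have "W h = y - \<i> *\<^sub>C x" using WV unfolding cayley_pair_def by blast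
  then have "y + \<i> *\<^sub>C x = y - \<i> *\<^sub>C x" using assms(3) h(2) by simp
  then have "\<i> *\<^sub>C x + \<i> *\<^sub>C x = 0" by (simp add: algebra_simps)
  then have "(2 * \<i>) *\<^sub>C x = 0" by (simp add: scaleC_add_left[symmetric])
  then have "norm ((2 * \<i>) *\<^sub>C x) = 0" by (simp only: norm_zero)
  then have x: "x = 0" by (simp add: norm_scaleC norm_mult)
  have "(0, 0) \<in> A" using sa_linear_op[OF A] unfolding linear_op_def by blast
  then have "y = 0" using sa_unique[OF A] h(1) x by blast
  then show ?thesis using h(2) x by (simp add: scaleC.zero_right)
qed

subsection \<open>The spectral theorem\<close>

text \<open>The symbol of the resolvent of \<open>A\<close> at \<open>- \<i>\<close>, as
  \<open>mult_res_i\<close> is that of \<open>A\<close> times the resolvent. These two bounded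
  functions parametrize the graph of the unbounded operator, and both are affine in
  \<open>cayley\<close>.\<close>

definition res_i :: "real \<Rightarrow> complex" where "res_i l = 1 / (of_real l + \<i>)"

definition mult_res_i :: "real \<Rightarrow> complex" where "mult_res_i l = of_real l / (of_real l + \<i>)"

lemma res_i_cayley: "res_i l = (1 / (2 * \<i>)) * (1 - cayley l)"
  by (simp add: res_i_def cayley_def field_simps)

lemma mult_res_i_cayley: "mult_res_i l = (1 / 2) * (1 + cayley l)"
  by (simp add: mult_res_i_def cayley_def field_simps)

lemma bdd_borel_cayley: "cayley \<in> bdd_borel"
  by (rule bdd_borelI[of _ 1]) (auto simp: borel_measurable_cayley)

lemma bdd_borel_res_i: "res_i \<in> bdd_borel"
  unfolding res_i_cayley[abs_def]
  by (intro bdd_borel_mult bdd_borel_diff bdd_borel_const bdd_borel_cayley)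

lemma bdd_borel_mult_res_i: "mult_res_i \<in> bdd_borel"
  unfolding mult_res_i_cayley[abs_def]
  by (intro bdd_borel_mult bdd_borel_add bdd_borel_const bdd_borel_cayley)

lemma res_i_norm: "res_i l * cnj (res_i l) = of_real (1 / (l\<^sup>2 + 1))"
  by (simp add: res_i_def field_simps power2_eq_square)

lemma mult_res_i_cnj: "mult_res_i l * cnj (res_i l) = of_real (l / (l\<^sup>2 + 1))"
  using res_i_norm[of l] by (simp add: res_i_def mult_res_i_def)

lemma calculus_res_i:
  assumes \<Phi>: "borel_calculus \<Phi>"
  shows "\<Phi> res_i h = (1 / (2 * \<i>)) *\<^sub>C (h - \<Phi> cayley h)"
    and "\<Phi> mult_res_i h = (1 / 2) *\<^sub>C (h + \<Phi> cayley h)"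
proof -
  have b: "(\<lambda>l. 1 - cayley l) \<in> bdd_borel" "(\<lambda>l. 1 + cayley l) \<in> bdd_borel"
    by (intro bdd_borel_diff bdd_borel_add bdd_borel_const bdd_borel_cayley)+
  show "\<Phi> res_i h = (1 / (2 * \<i>)) *\<^sub>C (h - \<Phi> cayley h)"
    unfolding res_i_cayley[abs_def] calculus_scale[OF \<Phi> b(1)]
    using calculus_diff[OF \<Phi> bdd_borel_const bdd_borel_cayley, of 1 h] calculus_one[OF \<Phi>] by simp
  show "\<Phi> mult_res_i h = (1 / 2) *\<^sub>C (h + \<Phi> cayley h)"
    unfolding mult_res_i_cayley[abs_def] calculus_scale[OF \<Phi> b(2)]
    using calculus_add[OF \<Phi> bdd_borel_const bdd_borel_cayley, of 1 h] calculus_one[OF \<Phi>] by simp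
qed

lemma square_div_le_one: "t\<^sup>2 / (t\<^sup>2 + 1) \<le> 1" "\<bar>t / (t\<^sup>2 + 1)\<bar> \<le> (1::real)"
proof -
  have p: "0 < t\<^sup>2 + 1" by (simp add: add_nonneg_pos)
  then show "t\<^sup>2 / (t\<^sup>2 + 1) \<le> 1" by simp
  have "0 \<le> (\<bar>t\<bar> - 1)\<^sup>2" by simp
  then have "2 * \<bar>t\<bar> \<le> t\<^sup>2 + 1" by (simp add: power2_diff)
  then have "\<bar>t\<bar> \<le> t\<^sup>2 + 1" by linarith
  then show "\<bar>t / (t\<^sup>2 + 1)\<bar> \<le> 1" using p by (simp add: abs_divide)
qed

definition cutoff :: "nat \<Rightarrow> real \<Rightarrow> real" where
  "cutoff n t = indicator {- real n..real n} t"

lemma cutoff_measurable [measurable]: "cutoff n \<in> borel_measurable borel"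
  unfolding cutoff_def by measurable

lemma cutoff_nonneg: "0 \<le> cutoff n t" "cutoff n t \<le> 1"
  by (auto simp: cutoff_def indicator_def)

lemma cutoff_eventually: "\<forall>\<^sub>F n in sequentially. cutoff n t = 1"
proof -
  obtain N where "\<bar>t\<bar> \<le> real N" using real_arch_simple by blast
  then have "cutoff n t = 1" if "n \<ge> N" for n
  proof -
    have "real N \<le> real n" using that by simp
    then show ?thesis using \<open>\<bar>t\<bar> \<le> real N\<close> by (auto simp: cutoff_def indicator_def abs_le_iff)
  qed
  then show ?thesis by (rule eventually_sequentiallyI)
qed

lemma cutoff_tendsto: "(\<lambda>n. u * cutoff n t) \<longlonglongrightarrow> u"
  by (rule tendsto_eventually) (use cutoff_eventually[of t] in eventually_elim, simp)

lemma cutoff_mono: "m \<le> n \<Longrightarrow> cutoff m t \<le> cutoff n t"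
  by (auto simp: cutoff_def indicator_def)

lemma abs_cutoff_le: "\<bar>t * cutoff n t\<bar> \<le> real n"
  by (auto simp: cutoff_def indicator_def abs_le_iff)

lemma square_cutoff_le: "\<bar>t\<^sup>2 * cutoff n t\<bar> \<le> (real n)\<^sup>2"
proof (cases "t \<in> {- real n..real n}")
  case True
  then have "\<bar>t\<bar> \<le> real n" by (auto simp: abs_le_iff)
  then have "t\<^sup>2 \<le> (real n)\<^sup>2" by (simp add: abs_le_square_iff[symmetric])
  then show ?thesis using True by (simp add: cutoff_def)
qed (simp add: cutoff_def)

context
  fixes \<Phi> :: "(real \<Rightarrow> complex) \<Rightarrow> 'h::complex_hilbert \<Rightarrow> 'h" and \<mu> :: "'h \<Rightarrow> real measure"
  assumes \<Phi>: "borel_calculus \<Phi>"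
    and fin: "\<And>x. finite_measure (\<mu> x)" "\<And>x. sets (\<mu> x) = sets borel"
    and \<mu>: "\<And>f x. f \<in> bdd_borel \<Longrightarrow> cinner (\<Phi> f x) x = (\<integral>t. f t \<partial>\<mu> x)"
begin

text \<open>Passing from \<open>h\<close> to \<open>\<Phi> g h\<close> multiplies the measure by the
  density \<open>g t * cnj (g t)\<close>.\<close>

lemma integral_calculus_vector:
  assumes "f \<in> bdd_borel" "g \<in> bdd_borel"
  shows "(\<integral>t. f t \<partial>\<mu> (\<Phi> g h)) = (\<integral>t. f t * (g t * cnj (g t)) \<partial>\<mu> h)"
proof -
  have "(\<integral>t. f t \<partial>\<mu> (\<Phi> g h)) = cinner (\<Phi> (\<lambda>t. f t * g t) h) (\<Phi> g h)"
    using assms by (simp add: \<mu>[symmetric] calculus_mult[OF \<Phi>])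
  also have "\<dots> = cinner (\<Phi> (\<lambda>t. f t * g t * cnj (g t)) h) h"
    by (rule calculus_cinner_cinner[OF \<Phi>]) (use assms bdd_borel_mult in auto)
  also have "\<dots> = (\<integral>t. f t * g t * cnj (g t) \<partial>\<mu> h)"
    by (rule \<mu>) (intro bdd_borel_mult bdd_borel_cnj assms)
  finally show ?thesis by (simp add: mult.assoc)
qed

lemma measurable_\<mu>: "borel_measurable (\<mu> x) = (borel_measurable borel :: (real \<Rightarrow> 'b::topological_space) set)"
  by (rule measurable_cong_sets) (simp_all add: fin)

lemma integral_res_i:
  fixes u :: "real \<Rightarrow> real"
  assumes u: "u \<in> borel_measurable borel" "\<And>t. \<bar>u t\<bar> \<le> C"
  shows "(\<integral>t. u t \<partial>\<mu> (\<Phi> res_i h)) = (\<integral>t. u t / (t\<^sup>2 + 1) \<partial>\<mu> h)"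
proof -
  have "(\<lambda>t. complex_of_real (u t)) \<in> bdd_borel"
    using u by (intro bdd_borelI[of _ C]) auto
  from integral_calculus_vector[OF this bdd_borel_res_i, of h]
  have "complex_of_real (\<integral>t. u t \<partial>\<mu> (\<Phi> res_i h)) = complex_of_real (\<integral>t. u t / (t\<^sup>2 + 1) \<partial>\<mu> h)"
    unfolding res_i_norm of_real_mult[symmetric] integral_complex_of_real by simp
  then show ?thesis by (simp only: of_real_eq_iff)
qed

lemma integrable_bounded_real:
  fixes u :: "real \<Rightarrow> real"
  assumes "u \<in> borel_measurable borel" "\<And>t. \<bar>u t\<bar> \<le> C"
  shows "integrable (\<mu> x) u"
  using assms by (intro finite_measure.integrable_const_bound[OF fin(1), of _ C]) (auto simp: measurable_\<mu>)

text \<open>The measure of \<open>\<Phi> res_i h\<close> has density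
  \<open>1 / (t\<^sup>2 + 1)\<close> against that of \<open>h\<close>, which tames the second
  moment. As the calculus handles only bounded functions, the moments are reached through the
  truncations by \<open>cutoff\<close>.\<close>

lemma res_i_domain:
  "integrable (\<mu> (\<Phi> res_i h)) (\<lambda>l. l\<^sup>2)"
  "cinner (\<Phi> mult_res_i h) (\<Phi> res_i h) = complex_of_real (\<integral>l. l \<partial>\<mu> (\<Phi> res_i h))"
proof -
  let ?x = "\<Phi> res_i h"
  have p: "0 < t\<^sup>2 + 1" for t :: real by (simp add: add_nonneg_pos)
  have lim2: "(\<lambda>n. \<integral>t. t\<^sup>2 * cutoff n t / (t\<^sup>2 + 1) \<partial>\<mu> h) \<longlonglongrightarrow> (\<integral>t. t\<^sup>2 / (t\<^sup>2 + 1) \<partial>\<mu> h)"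
  proof (rule integral_dominated_convergence[where w="\<lambda>_. 1"])
    show "AE t in \<mu> h. (\<lambda>n. t\<^sup>2 * cutoff n t / (t\<^sup>2 + 1)) \<longlonglongrightarrow> t\<^sup>2 / (t\<^sup>2 + 1)"
      using p by (intro AE_I2 tendsto_divide tendsto_const cutoff_tendsto) (auto simp: less_imp_neq[symmetric])
    have "norm (t\<^sup>2 * cutoff n t / (t\<^sup>2 + 1)) \<le> 1" for t n
    proof -
      have "t\<^sup>2 * cutoff n t / (t\<^sup>2 + 1) \<le> t\<^sup>2 / (t\<^sup>2 + 1)"
        using p[of t] cutoff_nonneg[of n t] by (intro divide_right_mono mult_left_le) auto
      moreover have "0 \<le> t\<^sup>2 * cutoff n t / (t\<^sup>2 + 1)"
        using p[of t] cutoff_nonneg[of n t] by (intro divide_nonneg_pos mult_nonneg_nonneg) auto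
      ultimately show ?thesis using square_div_le_one(1)[of t] unfolding real_norm_def by linarith
    qed
    then show "AE t in \<mu> h. norm (t\<^sup>2 * cutoff n t / (t\<^sup>2 + 1)) \<le> 1" for n by simp
    show "integrable (\<mu> h) (\<lambda>_. 1 :: real)" by (rule finite_measure.integrable_const[OF fin(1)])
  qed (auto simp: measurable_\<mu>)
  show i2: "integrable (\<mu> ?x) (\<lambda>l. l\<^sup>2)"
  proof (rule integrable_monotone_convergence[where f="\<lambda>n t. t\<^sup>2 * cutoff n t"])
    show "integrable (\<mu> ?x) (\<lambda>t. t\<^sup>2 * cutoff n t)" for n
      by (rule integrable_bounded_real[OF _ square_cutoff_le]) measurable
    show "AE t in \<mu> ?x. mono (\<lambda>n. t\<^sup>2 * cutoff n t)"
      by (auto simp: mono_def intro!: mult_left_mono cutoff_mono)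
    show "AE t in \<mu> ?x. (\<lambda>n. t\<^sup>2 * cutoff n t) \<longlonglongrightarrow> t\<^sup>2" by (simp add: cutoff_tendsto)
    show "(\<lambda>n. \<integral>t. t\<^sup>2 * cutoff n t \<partial>\<mu> ?x) \<longlonglongrightarrow> (\<integral>t. t\<^sup>2 / (t\<^sup>2 + 1) \<partial>\<mu> h)"
      using lim2 by (subst integral_res_i[OF _ square_cutoff_le]) auto
  qed (simp add: measurable_\<mu>)
  have i1: "integrable (\<mu> ?x) (\<lambda>l. 1 + l\<^sup>2)"
    by (intro Bochner_Integration.integrable_add finite_measure.integrable_const[OF fin(1)] i2)
  \<comment> \<open>The first moment is dominated by the integrable function found in
    \<open>i1\<close>.\<close>
  have le: "\<bar>t\<bar> \<le> 1 + t\<^sup>2" for t :: real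
    using square_div_le_one(2)[of t] p[of t] by (simp add: abs_divide pos_divide_le_eq)
  have lim3: "(\<lambda>n. \<integral>t. t * cutoff n t \<partial>\<mu> ?x) \<longlonglongrightarrow> (\<integral>t. t \<partial>\<mu> ?x)"
  proof (rule integral_dominated_convergence[OF _ _ i1])
    show "AE t in \<mu> ?x. norm (t * cutoff n t) \<le> 1 + t\<^sup>2" for n
    proof (rule AE_I2)
      fix t
      have "norm (t * cutoff n t) \<le> \<bar>t\<bar>"
        using cutoff_nonneg[of n t] by (simp add: abs_mult mult_left_le)
      then show "norm (t * cutoff n t) \<le> 1 + t\<^sup>2" using le[of t] by linarith
    qed
  qed (auto simp: measurable_\<mu> cutoff_tendsto)
  have lim4: "(\<lambda>n. \<integral>t. t * cutoff n t / (t\<^sup>2 + 1) \<partial>\<mu> h) \<longlonglongrightarrow> (\<integral>t. t / (t\<^sup>2 + 1) \<partial>\<mu> h)"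
  proof (rule integral_dominated_convergence[where w="\<lambda>_. 1"])
    show "AE t in \<mu> h. (\<lambda>n. t * cutoff n t / (t\<^sup>2 + 1)) \<longlonglongrightarrow> t / (t\<^sup>2 + 1)"
      using p by (intro AE_I2 tendsto_divide tendsto_const cutoff_tendsto) (auto simp: less_imp_neq[symmetric])
    have "norm (t * cutoff n t / (t\<^sup>2 + 1)) \<le> 1" for t n
    proof -
      have "norm (t * cutoff n t / (t\<^sup>2 + 1)) = \<bar>t / (t\<^sup>2 + 1)\<bar> * cutoff n t"
        using cutoff_nonneg[of n t] by (simp add: abs_mult abs_divide)
      also have "\<dots> \<le> 1 * 1"
        by (rule mult_mono) (use square_div_le_one(2)[of t] cutoff_nonneg[of n t] in auto)
      finally show ?thesis by simp
    qed
    then show "AE t in \<mu> h. norm (t * cutoff n t / (t\<^sup>2 + 1)) \<le> 1" for n by simp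
    show "integrable (\<mu> h) (\<lambda>_. 1 :: real)" by (rule finite_measure.integrable_const[OF fin(1)])
  qed (auto simp: measurable_\<mu>)
  have "(\<integral>t. t * cutoff n t \<partial>\<mu> ?x) = (\<integral>t. t * cutoff n t / (t\<^sup>2 + 1) \<partial>\<mu> h)" for n
    by (rule integral_res_i[OF _ abs_cutoff_le]) measurable
  then have eq: "(\<integral>t. t \<partial>\<mu> ?x) = (\<integral>t. t / (t\<^sup>2 + 1) \<partial>\<mu> h)"
    using LIMSEQ_unique[OF lim3] lim4 by simp
  have "cinner (\<Phi> mult_res_i h) (\<Phi> res_i h) = cinner (\<Phi> (\<lambda>t. mult_res_i t * cnj (res_i t)) h) h"
    by (rule calculus_cinner_cinner[OF \<Phi> bdd_borel_mult_res_i bdd_borel_res_i])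
  also have "\<dots> = (\<integral>t. mult_res_i t * cnj (res_i t) \<partial>\<mu> h)"
    by (rule \<mu>) (intro bdd_borel_mult bdd_borel_cnj bdd_borel_res_i bdd_borel_mult_res_i)
  also have "\<dots> = complex_of_real (\<integral>t. t \<partial>\<mu> ?x)"
    unfolding mult_res_i_cnj integral_complex_of_real eq by (rule refl)
  finally show "cinner (\<Phi> mult_res_i h) (\<Phi> res_i h) = complex_of_real (\<integral>l. l \<partial>\<mu> ?x)" .
qed

text \<open>The vector \<open>h\<close> ought to be \<open>A + \<i>\<close> applied to
  \<open>x\<close>, so it is built as the limit of the truncated symbols \<open>f n\<close> acting
  on \<open>x\<close>. Applying \<open>res_i\<close> to them gives the cutoffs, which converge to
  the identity.\<close>

lemma domain_res_i:
  assumes i2: "integrable (\<mu> x) (\<lambda>l. l\<^sup>2)"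
  shows "\<exists>h. x = \<Phi> res_i h"
proof -
  have i1: "integrable (\<mu> x) (\<lambda>l. l\<^sup>2 + 1)"
    by (intro Bochner_Integration.integrable_add finite_measure.integrable_const[OF fin(1)] i2)
  define f where "f n t = (complex_of_real t + \<i>) * complex_of_real (cutoff n t)" for n t
  have f: "f n \<in> bdd_borel" for n
  proof (rule bdd_borelI)
    show "f n \<in> borel_measurable borel" unfolding f_def by measurable
    have "cmod (f n t) = cmod (complex_of_real (t * cutoff n t) + \<i> * complex_of_real (cutoff n t))" for t
      by (simp add: f_def algebra_simps)
    also have "\<dots> t \<le> real n + 1" for t
      using norm_triangle_ineq[of "complex_of_real (t * cutoff n t)" "\<i> * complex_of_real (cutoff n t)"]
        abs_cutoff_le[of t n] cutoff_nonneg[of n t] unfolding norm_mult norm_of_real by simp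
    finally show "cmod (f n t) \<le> real n + 1" for t .
  qed
  define a where "a n = (\<integral>t. (t\<^sup>2 + 1) * cutoff n t \<partial>\<mu> x)" for n
  have ai: "integrable (\<mu> x) (\<lambda>t. (t\<^sup>2 + 1) * cutoff n t)" for n
    by (rule Bochner_Integration.integrable_bound[OF i1])
       (auto simp: measurable_\<mu> abs_mult cutoff_nonneg intro!: mult_left_le)
  have "a \<longlonglongrightarrow> (\<integral>t. t\<^sup>2 + 1 \<partial>\<mu> x)"
    unfolding a_def
    by (rule integral_dominated_convergence[OF _ _ i1])
       (auto simp: measurable_\<mu> abs_mult cutoff_nonneg cutoff_tendsto intro!: mult_left_le)
  then have "Cauchy a" by (rule LIMSEQ_imp_Cauchy)
  \<comment> \<open>For \<open>m \<le> n\<close> the difference of cutoffs is an indicator and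
    equals its own square, so the squared norm is a difference of terms of the convergent sequence
    \<open>a\<close>.\<close>
  have nd: "(norm (\<Phi> (f n) x - \<Phi> (f m) x))\<^sup>2 = a n - a m" if "m \<le> n" for m n
  proof -
    have sq: "(cutoff n t - cutoff m t)\<^sup>2 = cutoff n t - cutoff m t" for t
      using that by (auto simp: cutoff_def indicator_def)
    have fd: "f n t - f m t = (complex_of_real t + \<i>) * complex_of_real (cutoff n t - cutoff m t)" for t
      by (simp add: f_def algebra_simps)
    have sq': "(cmod (f n t - f m t))\<^sup>2 = (t\<^sup>2 + 1) * (cutoff n t - cutoff m t)" for t
      unfolding fd norm_mult power_mult_distrib norm_of_real power2_abs sq by (simp add: cmod_power2)
    have fb: "(\<lambda>t. f n t - f m t) \<in> bdd_borel" by (intro bdd_borel_diff f)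
    have nb: "(\<lambda>t. complex_of_real ((cmod (f n t - f m t))\<^sup>2)) \<in> bdd_borel"
      using bdd_borel_mult[OF fb bdd_borel_cnj[OF fb]] unfolding complex_norm_square[symmetric] .
    have "complex_of_real ((norm (\<Phi> (f n) x - \<Phi> (f m) x))\<^sup>2) =
        cinner (\<Phi> (\<lambda>t. complex_of_real ((cmod (f n t - f m t))\<^sup>2)) x) x"
      using calculus_norm[OF \<Phi> fb, of x] unfolding calculus_diff[OF \<Phi> f f] .
    also have "\<dots> = (\<integral>t. complex_of_real ((t\<^sup>2 + 1) * (cutoff n t - cutoff m t)) \<partial>\<mu> x)"
      using \<mu>[OF nb, of x] unfolding sq' .
    finally have "(norm (\<Phi> (f n) x - \<Phi> (f m) x))\<^sup>2 = (\<integral>t. (t\<^sup>2 + 1) * (cutoff n t - cutoff m t) \<partial>\<mu> x)"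
      unfolding integral_complex_of_real by (simp only: of_real_eq_iff)
    also have "\<dots> = a n - a m"
      unfolding a_def right_diff_distrib by (rule Bochner_Integration.integral_diff[OF ai ai])
    finally show ?thesis .
  qed
  have nd': "(norm (\<Phi> (f n) x - \<Phi> (f m) x))\<^sup>2 \<le> \<bar>a n - a m\<bar>" for m n
    using nd[of m n] nd[of n m] by (cases "m \<le> n") (auto simp: norm_minus_commute)
  have "Cauchy (\<lambda>n. \<Phi> (f n) x)"
  proof (rule metric_CauchyI)
    fix e :: real assume "e > 0"
    then obtain M where M: "\<forall>m\<ge>M. \<forall>n\<ge>M. dist (a m) (a n) < e\<^sup>2"
      using metric_CauchyD[OF \<open>Cauchy a\<close>, of "e\<^sup>2"] by auto
    have "dist (\<Phi> (f m) x) (\<Phi> (f n) x) < e" if "m \<ge> M" "n \<ge> M" for m n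
    proof -
      have "(norm (\<Phi> (f m) x - \<Phi> (f n) x))\<^sup>2 < e\<^sup>2"
        using M that nd'[of m n] by (fastforce simp: dist_real_def)
      then show ?thesis using \<open>e > 0\<close> by (simp add: dist_norm power2_less_imp_less)
    qed
    then show "\<exists>M. \<forall>m\<ge>M. \<forall>n\<ge>M. dist (\<Phi> (f m) x) (\<Phi> (f n) x) < e" by blast
  qed
  then obtain h where h: "(\<lambda>n. \<Phi> (f n) x) \<longlonglongrightarrow> h" by (auto simp: Cauchy_convergent_iff convergent_def)
  have "(\<lambda>n. \<Phi> res_i (\<Phi> (f n) x)) \<longlonglongrightarrow> \<Phi> res_i h"
    by (rule bounded_linear.tendsto[OF bounded_clinear_bounded_linear[OF calculus_clinear[OF \<Phi> bdd_borel_res_i]] h])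
  moreover have eq: "\<Phi> res_i (\<Phi> (f n) x) = \<Phi> (\<lambda>t. complex_of_real (cutoff n t)) x" for n
  proof -
    have "(\<lambda>t. res_i t * f n t) = (\<lambda>t. complex_of_real (cutoff n t))" by (simp add: res_i_def f_def)
    then show ?thesis using calculus_mult[OF \<Phi> bdd_borel_res_i f, of n x] by simp
  qed
  moreover have "(\<lambda>n. \<Phi> (\<lambda>t. complex_of_real (cutoff n t)) x) \<longlonglongrightarrow> \<Phi> (\<lambda>_. 1) x"
  proof (rule calculus_limit[OF \<Phi>])
    show "(\<lambda>n. complex_of_real (cutoff n t)) \<longlonglongrightarrow> 1" for t
      using tendsto_of_real[OF cutoff_tendsto[of 1 t]] by simp
    show "cmod (complex_of_real (cutoff n t)) \<le> 1" for n t using cutoff_nonneg[of n t] by simp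
  qed measurable
  ultimately have "\<Phi> res_i h = \<Phi> (\<lambda>_. 1) x" unfolding eq using LIMSEQ_unique by blast
  then have "x = \<Phi> res_i h" by (simp add: calculus_one[OF \<Phi>])
  then show ?thesis by blast
qed

end

section \<open>Existence of a spectral measure and its link to the Cayley transform\<close>

text \<open>In the calculus of the Cayley transform, \<open>A\<close> consists of the pairs
  \<open>(\<Psi> res_i h, \<Psi> mult_res_i h)\<close>: for \<open>h = y + \<i> *\<^sub>C x\<close>
  they are \<open>x\<close> and \<open>y\<close>. Domain and quadratic form are then read off from
  \<open>res_i_domain\<close> and \<open>domain_res_i\<close>.\<close>

lemma spectral_measure_exists:
  assumes A: "self_adjoint_op A"
  shows "\<exists>E. is_spectral_measure A E"
proof -
  obtain W V where WV: "cayley_pair A W V" using cayley_pair_exists[OF A] by blast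
  then have W: "bounded_clinear W" "bounded_clinear V" "\<And>x. W (V x) = x" "\<And>x. V (W x) = x"
    "\<And>x y. cinner (W x) y = cinner x (V y)" "\<And>x y. (x, y) \<in> A \<Longrightarrow> W (y + \<i> *\<^sub>C x) = y - \<i> *\<^sub>C x"
    "\<And>h. \<exists>x y. (x, y) \<in> A \<and> h = y + \<i> *\<^sub>C x"
    unfolding cayley_pair_def by blast+
  obtain \<Psi> where \<Psi>: "borel_calculus \<Psi>" "\<Psi> cayley = W"
    using unitary_calculus[OF W(1-5) cayley_pair_injective[OF A WV]] by blast
  have res: "\<Psi> res_i (y + \<i> *\<^sub>C x) = x" "\<Psi> mult_res_i (y + \<i> *\<^sub>C x) = y" if "(x, y) \<in> A" for x y
  proof -
    have "\<i> *\<^sub>C x + \<i> *\<^sub>C x = (2 * \<i>) *\<^sub>C x" by (simp add: scaleC_add_left[symmetric])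
    then show "\<Psi> res_i (y + \<i> *\<^sub>C x) = x"
      by (simp add: calculus_res_i(1)[OF \<Psi>(1)] \<Psi>(2) W(6)[OF that] scaleC_scaleC algebra_simps)
    have "y + y = 2 *\<^sub>C y" by (metis one_add_one scaleC_add_left scaleC_one)
    then show "\<Psi> mult_res_i (y + \<i> *\<^sub>C x) = y"
      by (simp add: calculus_res_i(2)[OF \<Psi>(1)] \<Psi>(2) W(6)[OF that] scaleC_scaleC algebra_simps)
  qed
  have memA: "(\<Psi> res_i h, \<Psi> mult_res_i h) \<in> A" for h
  proof -
    obtain x y where "(x, y) \<in> A" "h = y + \<i> *\<^sub>C x" using W(7) by blast
    then show ?thesis by (simp add: res)
  qed
  let ?E = "\<lambda>B. \<Psi> (\<lambda>t. indicator B t)"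
  note pvm = calculus_pvm(1)[OF \<Psi>(1)]
  note dom = res_i_domain[OF \<Psi>(1) finite_scalar_measure[OF pvm] sets_scalar_measure[OF pvm]
      calculus_pvm(2)[OF \<Psi>(1), symmetric]]
  note dom' = domain_res_i[OF \<Psi>(1) finite_scalar_measure[OF pvm] sets_scalar_measure[OF pvm]
      calculus_pvm(2)[OF \<Psi>(1), symmetric]]
  have "is_spectral_measure A ?E"
    unfolding is_spectral_measure_def
  proof (intro conjI pvm)
    show "Domain A = {x. integrable (scalar_measure ?E x) (\<lambda>l. l\<^sup>2)}"
    proof (intro set_eqI iffI)
      fix x assume "x \<in> Domain A"
      then obtain y where "(x, y) \<in> A" by blast
      then show "x \<in> {x. integrable (scalar_measure ?E x) (\<lambda>l. l\<^sup>2)}"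
        using dom(1)[of "y + \<i> *\<^sub>C x"] res(1) by simp
    next
      fix x assume "x \<in> {x. integrable (scalar_measure ?E x) (\<lambda>l. l\<^sup>2)}"
      then obtain h where "x = \<Psi> res_i h" using dom' by blast
      then show "x \<in> Domain A" using memA by blast
    qed
    show "\<forall>(x, y)\<in>A. cinner y x = complex_of_real (\<integral>l. l \<partial>scalar_measure ?E x)"
    proof clarify
      fix x y assume "(x, y) \<in> A"
      then show "cinner y x = complex_of_real (\<integral>l. l \<partial>scalar_measure ?E x)"
        using dom(2)[of "y + \<i> *\<^sub>C x"] res by simp
    qed
  qed
  then show ?thesis by blast
qed

text \<open>The form of uniqueness that the arbitrary choice in \<open>spectral_measure\<close>
  calls for. A spectral measure is tied to \<open>A\<close> only by its domain and quadratic form,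
  so polarization and density of the domain must show that its multiplication operator is
  \<open>A\<close> itself.\<close>

lemma spectral_measure_cayley:
  assumes A: "self_adjoint_op A" and WV: "cayley_pair A W V" and E: "is_spectral_measure A E"
    and \<Phi>: "borel_calculus \<Phi>"
      "\<And>f x. f \<in> bdd_borel \<Longrightarrow> cinner (\<Phi> f x) x = (\<integral>t. f t \<partial>scalar_measure E x)"
  shows "\<Phi> cayley = W"
proof
  fix h0
  have pvm: "projection_valued_measure E" and Dom: "Domain A = {x. integrable (scalar_measure E x) (\<lambda>l. l\<^sup>2)}"
    and quad: "\<And>x y. (x, y) \<in> A \<Longrightarrow> cinner y x = complex_of_real (\<integral>l. l \<partial>scalar_measure E x)"
    using E unfolding is_spectral_measure_def by auto
  note dom = res_i_domain[OF \<Phi>(1) finite_scalar_measure[OF pvm] sets_scalar_measure[OF pvm] \<Phi>(2)]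
  note dom' = domain_res_i[OF \<Phi>(1) finite_scalar_measure[OF pvm] sets_scalar_measure[OF pvm] \<Phi>(2)]
  note lin = calculus_clinear[OF \<Phi>(1) bdd_borel_res_i] calculus_clinear[OF \<Phi>(1) bdd_borel_mult_res_i]
  \<comment> \<open>The graph of the difference of \<open>A\<close> and the multiplication operator
    of the calculus on their common domain; the goal is that it is 0.\<close>
  define D where "D = {(\<Phi> res_i h, y - \<Phi> mult_res_i h) | h y. (\<Phi> res_i h, y) \<in> A}"
  have D_zero: "cinner d x = 0" if "(x, d) \<in> D" for x d
  proof -
    obtain h y where h: "x = \<Phi> res_i h" "d = y - \<Phi> mult_res_i h" "(x, y) \<in> A"
      using \<open>(x, d) \<in> D\<close> unfolding D_def by auto
    have "cinner y x = cinner (\<Phi> mult_res_i h) x"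
      using quad[OF h(3)] dom(2)[of h] h(1) by simp
    then show ?thesis by (simp add: h(2) cinner.diff_left)
  qed
  have D_add: "(x + x', d + d') \<in> D" if "(x, d) \<in> D" "(x', d') \<in> D" for x d x' d'
  proof -
    obtain h y where h: "x = \<Phi> res_i h" "d = y - \<Phi> mult_res_i h" "(\<Phi> res_i h, y) \<in> A"
      using \<open>(x, d) \<in> D\<close> unfolding D_def by auto
    obtain h' y' where h': "x' = \<Phi> res_i h'" "d' = y' - \<Phi> mult_res_i h'" "(\<Phi> res_i h', y') \<in> A"
      using \<open>(x', d') \<in> D\<close> unfolding D_def by auto
    have "(\<Phi> res_i (h + h'), y + y') \<in> A"
      using sa_add[OF A h(3) h'(3)] by (simp add: bounded_clinear_add[OF lin(1)])
    moreover have "d + d' = (y + y') - \<Phi> mult_res_i (h + h')" "x + x' = \<Phi> res_i (h + h')"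
      by (simp_all add: h h' bounded_clinear_add[OF lin(1)] bounded_clinear_add[OF lin(2)])
    ultimately show ?thesis unfolding D_def by blast
  qed
  have D_scale: "(c *\<^sub>C x, c *\<^sub>C d) \<in> D" if "(x, d) \<in> D" for x d c
  proof -
    obtain h y where h: "x = \<Phi> res_i h" "d = y - \<Phi> mult_res_i h" "(\<Phi> res_i h, y) \<in> A"
      using \<open>(x, d) \<in> D\<close> unfolding D_def by auto
    have "(\<Phi> res_i (c *\<^sub>C h), c *\<^sub>C y) \<in> A"
      using sa_scale[OF A h(3)] by (simp add: bounded_clinear_scaleC[OF lin(1)])
    moreover have "c *\<^sub>C d = c *\<^sub>C y - \<Phi> mult_res_i (c *\<^sub>C h)" "c *\<^sub>C x = \<Phi> res_i (c *\<^sub>C h)"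
      by (simp_all add: h bounded_clinear_scaleC[OF lin(1)] bounded_clinear_scaleC[OF lin(2)] scaleC.diff_right)
    ultimately show ?thesis unfolding D_def by blast
  qed
  \<comment> \<open>Polarization: the quadratic form of the difference vanishes at
    \<open>x + x'\<close> and at \<open>x + \<i> *\<^sub>C x'\<close>, which gives two linear
    equations for the two mixed terms.\<close>
  have D_orth: "cinner d x' = 0" if "(x, d) \<in> D" "(x', d') \<in> D" for x d x' d'
  proof -
    have 1: "cinner d x' + cinner d' x = 0"
      using D_zero[OF D_add[OF that]] D_zero[OF that(1)] D_zero[OF that(2)] by (simp add: cinner_simps add.commute)
    have "cinner (d + \<i> *\<^sub>C d') (x + \<i> *\<^sub>C x') = 0"
      by (rule D_zero[OF D_add[OF that(1) D_scale[OF that(2)]]])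
    then have "- \<i> * cinner d x' + \<i> * cinner d' x = 0"
      using D_zero[OF that(1)] D_zero[OF that(2)] by (simp add: cinner_simps)
    then have "cinner d x' = cinner d' x" by (simp add: algebra_simps)
    with 1 show ?thesis by simp
  qed
  have D_dom: "\<exists>d. (x, d) \<in> D" if x: "x \<in> Domain A" for x
  proof -
    obtain y where y: "(x, y) \<in> A" using x by blast
    obtain h where "x = \<Phi> res_i h" using x Dom dom' by blast
    then show ?thesis using y unfolding D_def by blast
  qed
  have mem: "(\<Phi> res_i h, \<Phi> mult_res_i h) \<in> A" for h
  proof -
    have "\<Phi> res_i h \<in> Domain A" using dom(1) Dom by simp
    then obtain y where y: "(\<Phi> res_i h, y) \<in> A" by blast
    define d where "d = y - \<Phi> mult_res_i h"
    have d: "(\<Phi> res_i h, d) \<in> D" using y unfolding D_def d_def by blast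
    have "closed {x. cinner d x = 0}"
      by (intro closed_Collect_eq continuous_on_const)
         (intro linear_continuous_on cinner.bounded_linear_right)
    moreover have "Domain A \<subseteq> {x. cinner d x = 0}" using D_orth[OF d] D_dom by blast
    ultimately have "closure (Domain A) \<subseteq> {x. cinner d x = 0}" by (rule closure_minimal[rotated])
    moreover have "closure (Domain A) = UNIV"
      using A unfolding self_adjoint_op_def densely_defined_def by blast
    ultimately have "cinner d d = 0" by blast
    then have "d = 0" by (simp add: cinner_self)
    then show ?thesis using y by (simp add: d_def)
  qed
  have s: "s = (1 / 2) *\<^sub>C (a + b) \<Longrightarrow> r = (1 / (2 * \<i>)) *\<^sub>C (a - b) \<Longrightarrow> s + \<i> *\<^sub>C r = a \<and> s - \<i> *\<^sub>C r = b"
    for s r a b :: 'a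
  proof -
    assume sr: "s = (1 / 2) *\<^sub>C (a + b)" "r = (1 / (2 * \<i>)) *\<^sub>C (a - b)"
    have ir: "\<i> *\<^sub>C r = (1 / 2) *\<^sub>C (a - b)" by (simp add: sr scaleC_scaleC)
    have half: "(1 / 2) *\<^sub>C c + (1 / 2) *\<^sub>C c = c" for c :: 'a
      by (simp add: scaleC_add_left[symmetric])
    show "s + \<i> *\<^sub>C r = a \<and> s - \<i> *\<^sub>C r = b"
      unfolding ir sr(1) using half[of a] half[of b] by (simp add: scaleC_add_right scaleC.diff_right)
  qed
  \<comment> \<open>The argument of \<open>W\<close> is \<open>h0\<close> and the right-hand side is
    \<open>\<Phi> cayley h0\<close>, since \<open>mult_res_i\<close> plus or minus
    \<open>\<i>\<close> times \<open>res_i\<close> is 1 or \<open>cayley\<close>.\<close>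
  have "W (\<Phi> mult_res_i h0 + \<i> *\<^sub>C \<Phi> res_i h0) = \<Phi> mult_res_i h0 - \<i> *\<^sub>C \<Phi> res_i h0"
    using mem[of h0] WV unfolding cayley_pair_def by blast
  then show "\<Phi> cayley h0 = W h0"
    using s[OF calculus_res_i(2)[OF \<Phi>(1)] calculus_res_i(1)[OF \<Phi>(1)], of h0] by simp
qed

subsection \<open>The evolution group belongs to the algebra\<close>

text \<open>It serves twice: to form Cayley transforms of bounded elements of the commutant, and to
  certify that the constructed controls are control functions.\<close>

lemma self_adjoint_graph_of:
  assumes T: "bounded_clinear T" and sym: "\<And>x y. cinner (T x) y = cinner x (T y)"
  shows "self_adjoint_op (graph_of T)"
proof -
  have "linear_op (graph_of T)"
    unfolding linear_op_def graph_of_def single_valued_def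
    by (auto simp: bounded_clinear_zero[OF T] bounded_clinear_add[OF T] bounded_clinear_scaleC[OF T])
  moreover have "Domain (graph_of T) = UNIV" unfolding graph_of_def by auto
  then have "densely_defined (graph_of T)" unfolding densely_defined_def by simp
  moreover have "op_adjoint (graph_of T) = graph_of T"
  proof (intro set_eqI iffI)
    fix p assume p: "p \<in> op_adjoint (graph_of T)"
    obtain y z where yz: "p = (y, z)" by (cases p)
    have "cinner (T x) y = cinner x z" for x
      using p unfolding yz op_adjoint_def graph_of_def by auto
    then have "z = T y" by (intro cinner_eqI_right) (simp add: sym)
    then show "p \<in> graph_of T" unfolding yz graph_of_def by auto
  next
    fix p assume "p \<in> graph_of T"
    then show "p \<in> op_adjoint (graph_of T)"
      unfolding op_adjoint_def graph_of_def by (auto simp: sym)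
  qed
  ultimately show ?thesis unfolding self_adjoint_op_def by blast
qed

section \<open>Commutants and the Cayley transform of an affiliated operator\<close>

lemma commutantD: "T \<in> commutant M \<Longrightarrow> a \<in> M \<Longrightarrow> T (a x) = a (T x)"
  unfolding commutant_def by (auto simp: fun_eq_iff)

lemma commutant_clinear: "T \<in> commutant M \<Longrightarrow> bounded_clinear T"
  unfolding commutant_def by blast

lemma commutantI: "bounded_clinear T \<Longrightarrow> (\<And>a x. a \<in> M \<Longrightarrow> T (a x) = a (T x)) \<Longrightarrow> T \<in> commutant M"
  unfolding commutant_def by (auto simp: fun_eq_iff)

lemma von_neumann_memI:
  assumes "von_neumann_algebra M" "bounded_clinear T" "\<And>S x. S \<in> commutant M \<Longrightarrow> T (S x) = S (T x)"
  shows "T \<in> M"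
proof -
  have "T \<in> commutant (commutant M)" using assms by (intro commutantI) auto
  then show ?thesis using assms(1) unfolding von_neumann_algebra_def by simp
qed

lemma von_neumann_clinear: "von_neumann_algebra M \<Longrightarrow> a \<in> M \<Longrightarrow> bounded_clinear a"
  unfolding von_neumann_algebra_def by blast

lemma cayley_pair_unitary: "cayley_pair A W V \<Longrightarrow> unitary_op W"
proof -
  assume WV: "cayley_pair A W V"
  have "adj W = V" using WV unfolding cayley_pair_def by (intro adj_eqI) blast
  then show ?thesis using WV unfolding unitary_op_def cayley_pair_def by (auto simp: fun_eq_iff)
qed

text \<open>Affiliation says that \<open>(x, y) \<in> A\<close> implies
  \<open>(u x, u y) \<in> A\<close>, and \<open>W\<close> is defined on
  \<open>y + \<i> *\<^sub>C x\<close> by the graph alone.\<close>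

lemma cayley_pair_commutes_unitary:
  assumes WV: "cayley_pair A W V" and aff: "affiliated A M"
    and u: "u \<in> commutant M" "unitary_op u"
  shows "W (u h) = u (W h)"
proof -
  have uc: "bounded_clinear u" by (rule commutant_clinear[OF u(1)])
  obtain x y where h: "(x, y) \<in> A" "h = y + \<i> *\<^sub>C x" using WV unfolding cayley_pair_def by blast
  have "A O graph_of u = graph_of u O A" using aff u unfolding affiliated_def by blast
  moreover have "(x, u y) \<in> A O graph_of u" using h(1) unfolding graph_of_def by auto
  ultimately have "(u x, u y) \<in> A" unfolding graph_of_def by auto
  then have "W (u y + \<i> *\<^sub>C u x) = u y - \<i> *\<^sub>C u x" "W h = y - \<i> *\<^sub>C x"
    using WV h unfolding cayley_pair_def by blast+
  then show ?thesis
    by (simp add: h(2) bounded_clinear_add[OF uc] bounded_clinear_diff[OF uc] bounded_clinear_scaleC[OF uc])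
qed

text \<open>
  Affiliation only gives commutation with the unitaries of the commutant; the Cayley transform \<open>u\<close> of \<open>T\<close>
  is such a unitary, and \<open>T\<close> is recovered from it because \<open>h - u h = 2\<i>x\<close> for \<open>h = T x + \<i>x\<close>.
\<close>

lemma cayley_pair_commutes_self_adjoint:
  assumes WV: "cayley_pair A W V" and aff: "affiliated A M" and M: "von_neumann_algebra M"
    and T: "T \<in> commutant M" and sym: "\<And>x y. cinner (T x) y = cinner x (T y)"
  shows "W (T x) = T (W x)"
proof -
  have Tc: "bounded_clinear T" by (rule commutant_clinear[OF T])
  have Wc: "bounded_clinear W" using WV unfolding cayley_pair_def by blast
  obtain u v where uv: "cayley_pair (graph_of T) u v"
    using cayley_pair_exists[OF self_adjoint_graph_of[OF Tc sym]] by blast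
  have u: "u (T x + \<i> *\<^sub>C x) = T x - \<i> *\<^sub>C x" for x
    using uv unfolding cayley_pair_def graph_of_def by blast
  have uc: "bounded_clinear u" using uv unfolding cayley_pair_def by blast
  have surj: "\<exists>x. h = T x + \<i> *\<^sub>C x" for h
    using uv unfolding cayley_pair_def graph_of_def by blast
  have "u \<in> commutant M"
  proof (rule commutantI[OF uc])
    fix a h assume a: "a \<in> M"
    have ac: "bounded_clinear a" by (rule von_neumann_clinear[OF M a])
    obtain x where h: "h = T x + \<i> *\<^sub>C x" using surj by blast
    have "a h = T (a x) + \<i> *\<^sub>C a x"
      by (simp add: h bounded_clinear_add[OF ac] bounded_clinear_scaleC[OF ac] commutantD[OF T a])
    then have "u (a h) = T (a x) - \<i> *\<^sub>C a x" by (simp add: u)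
    then show "u (a h) = a (u h)"
      by (simp add: h u bounded_clinear_diff[OF ac] bounded_clinear_scaleC[OF ac] commutantD[OF T a])
  qed
  then have Wu: "W (u h) = u (W h)" for h
    by (rule cayley_pair_commutes_unitary[OF WV aff _ cayley_pair_unitary[OF uv]])
  have two: "h - u h = (2 * \<i>) *\<^sub>C y" if "h = T y + \<i> *\<^sub>C y" for h y
    by (simp add: that u scaleC_add_left[symmetric])
  define h where "h = T x + \<i> *\<^sub>C x"
  obtain y where y: "W h = T y + \<i> *\<^sub>C y" using surj by blast
  have "(2 * \<i>) *\<^sub>C y = W h - u (W h)" using two[OF y] by simp
  also have "\<dots> = W (h - u h)" by (simp add: Wu bounded_clinear_diff[OF Wc])
  also have "\<dots> = (2 * \<i>) *\<^sub>C W x" unfolding two[OF h_def] by (rule bounded_clinear_scaleC[OF Wc])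
  finally have "(1 / (2 * \<i>)) *\<^sub>C ((2 * \<i>) *\<^sub>C y) = (1 / (2 * \<i>)) *\<^sub>C ((2 * \<i>) *\<^sub>C W x)" by simp
  then have "y = W x" by (simp add: scaleC_scaleC)
  then have "W (T x) + \<i> *\<^sub>C W x = T (W x) + \<i> *\<^sub>C W x"
    using y by (simp add: h_def bounded_clinear_add[OF Wc] bounded_clinear_scaleC[OF Wc])
  then show ?thesis by simp
qed

lemma commutant_adj:
  assumes M: "von_neumann_algebra M" and T: "T \<in> commutant M"
  shows "adj T \<in> commutant M"
proof (rule commutantI)
  have Tc: "bounded_clinear T" by (rule commutant_clinear[OF T])
  show "bounded_clinear (adj T)" by (rule bounded_clinear_adj[OF Tc])
  fix a x assume a: "a \<in> M"
  have ac: "bounded_clinear a" by (rule von_neumann_clinear[OF M a])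
  have a': "adj a \<in> M" using M a unfolding von_neumann_algebra_def by blast
  have adj_a: "cinner (adj a x) y = cinner x (a y)" for x y
    unfolding cinner_commute[of "adj a x" y] cinner_commute[of x "a y"] adj_cinner[OF ac] by (rule refl)
  show "adj T (a x) = a (adj T x)"
  proof (rule cinner_eqI_right)
    fix y
    have "cinner y (adj T (a x)) = cinner (adj a (T y)) x" by (simp add: adj_cinner[OF Tc, symmetric] adj_a)
    also have "\<dots> = cinner (T (adj a y)) x" by (simp add: commutantD[OF T a'])
    also have "\<dots> = cinner y (a (adj T x))" by (simp add: adj_cinner[OF Tc] adj_a)
    finally show "cinner y (adj T (a x)) = cinner y (a (adj T x))" .
  qed
qed

text \<open>A general element of the commutant is a combination of two self-adjoint ones, and
  \<open>commutant_adj\<close> keeps the adjoint within the commutant.\<close>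

lemma cayley_pair_commutes:
  assumes WV: "cayley_pair A W V" and aff: "affiliated A M" and M: "von_neumann_algebra M"
    and T: "T \<in> commutant M"
  shows "W (T x) = T (W x)"
proof -
  have Wc: "bounded_clinear W" using WV unfolding cayley_pair_def by blast
  have Tc: "bounded_clinear T" by (rule commutant_clinear[OF T])
  have T': "adj T \<in> commutant M" by (rule commutant_adj[OF M T])
  have Tc': "bounded_clinear (adj T)" by (rule commutant_clinear[OF T'])
  have adj_T: "cinner (adj T x) y = cinner x (T y)" for x y
    unfolding cinner_commute[of "adj T x" y] cinner_commute[of x "T y"] adj_cinner[OF Tc] by (rule refl)
  have lin: "bounded_clinear (\<lambda>x. c *\<^sub>C T x + d *\<^sub>C adj T x)" for c d
  proof -
    have "bounded_linear (\<lambda>x. c *\<^sub>C T x + d *\<^sub>C adj T x)"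
      using bounded_clinear_bounded_linear[OF Tc] bounded_clinear_bounded_linear[OF Tc']
      by (intro bounded_linear_add bounded_linear_compose[OF scaleC.bounded_linear_right])
    then show ?thesis
      unfolding bounded_clinear_def
      by (simp add: bounded_clinear_scaleC[OF Tc] bounded_clinear_scaleC[OF Tc'] scaleC_add_right scaleC_scaleC mult.commute)
  qed
  have comm: "(\<lambda>x. c *\<^sub>C T x + d *\<^sub>C adj T x) \<in> commutant M" for c d
  proof (rule commutantI[OF lin])
    fix a x assume a: "a \<in> M"
    have ac: "bounded_clinear a" by (rule von_neumann_clinear[OF M a])
    show "c *\<^sub>C T (a x) + d *\<^sub>C adj T (a x) = a (c *\<^sub>C T x + d *\<^sub>C adj T x)"
      by (simp add: commutantD[OF T a] commutantD[OF T' a] bounded_clinear_add[OF ac] bounded_clinear_scaleC[OF ac])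
  qed
  \<comment> \<open>The value \<open>c = 1\<close> gives twice the real part of \<open>T\<close>,
    and \<open>c = \<i>\<close> gives minus twice its imaginary part.\<close>
  have sa: "W (c *\<^sub>C T x + cnj c *\<^sub>C adj T x) = c *\<^sub>C T (W x) + cnj c *\<^sub>C adj T (W x)" for c
    by (rule cayley_pair_commutes_self_adjoint[OF WV aff M comm])
       (simp add: cinner_simps adj_T adj_cinner[OF Tc] add.commute)
  have 1: "W (T x) + W (adj T x) = T (W x) + adj T (W x)"
    using sa[of 1] by (simp add: bounded_clinear_add[OF Wc])
  have 2: "\<i> *\<^sub>C W (T x) - \<i> *\<^sub>C W (adj T x) = \<i> *\<^sub>C T (W x) - \<i> *\<^sub>C adj T (W x)"
    using sa[of \<i>] by (simp add: bounded_clinear_add[OF Wc] bounded_clinear_diff[OF Wc] bounded_clinear_scaleC[OF Wc] scaleC.minus_left)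
  have "(- \<i>) *\<^sub>C (\<i> *\<^sub>C W (T x) - \<i> *\<^sub>C W (adj T x)) = (- \<i>) *\<^sub>C (\<i> *\<^sub>C T (W x) - \<i> *\<^sub>C adj T (W x))"
    using 2 by simp
  then have 3: "W (T x) - W (adj T x) = T (W x) - adj T (W x)"
    by (simp add: scaleC.diff_right scaleC_scaleC)
  have "W (T x) + W (T x) = T (W x) + T (W x)" using arg_cong2[OF 1 3, of "(+)"] by simp
  then have "2 *\<^sub>R W (T x) = 2 *\<^sub>R T (W x)" by (simp add: scaleR_2)
  then show ?thesis by simp
qed

text \<open>Commuting with \<open>\<Phi> cayley\<close> implies commuting with its inverse, hence
  with all integer powers of \<open>cayley\<close>. The difference of the two matrix coefficients is
  a functional that vanishes on those powers.\<close>

lemma calculus_commutes: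
  assumes \<Phi>: "borel_calculus \<Phi>" and T: "bounded_clinear T"
    and c: "\<And>x. \<Phi> cayley (T x) = T (\<Phi> cayley x)"
    and f: "f \<in> bdd_borel"
  shows "\<Phi> f (T x) = T (\<Phi> f x)"
proof (rule cinner_eqI)
  fix y
  have cb: "(\<lambda>t. cnj (cayley t)) \<in> bdd_borel" by (intro bdd_borel_cnj bdd_borel_cayley)
  have inv: "\<Phi> cayley (\<Phi> (\<lambda>t. cnj (cayley t)) x) = x" "\<Phi> (\<lambda>t. cnj (cayley t)) (\<Phi> cayley x) = x" for x
    using calculus_unitary[OF \<Phi> bdd_borel_cayley] by simp_all
  have c': "\<Phi> (\<lambda>t. cnj (cayley t)) (T x) = T (\<Phi> (\<lambda>t. cnj (cayley t)) x)" for x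
    by (metis c inv)
  have pow: "\<Phi> (\<lambda>t. g t ^ n) (T x) = T (\<Phi> (\<lambda>t. g t ^ n) x) \<and> (\<lambda>t. g t ^ n) \<in> bdd_borel"
    if g: "g \<in> bdd_borel" "\<And>x. \<Phi> g (T x) = T (\<Phi> g x)" for g n x
  proof (induction n arbitrary: x)
    case 0 then show ?case by (simp add: calculus_one[OF \<Phi>])
  next
    case (Suc n)
    then show ?case
      by (simp add: calculus_mult[OF \<Phi> g(1)] g(2) bdd_borel_mult[OF g(1)])
  qed
  have "(\<lambda>f. cinner (\<Phi> f (T x)) y - cinner (\<Phi> f x) (adj T y)) f = 0"
  proof (rule bp_functional_zero_of_cayley[OF bp_functional_diff[OF calculus_bp[OF \<Phi>] calculus_bp[OF \<Phi>]] _ f])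
    fix k :: int
    have "\<Phi> (\<lambda>t. cayley t powi k) (T x) = T (\<Phi> (\<lambda>t. cayley t powi k) x)"
    proof (cases "k \<ge> 0")
      case True
      then show ?thesis using pow[OF bdd_borel_cayley c, of "nat k" x] by (simp add: power_int_def)
    next
      case False
      have "inverse (cayley t) = cnj (cayley t)" for t
      proof -
        have "cayley t * cnj (cayley t) = 1" by (simp add: complex_norm_square[symmetric])
        then show ?thesis by (rule inverse_unique)
      qed
      then show ?thesis using False pow[OF cb c', of "nat (- k)" x] by (simp add: power_int_def)
    qed
    then show "cinner (\<Phi> (\<lambda>t. cayley t powi k) (T x)) y - cinner (\<Phi> (\<lambda>t. cayley t powi k) x) (adj T y) = 0"
      by (simp add: adj_cinner[OF T])
  qed
  then show "cinner (\<Phi> f (T x)) y = cinner (T (\<Phi> f x)) y" by (simp add: adj_cinner[OF T])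
qed

text \<open>Unfolds the two choices in \<open>evolution\<close>: the chosen spectral measure exists,
  and the operator in \<open>spectral_integral\<close> is determined by its quadratic form. A single
  calculus serves all times, and the double commutant puts its values into \<open>M\<close>.\<close>

lemma evolution_calculus:
  assumes V0: "self_adjoint_op V0" "affiliated V0 M" and M: "von_neumann_algebra M"
  shows "\<exists>\<Phi>. borel_calculus \<Phi> \<and>
    (\<forall>hbar t. evolution hbar V0 t = \<Phi> (\<lambda>l. cis (- (t / hbar) * l))) \<and>
    (\<forall>f\<in>bdd_borel. \<Phi> f \<in> M)"
proof -
  define E where "E = spectral_measure V0"
  have E: "is_spectral_measure V0 E"
    unfolding E_def spectral_measure_def using someI_ex[OF spectral_measure_exists[OF V0(1)]] .
  then have pvm: "projection_valued_measure E" unfolding is_spectral_measure_def by blast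
  obtain \<Phi> where \<Phi>: "borel_calculus \<Phi>"
    "\<And>f x. f \<in> bdd_borel \<Longrightarrow> cinner (\<Phi> f x) x = (\<integral>t. f t \<partial>scalar_measure E x)"
    using pvm_calculus[OF pvm] by blast
  have si: "spectral_integral E f = \<Phi> f" if f: "f \<in> bdd_borel" for f
    unfolding spectral_integral_def
  proof (rule the_equality)
    show "bounded_clinear (\<Phi> f) \<and> (\<forall>x. cinner (\<Phi> f x) x = (\<integral>l. f l \<partial>scalar_measure E x))"
      using f \<Phi>(2) calculus_clinear[OF \<Phi>(1)] by blast
    fix T assume "bounded_clinear T \<and> (\<forall>x. cinner (T x) x = (\<integral>l. f l \<partial>scalar_measure E x))"
    then show "T = \<Phi> f"
      using f \<Phi>(2) by (intro quadratic_form_determines calculus_clinear[OF \<Phi>(1) f]) auto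
  qed
  have "evolution hbar V0 t = \<Phi> (\<lambda>l. cis (- (t / hbar) * l))" for hbar t
  proof -
    have eq: "(\<lambda>l. exp (- (\<i> / complex_of_real hbar) * complex_of_real t * complex_of_real l)) =
        (\<lambda>l. cis (- (t / hbar) * l))"
      by (simp add: cis_conv_exp mult.assoc)
    show ?thesis
      unfolding evolution_def fun_calc_def E_def[symmetric] eq by (rule si[OF bdd_borel_cis])
  qed
  moreover have "\<Phi> f \<in> M" if f: "f \<in> bdd_borel" for f
  proof (rule von_neumann_memI[OF M calculus_clinear[OF \<Phi>(1) f]])
    fix S x assume S: "S \<in> commutant M"
    obtain W V where WV: "cayley_pair V0 W V" using cayley_pair_exists[OF V0(1)] by blast
    have "\<Phi> cayley = W" by (rule spectral_measure_cayley[OF V0(1) WV E \<Phi>])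
    then show "\<Phi> f (S x) = S (\<Phi> f x)"
      using cayley_pair_commutes[OF WV V0(2) M S]
      by (intro calculus_commutes[OF \<Phi>(1) commutant_clinear[OF S] _ f]) simp
  qed
  ultimately show ?thesis using \<Phi>(1) by blast
qed

text \<open>The exponentials obey these laws pointwise and \<Phi> respects products and conjugates;
  strong continuity is bounded pointwise convergence of the symbols.\<close>

lemma evolution_unitary_group:
  assumes V0: "self_adjoint_op V0" "affiliated V0 M" and M: "von_neumann_algebra M"
  shows "evolution hbar V0 t \<in> M"
    and "evolution hbar V0 (s + t) x = evolution hbar V0 s (evolution hbar V0 t x)"
    and "evolution hbar V0 0 x = x"
    and "cinner (evolution hbar V0 t x) y = cinner x (evolution hbar V0 (- t) y)"
    and "continuous_on S (\<lambda>t. evolution hbar V0 t x)"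
proof -
  obtain \<Phi> where \<Phi>: "borel_calculus \<Phi>" "\<And>t. evolution hbar V0 t = \<Phi> (\<lambda>l. cis (- (t / hbar) * l))"
    "\<And>f. f \<in> bdd_borel \<Longrightarrow> \<Phi> f \<in> M"
    using evolution_calculus[OF V0 M] by blast
  show "evolution hbar V0 t \<in> M" unfolding \<Phi>(2) by (rule \<Phi>(3)) (rule bdd_borel_cis)
  have eq: "(\<lambda>l. cis (- ((s + t) / hbar) * l)) = (\<lambda>l. cis (- (s / hbar) * l) * cis (- (t / hbar) * l))"
    by (auto simp: cis_mult add_divide_distrib algebra_simps)
  show "evolution hbar V0 (s + t) x = evolution hbar V0 s (evolution hbar V0 t x)"
    unfolding \<Phi>(2) eq by (rule calculus_mult[OF \<Phi>(1) bdd_borel_cis bdd_borel_cis])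
  show "evolution hbar V0 0 x = x" unfolding \<Phi>(2) using calculus_one[OF \<Phi>(1)] by simp
  show "cinner (evolution hbar V0 t x) y = cinner x (evolution hbar V0 (- t) y)"
    unfolding \<Phi>(2) using calculus_cinner[OF \<Phi>(1) bdd_borel_cis, of "- (t / hbar)" x y]
    by (simp add: cis_cnj)
  show "continuous_on S (\<lambda>t. evolution hbar V0 t x)"
    unfolding continuous_on_sequentially
  proof (intro allI ballI impI, elim conjE)
    fix u :: "nat \<Rightarrow> real" and a assume u: "u \<longlonglongrightarrow> a"
    show "((\<lambda>t. evolution hbar V0 t x) \<circ> u) \<longlonglongrightarrow> evolution hbar V0 a x"
      unfolding comp_def \<Phi>(2)
    proof (rule calculus_limit[OF \<Phi>(1), where C = 1])
      show "(\<lambda>l. cis (- (u n / hbar) * l)) \<in> borel_measurable borel" for n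
        by (rule bdd_borel_measurable[OF bdd_borel_cis])
      show "(\<lambda>n. cis (- (u n / hbar) * l)) \<longlonglongrightarrow> cis (- (a / hbar) * l)" for l
        unfolding cis_conv_exp divide_inverse by (intro tendsto_intros u)
    qed simp
  qed
qed

subsection \<open>Weak compactness of balls of self-adjoint elements\<close>

text \<open>The pointwise norm bound, rather than one on \<open>onorm\<close>, is what
  \<open>form_representation\<close> delivers for weak limits.\<close>

definition sa_ball :: "('h::complex_hilbert \<Rightarrow> 'h) set \<Rightarrow> real \<Rightarrow> ('h \<Rightarrow> 'h) set" where
  "sa_ball M r = {A \<in> M. (\<forall>x y. cinner (A x) y = cinner x (A y)) \<and> (\<forall>x. norm (A x) \<le> r * norm x)}"

lemma sa_ballD:
  assumes "A \<in> sa_ball M r"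
  shows "A \<in> M" "cinner (A x) y = cinner x (A y)" "norm (A x) \<le> r * norm x"
  using assms unfolding sa_ball_def by blast+

text \<open>Tychonoff: a product of closed discs is compact, so the sequence has a cluster point in
  the product topology. A filter finer than \<open>sequentially\<close> replaces a subsequence,
  because the index set may be uncountable.\<close>

lemma bounded_functions_cluster_filter:
  fixes \<beta> :: "nat \<Rightarrow> 'a \<Rightarrow> complex"
  assumes "\<And>n p. cmod (\<beta> n p) \<le> b p"
  obtains F l where "F \<noteq> bot" "F \<le> sequentially" "\<And>p. ((\<lambda>n. \<beta> n p) \<longlongrightarrow> l p) F"
proof -
  define K where "K = (\<Pi>\<^sub>E p\<in>UNIV. cball (0::complex) (b p))"
  have "compactin (product_topology (\<lambda>_. euclidean) UNIV) K"
    unfolding K_def compactin_PiE by simp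
  then have "compact K" by (simp add: euclidean_product_topology)
  moreover have "eventually (\<lambda>f. f \<in> K) (filtermap \<beta> sequentially)"
    unfolding eventually_filtermap using assms by (intro always_eventually) (simp add: K_def PiE_iff)
  moreover have "filtermap \<beta> sequentially \<noteq> bot" by (simp add: filtermap_bot_iff)
  ultimately obtain l where l: "inf (nhds l) (filtermap \<beta> sequentially) \<noteq> bot"
    unfolding compact_filter by blast
  \<comment> \<open>Along this filter \<beta> converges to \<open>l\<close> by construction; that it
    is proper is exactly the cluster property.\<close>
  define F where "F = inf sequentially (filtercomap \<beta> (nhds l))"
  have "F \<noteq> bot"
  proof
    assume "F = bot"
    then have "eventually (\<lambda>_. False) F" by simp
    then obtain P Q where P: "eventually P sequentially" and Q: "eventually Q (filtercomap \<beta> (nhds l))"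
      and PQ: "\<And>n. P n \<Longrightarrow> Q n \<Longrightarrow> False"
      unfolding F_def eventually_inf by blast
    obtain R where R: "eventually R (nhds l)" "\<And>n. R (\<beta> n) \<Longrightarrow> Q n"
      using Q unfolding eventually_filtercomap by blast
    have "eventually (\<lambda>f. \<not> R f) (filtermap \<beta> sequentially)"
      unfolding eventually_filtermap using P by eventually_elim (use PQ R(2) in blast)
    then have "eventually (\<lambda>_. False) (inf (nhds l) (filtermap \<beta> sequentially))"
      unfolding eventually_inf using R(1) by blast
    then show False using l by (simp add: eventually_False)
  qed
  moreover have "F \<le> sequentially" unfolding F_def by simp
  moreover have "((\<lambda>n. \<beta> n p) \<longlongrightarrow> l p) F" for p
  proof -
    have "(\<beta> \<longlongrightarrow> l) F"
      unfolding F_def by (rule filterlim_mono[OF filterlim_filtercomap order_refl]) simp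
    then show ?thesis
      by (rule continuous_on_tendsto_compose[OF continuous_on_product_coordinates]) simp_all
  qed
  ultimately show thesis using that by blast
qed

text \<open>Matrix coefficients converge along a common filter to a bounded form, whose operator
  inherits symmetry, norm bound and membership. The radii may vary with \<open>n\<close>, as the
  times of a minimizing sequence do; convergence of \<open>A n z\<close> in norm identifies the
  value of the limit at \<open>z\<close>.\<close>

lemma sa_ball_weak_limit:
  fixes A :: "nat \<Rightarrow> 'h::complex_hilbert \<Rightarrow> 'h"
  assumes M: "von_neumann_algebra M"
    and A: "\<And>n. A n \<in> sa_ball M (r n)" and r: "r \<longlonglongrightarrow> s"
    and lim: "(\<lambda>n. A n z) \<longlonglongrightarrow> w"
  shows "\<exists>B\<in>sa_ball M s. B z = w"
proof -
  note AD = sa_ballD[OF A]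
  have Ac: "bounded_clinear (A n)" for n by (rule von_neumann_clinear[OF M AD(1)])
  obtain R where R: "\<And>n. norm (r n) \<le> R"
    using Bseq_def convergent_imp_Bseq convergentI[OF r] by metis
  have bound: "cmod (cinner (A n x) y) \<le> r n * norm x * norm y" for n x y
    by (rule order_trans[OF cmod_cinner_le mult_right_mono[OF AD(3)]]) simp
  define \<beta> where "\<beta> n p = cinner (A n (fst p)) (snd p)" for n and p :: "'h \<times> 'h"
  have "cmod (\<beta> n p) \<le> R * norm (fst p) * norm (snd p)" for n p
  proof -
    have "r n * norm (fst p) * norm (snd p) \<le> R * norm (fst p) * norm (snd p)"
      using R[of n] by (intro mult_right_mono) auto
    then show ?thesis unfolding \<beta>_def using bound[of n "fst p" "snd p"] by linarith
  qed
  then obtain F l where F: "F \<noteq> bot" "F \<le> sequentially" "\<And>p. ((\<lambda>n. \<beta> n p) \<longlongrightarrow> l p) F"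
    using bounded_functions_cluster_filter[of \<beta> "\<lambda>p. R * norm (fst p) * norm (snd p)"] by blast
  define B where "B x y = l (x, y)" for x y
  have B: "((\<lambda>n. cinner (A n x) y) \<longlongrightarrow> B x y) F" for x y
    using F(3)[of "(x, y)"] by (simp add: \<beta>_def B_def)
  have uniq: "a = b" if "(f \<longlongrightarrow> a) F" "(f \<longlongrightarrow> b) F" for f :: "nat \<Rightarrow> complex" and a b
    using tendsto_unique[OF F(1) that] .
  have "\<exists>T. bounded_clinear T \<and> (\<forall>x y. cinner (T x) y = B x y) \<and> (\<forall>x. norm (T x) \<le> s * norm x)"
  proof (rule form_representation)
    show "B (x + y) v = B x v + B y v" for x y v
      by (rule uniq[OF B]) (simp add: bounded_clinear_add[OF Ac] cinner_add_left tendsto_add B)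
    show "B x (y + v) = B x y + B x v" for x y v
      by (rule uniq[OF B]) (simp add: cinner_add_right tendsto_add B)
    show "B (c *\<^sub>C x) y = c * B x y" for c x y
      by (rule uniq[OF B]) (simp add: bounded_clinear_scaleC[OF Ac] cinner_scaleC_left tendsto_mult B)
    show "B x (c *\<^sub>C y) = cnj c * B x y" for c x y
      by (rule uniq[OF B]) (simp add: cinner_scaleC_right tendsto_mult B)
    show "cmod (B x y) \<le> s * norm x * norm y" for x y
    proof (rule tendsto_le[OF F(1)])
      show "((\<lambda>n. r n * norm x * norm y) \<longlongrightarrow> s * norm x * norm y) F"
        by (intro tendsto_intros tendsto_mono[OF F(2) r])
      show "((\<lambda>n. cmod (cinner (A n x) y)) \<longlongrightarrow> cmod (B x y)) F"
        by (intro tendsto_intros B)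
    qed (use bound in simp)
  qed
  then obtain T where T: "bounded_clinear T" "\<And>x y. cinner (T x) y = B x y" "\<And>x. norm (T x) \<le> s * norm x"
    by blast
  have sym: "cinner (T x) y = cinner x (T y)" for x y
  proof -
    have "((\<lambda>n. cinner (A n x) y) \<longlongrightarrow> cnj (B y x)) F"
      using tendsto_cnj[OF B[of y x]] unfolding cinner_commute[of x, symmetric] AD(2)[symmetric] .
    then have "cinner (T x) y = cnj (cinner (T y) x)" unfolding T(2) by (rule uniq[OF B])
    then show ?thesis unfolding cinner_commute[of x "T y"] .
  qed
  have "T \<in> M"
  proof (rule von_neumann_memI[OF M T(1)])
    fix S x assume S: "S \<in> commutant M"
    have Sc: "bounded_clinear S" by (rule commutant_clinear[OF S])
    show "T (S x) = S (T x)"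
    proof (rule cinner_eqI)
      fix y
      \<comment> \<open>Moving \<open>S\<close> to the right-hand slot keeps both sides matrix
        coefficients of \<open>A n\<close> at fixed vectors, to which the weak limit
        applies.\<close>
      have "cinner (A n (S x)) y = cinner (A n x) (adj S y)" for n
        by (simp add: commutantD[OF S AD(1), symmetric] adj_cinner[OF Sc])
      then have "B (S x) y = B x (adj S y)" using uniq[OF B[of "S x" y]] B[of x "adj S y"] by simp
      then show "cinner (T (S x)) y = cinner (S (T x)) y" by (simp add: T(2) adj_cinner[OF Sc])
    qed
  qed
  then have "T \<in> sa_ball M s" unfolding sa_ball_def using sym T(3) by blast
  moreover have "T z = w"
  proof (rule cinner_eqI)
    fix y
    have "((\<lambda>n. cinner (A n z) y) \<longlongrightarrow> cinner w y) F"
      by (rule cinner.tendsto[OF tendsto_mono[OF F(2) lim] tendsto_const])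
    then show "cinner (T z) y = cinner w y" unfolding T(2) by (rule uniq[OF B])
  qed
  ultimately show ?thesis by blast
qed

subsection \<open>Reachable states\<close>

text \<open>The operators vary only strongly continuously, not in norm. The uniform bound handles
  the change of the vector, and strong continuity at the fixed vector \<open>y a\<close> handles the
  rest.\<close>

lemma continuous_on_strong_compose:
  fixes F :: "real \<Rightarrow> 'h::complex_hilbert \<Rightarrow> 'h"
  assumes lin: "\<And>s. s \<in> I \<Longrightarrow> bounded_clinear (F s)"
    and bound: "\<And>s x. s \<in> I \<Longrightarrow> norm (F s x) \<le> C * norm x"
    and cont: "\<And>x. continuous_on I (\<lambda>s. F s x)" and y: "continuous_on I y"
  shows "continuous_on I (\<lambda>s. F s (y s))"
  unfolding continuous_on_sequentially
proof (intro allI ballI impI, elim conjE)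
  fix u a assume a: "a \<in> I" and u: "\<forall>n. u n \<in> I" "u \<longlonglongrightarrow> a"
  have 1: "(\<lambda>n. F (u n) (y a)) \<longlonglongrightarrow> F a (y a)"
    using cont[of "y a"] a u unfolding continuous_on_sequentially comp_def by blast
  have 2: "(\<lambda>n. y (u n)) \<longlonglongrightarrow> y a"
    using y a u unfolding continuous_on_sequentially comp_def by blast
  have "(\<lambda>n. F (u n) (y (u n) - y a)) \<longlonglongrightarrow> 0"
  proof (rule Lim_null_comparison)
    show "\<forall>\<^sub>F n in sequentially. norm (F (u n) (y (u n) - y a)) \<le> C * norm (y (u n) - y a)"
      using u(1) bound by simp
    have "(\<lambda>n. C * norm (y (u n) - y a)) \<longlonglongrightarrow> C * norm (y a - y a)"
      by (intro tendsto_intros 2)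
    then show "(\<lambda>n. C * norm (y (u n) - y a)) \<longlonglongrightarrow> 0" by simp
  qed
  moreover have "F (u n) (y (u n) - y a) = F (u n) (y (u n)) - F (u n) (y a)" for n
    using lin u(1) by (simp add: bounded_clinear_diff)
  ultimately have "(\<lambda>n. F (u n) (y (u n)) - F (u n) (y a)) \<longlonglongrightarrow> 0" by simp
  from tendsto_add[OF this 1] show "((\<lambda>s. F s (y s)) \<circ> u) \<longlonglongrightarrow> F a (y a)" by (simp add: comp_def)
qed

lemma borel_measurable_lebesgue_on_continuous:
  fixes f :: "real \<Rightarrow> 'a::topological_space"
  assumes "continuous_on I f"
  shows "f \<in> borel_measurable (lebesgue_on I)"
proof -
  have "(\<lambda>x. x) \<in> measurable lebesgue (borel :: real measure)"
    by (rule measurable_completion) simp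
  then have "(\<lambda>x. x) \<in> measurable (lebesgue_on I) (restrict_space borel I)"
    by (rule measurable_restrict_space3) simp
  from measurable_compose[OF this borel_measurable_continuous_on_restrict[OF assms]]
  show ?thesis .
qed

section \<open>Reachability expressed by self-adjoint elements of the algebra\<close>

context
  fixes M :: "('h::complex_hilbert \<Rightarrow> 'h) set" and V0 :: "'h unbounded_op" and hbar :: real
  assumes M: "von_neumann_algebra M" and V0: "self_adjoint_op V0" "affiliated V0 M"
begin

abbreviation (input) "U \<equiv> evolution hbar V0"

lemmas U = evolution_unitary_group[OF V0 M, where hbar = hbar]

lemma U_clinear: "bounded_clinear (U t)"
  by (rule von_neumann_clinear[OF M U(1)])

lemma U_inverse: "U (- t) (U t x) = x" "U t (U (- t) x) = x"
  using U(2)[of "- t" t x] U(2)[of t "- t" x] by (simp_all add: U(3))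

lemma norm_U: "norm (U t x) = norm x"
proof -
  have "cinner (U t x) (U t x) = cinner x x" by (simp add: U(4) U_inverse)
  then have "(norm (U t x))\<^sup>2 = (norm x)\<^sup>2" unfolding cinner_self by (simp only: of_real_eq_iff)
  then show ?thesis by (simp add: power2_eq_iff_nonneg)
qed

lemma U_commutant: "S \<in> commutant M \<Longrightarrow> S (U t x) = U t (S x)"
  by (rule commutantD[OF _ U(1)])

text \<open>The operator does not depend on the initial vector. Linearity, symmetry and commutation
  with the commutant hold for the integrand and pass through the integral, since bounded linear maps
  do; the double commutant then gives membership in \<open>M\<close>.\<close>

lemma control_integral_eq_sa_ball:
  assumes V: "V \<in> admissible_controls M N S" and "0 \<le> S"
  shows "\<exists>A\<in>sa_ball M (N * S). \<forall>\<xi>0. control_integral hbar V0 \<xi>0 S V = U S (A \<xi>0)"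
proof -
  let ?I = "{0..S}"
  have VM: "V t \<in> M" and V_on: "onorm (V t) \<le> N"
    and V_sa: "self_adjoint_op (graph_of (V t))" if "t \<in> ?I" for t
    using V that unfolding admissible_controls_def control_function_def by auto
  have cont: "continuous_on ?I (\<lambda>t. V t x)" for x
    using V unfolding admissible_controls_def by auto
  have Vc: "bounded_clinear (V t)" if "t \<in> ?I" for t
    by (rule von_neumann_clinear[OF M VM[OF that]])
  have V_norm: "norm (V t x) \<le> N * norm x" if "t \<in> ?I" for t x
    using onorm[OF bounded_clinear_bounded_linear[OF Vc[OF that]], of x]
      mult_right_mono[OF V_on[OF that], of "norm x"] by simp
  have V_sym: "cinner (V t x) y = cinner x (V t y)" if "t \<in> ?I" for t x y
    by (rule sa_symmetric[OF V_sa[OF that]]) (auto simp: graph_of_def)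
  \<comment> \<open>The control in the interaction picture; \<open>U (S - s)\<close> splits as
    \<open>U S\<close> after \<open>U (- s)\<close>, so \<open>U S\<close> can be pulled out of the
    integral.\<close>
  define g where "g x s = U (- s) (V s (U s x))" for x s
  have g_norm: "norm (g x s) \<le> N * norm x" if "s \<in> ?I" for x s
    unfolding g_def norm_U using V_norm[OF that, of "U s x"] by (simp add: norm_U)
  have g_cont: "continuous_on ?I (g x)" for x
  proof -
    have c1: "continuous_on ?I (\<lambda>s. V s (U s x))"
      by (rule continuous_on_strong_compose[OF Vc V_norm cont U(5)])
    have c2: "continuous_on ?I (\<lambda>s. U (- s) v)" for v
      by (rule continuous_on_compose2[OF U(5)[of UNIV v]]) (auto intro: continuous_intros)
    show ?thesis
      unfolding g_def by (rule continuous_on_strong_compose[OF U_clinear _ c2 c1, of 1]) (simp add: norm_U)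
  qed
  note g_int = integrable_continuous_interval[OF g_cont]
  have lin: "integral ?I (\<lambda>s. h (g x s)) = h (integral ?I (g x))" if "bounded_linear h" for h :: "'h \<Rightarrow> 'b::banach" and x
    using integral_linear[OF g_int that] by (simp add: comp_def)
  define A where "A x = integral ?I (g x)" for x
  have A_norm: "norm (A x) \<le> (N * S) * norm x" for x
    using integral_bound[OF \<open>0 \<le> S\<close> g_cont, of x "N * norm x"] g_norm unfolding A_def by (simp add: mult_ac)
  have Ac: "bounded_clinear A"
  proof (rule bounded_clinearI[OF _ _ A_norm])
    show "A (x + y) = A x + A y" for x y
    proof -
      have "A (x + y) = integral ?I (\<lambda>s. g x s + g y s)"
        unfolding A_def by (rule integral_cong)
          (simp add: g_def bounded_clinear_add[OF U_clinear] bounded_clinear_add[OF Vc])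
      then show ?thesis unfolding A_def by (simp add: integral_add[OF g_int g_int])
    qed
    show "A (c *\<^sub>C x) = c *\<^sub>C A x" for c x
    proof -
      have "A (c *\<^sub>C x) = integral ?I (\<lambda>s. c *\<^sub>C g x s)"
        unfolding A_def by (rule integral_cong)
          (simp add: g_def bounded_clinear_scaleC[OF U_clinear] bounded_clinear_scaleC[OF Vc])
      then show ?thesis unfolding A_def using lin[OF scaleC.bounded_linear_right] by simp
    qed
  qed
  have g_sym: "cinner (g x s) y = cinner x (g y s)" if "s \<in> ?I" for x y s
    unfolding g_def by (simp add: U(4) V_sym[OF that])
  have A_sym: "cinner (A x) y = cinner x (A y)" for x y
  proof -
    have "cinner (A x) y = integral ?I (\<lambda>s. cinner (g x s) y)"
      unfolding A_def by (rule lin[OF cinner.bounded_linear_left, symmetric])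
    also have "\<dots> = integral ?I (\<lambda>s. cinner x (g y s))"
      by (rule integral_cong) (rule g_sym)
    also have "\<dots> = cinner x (A y)"
      unfolding A_def by (rule lin[OF cinner.bounded_linear_right])
    finally show ?thesis .
  qed
  have "A \<in> M"
  proof (rule von_neumann_memI[OF M Ac])
    fix T x assume T: "T \<in> commutant M"
    have "A (T x) = integral ?I (\<lambda>s. T (g x s))"
      unfolding A_def by (rule integral_cong) (simp add: g_def U_commutant[OF T] commutantD[OF T VM])
    also have "\<dots> = T (A x)"
      unfolding A_def by (rule lin[OF bounded_clinear_bounded_linear[OF commutant_clinear[OF T]]])
    finally show "A (T x) = T (A x)" .
  qed
  then have "A \<in> sa_ball M (N * S)" unfolding sa_ball_def using A_sym A_norm by blast
  moreover have "control_integral hbar V0 \<xi>0 S V = U S (A \<xi>0)" for \<xi>0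
  proof -
    have "control_integral hbar V0 \<xi>0 S V = integral ?I (\<lambda>s. U S (g \<xi>0 s))"
      unfolding control_integral_def g_def
      by (rule integral_cong) (simp add: U(2)[of S "- s" for s, symmetric])
    then show ?thesis unfolding A_def using lin[OF bounded_clinear_bounded_linear[OF U_clinear]] by simp
  qed
  ultimately show ?thesis by blast
qed

text \<open>For \<open>S = 0\<close> the control below is \<open>0\<close>, because \<open>1 / 0 = 0\<close>; then also \<open>A = 0\<close>.\<close>

lemma sa_ball_eq_control_integral:
  assumes A: "A \<in> sa_ball M (N * S)" and S: "0 \<le> S" and N: "0 < N"
  shows "\<exists>V\<in>admissible_controls M N S. \<forall>\<xi>0. control_integral hbar V0 \<xi>0 S V = U S (A \<xi>0)"
proof -
  note AD = sa_ballD[OF A]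
  have Ac: "bounded_clinear A" by (rule von_neumann_clinear[OF M AD(1)])
  \<comment> \<open>Chosen constant in the interaction picture, with the total effect
    \<open>A\<close> spread evenly over the time \<open>S\<close>.\<close>
  define V where "V s x = U s ((1 / S) *\<^sub>R A (U (- s) x))" for s x
  have scaleR_C: "r *\<^sub>R x = complex_of_real r *\<^sub>C x" for r and x :: 'h
    by (simp add: scaleC_of_real)
  have V_norm: "norm (V s x) \<le> N * norm x" for s x
  proof (cases "S = 0")
    case True
    then show ?thesis using N unfolding V_def by (simp add: norm_U)
  next
    case False
    have "norm (V s x) = norm (A (U (- s) x)) / S" using S unfolding V_def by (simp add: norm_U)
    also have "\<dots> \<le> (N * S * norm x) / S"
      using AD(3)[of "U (- s) x"] S by (intro divide_right_mono) (simp_all add: norm_U)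
    finally show ?thesis using False by simp
  qed
  have Vc: "bounded_clinear (V s)" for s
    by (rule bounded_clinearI[OF _ _ V_norm])
       (simp_all add: V_def scaleR_C bounded_clinear_add[OF U_clinear] bounded_clinear_add[OF Ac]
         bounded_clinear_scaleC[OF U_clinear] bounded_clinear_scaleC[OF Ac] scaleC_add_right
         scaleC_scaleC mult.commute)
  have VM: "V s \<in> M" for s
  proof (rule von_neumann_memI[OF M Vc])
    fix T x assume T: "T \<in> commutant M"
    show "V s (T x) = T (V s x)"
      unfolding V_def scaleR_C
      by (simp add: U_commutant[OF T] commutantD[OF T AD(1)] bounded_clinear_scaleC[OF commutant_clinear[OF T]])
  qed
  have V_sym: "cinner (V s x) y = cinner x (V s y)" for s x y
    unfolding V_def scaleR_C
    by (simp add: U(4) cinner_scaleC_left cinner_scaleC_right AD(2) bounded_clinear_scaleC[OF U_clinear])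
  have V_cont: "continuous_on I (\<lambda>s. V s x)" for I x
  proof -
    have "continuous_on I (\<lambda>s. U (- s) x)"
      by (rule continuous_on_compose2[OF U(5)[of UNIV x]]) (auto intro: continuous_intros)
    then have "continuous_on I (\<lambda>s. A (U (- s) x))"
      by (rule bounded_linear.continuous_on[OF bounded_clinear_bounded_linear[OF Ac]])
    then have "continuous_on I (\<lambda>s. (1 / S) *\<^sub>R A (U (- s) x))" by (intro continuous_intros)
    then show ?thesis
      unfolding V_def by (rule continuous_on_strong_compose[OF U_clinear _ U(5), of _ 1, rotated]) (simp add: norm_U)
  qed
  have sa: "self_adjoint_op (graph_of (V s))" for s by (rule self_adjoint_graph_of[OF Vc V_sym])
  have L0: "graph_of (V s) \<in> L0 M" for s
  proof -
    have "closed (graph_of (V s))"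
      unfolding closed_sequential_limits
    proof (intro allI impI, elim conjE)
      fix p l assume p: "\<forall>n. p n \<in> graph_of (V s)" and l: "p \<longlonglongrightarrow> l"
      have "snd (p n) = V s (fst (p n))" for n using p[rule_format, of n] unfolding graph_of_def by auto
      moreover have "(\<lambda>n. V s (fst (p n))) \<longlonglongrightarrow> V s (fst l)"
        by (rule bounded_linear.tendsto[OF bounded_clinear_bounded_linear[OF Vc] tendsto_fst[OF l]])
      ultimately have "snd l = V s (fst l)" using LIMSEQ_unique[OF tendsto_snd[OF l]] by simp
      then show "l \<in> graph_of (V s)" unfolding graph_of_def by (cases l) auto
    qed
    moreover have "affiliated (graph_of (V s)) M"
      unfolding affiliated_def
    proof (intro ballI impI)
      fix u assume u: "u \<in> commutant M"
      have "u (V s x) = V s (u x)" for x by (rule commutantD[OF u VM])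
      then show "graph_of (V s) O graph_of u = graph_of u O graph_of (V s)"
        unfolding graph_of_def by auto
    qed
    ultimately show ?thesis
      unfolding L0_def using sa[of s] unfolding self_adjoint_op_def by blast
  qed
  have "V \<in> admissible_controls M N S"
    unfolding admissible_controls_def control_function_def
    using sa L0 VM V_cont onorm_bound[OF less_imp_le[OF N] V_norm]
    by (simp add: borel_measurable_lebesgue_on_continuous)
  moreover have "control_integral hbar V0 \<xi>0 S V = U S (A \<xi>0)" for \<xi>0
  proof -
    \<comment> \<open>The conjugations cancel and the integrand no longer depends on
      \<open>s\<close>.\<close>
    have "control_integral hbar V0 \<xi>0 S V = integral {0..S} (\<lambda>s. U S ((1 / S) *\<^sub>R A \<xi>0))"
      unfolding control_integral_def V_def U_inverse by (simp add: U(2)[symmetric])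
    also have "\<dots> = S *\<^sub>R U S ((1 / S) *\<^sub>R A \<xi>0)" using S by simp
    also have "\<dots> = U S (A \<xi>0)"
    proof (cases "S = 0")
      case True
      then have "norm (A \<xi>0) \<le> 0" using AD(3)[of \<xi>0] by simp
      then show ?thesis using True by (simp add: bounded_clinear_zero[OF U_clinear])
    next
      case False
      then show ?thesis
        unfolding scaleR_C bounded_clinear_scaleC[OF U_clinear] by (simp add: scaleC_scaleC)
    qed
    finally show ?thesis .
  qed
  ultimately show ?thesis by blast
qed

text \<open>For a fixed target the time enters only through the vector
  \<open>U (- S) \<xi> - \<xi>0\<close> and the radius \<open>N * S\<close>, both continuous in
  \<open>S\<close>. Convergence of the times to the infimum is therefore enough, and the limit time
  0 is covered too.\<close>

lemma minimal_time_control: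
  assumes N: "0 < N" and T: "T > 0" "reachable hbar M V0 \<xi>0 N T \<xi>"
    and Tstar: "Tstar = Inf {S. S \<ge> 0 \<and> reachable hbar M V0 \<xi>0 N S \<xi>}"
  shows "\<exists>V\<in>admissible_controls M N Tstar. \<xi> = U Tstar \<xi>0 + control_integral hbar V0 \<xi>0 Tstar V"
proof -
  define X where "X = {S. S \<ge> 0 \<and> reachable hbar M V0 \<xi>0 N S \<xi>}"
  have "T \<in> X" using T unfolding X_def by simp
  then have X: "X \<noteq> {}" "bdd_below X" by (auto simp: X_def intro: bdd_belowI[of _ 0])
  have T0: "0 \<le> Tstar" unfolding Tstar X_def[symmetric] using X(1) by (rule cInf_greatest) (simp add: X_def)
  have "\<exists>S\<in>X. S < Tstar + 1 / real (Suc n)" for n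
    using cInf_lessD[OF X(1), of "Tstar + 1 / real (Suc n)"] unfolding Tstar X_def[symmetric] by auto
  then obtain S where S: "\<And>n. S n \<in> X" "\<And>n. S n < Tstar + 1 / real (Suc n)" by metis
  have "S \<longlonglongrightarrow> Tstar"
  proof (rule tendsto_sandwich[OF _ _ tendsto_const[of Tstar]])
    show "\<forall>\<^sub>F n in sequentially. Tstar \<le> S n"
      unfolding Tstar X_def[symmetric] using S(1) X(2) by (intro always_eventually allI cInf_lower) auto
    show "\<forall>\<^sub>F n in sequentially. S n \<le> Tstar + 1 / real (Suc n)"
      using S(2) by (intro always_eventually allI less_imp_le)
    show "(\<lambda>n. Tstar + 1 / real (Suc n)) \<longlonglongrightarrow> Tstar"
      using tendsto_add[OF tendsto_const[of Tstar] LIMSEQ_inverse_real_of_nat]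
      by (simp add: inverse_eq_divide)
  qed
  have "\<exists>A\<in>sa_ball M (N * S n). A \<xi>0 = U (- S n) \<xi> - \<xi>0" for n
  proof -
    have Sn: "0 \<le> S n" "reachable hbar M V0 \<xi>0 N (S n) \<xi>" using S(1)[of n] unfolding X_def by auto
    then obtain V where V: "V \<in> admissible_controls M N (S n)"
      "\<xi> = U (S n) \<xi>0 + control_integral hbar V0 \<xi>0 (S n) V"
      unfolding reachable_def reachable_set_def by blast
    obtain A where A: "A \<in> sa_ball M (N * S n)" "control_integral hbar V0 \<xi>0 (S n) V = U (S n) (A \<xi>0)"
      using control_integral_eq_sa_ball[OF V(1) Sn(1)] by blast
    \<comment> \<open>Evolving backwards moves the target instead of the operator, so that the
      operators act on the fixed vector \<open>\<xi>0\<close>.\<close>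
    have "U (- S n) \<xi> = \<xi>0 + A \<xi>0"
      unfolding V(2) A(2) by (simp add: bounded_clinear_add[OF U_clinear] U_inverse)
    then show ?thesis using A(1) by (intro bexI[of _ A]) auto
  qed
  then obtain A where A: "\<And>n. A n \<in> sa_ball M (N * S n)" "\<And>n. A n \<xi>0 = U (- S n) \<xi> - \<xi>0" by metis
  have "(\<lambda>n. U (- S n) \<xi> - \<xi>0) \<longlonglongrightarrow> U (- Tstar) \<xi> - \<xi>0"
  proof (intro tendsto_intros)
    have "isCont (\<lambda>t. U t \<xi>) (- Tstar)"
      using U(5)[of UNIV \<xi>] by (simp add: continuous_on_eq_continuous_at)
    then show "(\<lambda>n. U (- S n) \<xi>) \<longlonglongrightarrow> U (- Tstar) \<xi>"
      by (rule isCont_tendsto_compose) (intro tendsto_intros \<open>S \<longlonglongrightarrow> Tstar\<close>)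
  qed
  then have lim: "(\<lambda>n. A n \<xi>0) \<longlonglongrightarrow> U (- Tstar) \<xi> - \<xi>0" unfolding A(2) .
  have "(\<lambda>n. N * S n) \<longlonglongrightarrow> N * Tstar" by (intro tendsto_intros \<open>S \<longlonglongrightarrow> Tstar\<close>)
  from sa_ball_weak_limit[OF M A(1) this lim]
  obtain B where B: "B \<in> sa_ball M (N * Tstar)" "B \<xi>0 = U (- Tstar) \<xi> - \<xi>0" by blast
  obtain V where V: "V \<in> admissible_controls M N Tstar" "control_integral hbar V0 \<xi>0 Tstar V = U Tstar (B \<xi>0)"
    using sa_ball_eq_control_integral[OF B(1) T0 N] by blast
  have "U Tstar \<xi>0 + control_integral hbar V0 \<xi>0 Tstar V = \<xi>"
    unfolding V(2) B(2) by (simp add: bounded_clinear_diff[OF U_clinear] U_inverse)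
  then show ?thesis using V(1) by (intro bexI[of _ V]) auto
qed

end

theorem theorem3p7:
  fixes hbar N T Tstar :: real
    and M :: "('h::complex_hilbert \<Rightarrow> 'h) set"
    and \<tau> :: "('h \<Rightarrow> 'h) \<Rightarrow> complex"
    and V0 :: "'h unbounded_op"
    and \<xi>0 \<xi> :: 'h
  assumes "hbar > 0"
    and "separable_hilbert TYPE('h)"
    and "infinite_dimensional TYPE('h)"
    and "finite_von_neumann_algebra M \<tau>"
    and "self_adjoint_op V0"
    and "V0 \<in> L0 M"
    and "T > 0"
    and "N > 0"
    and "reachable hbar M V0 \<xi>0 N T \<xi>"
    and "Tstar = Inf {S. S \<ge> 0 \<and> reachable hbar M V0 \<xi>0 N S \<xi>}"
  shows "\<exists>V\<in>admissible_controls M N Tstar.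
           \<xi> = evolution hbar V0 Tstar \<xi>0
             + integral {0..Tstar}
                 (\<lambda>s. evolution hbar V0 (Tstar - s) (V s (evolution hbar V0 s \<xi>0)))"
proof -
  have M: "von_neumann_algebra M" using assms(4) unfolding finite_von_neumann_algebra_def by blast
  have aff: "affiliated V0 M" using assms(6) unfolding L0_def by blast
  show ?thesis
    using minimal_time_control[OF M assms(5) aff assms(8,7,9,10)] unfolding control_integral_def .
qed

end
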